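(* Let $\Delta^L=\langle p_1,p_2,p_3\rangle$ and $\Delta^R=\langle p_1,p_2,p_4\rangle$ be nondegenerate triangles with disjoint interiors sharing the edge $[p_1,p_2]$, and write $p_4=\eta_1p_1+\eta_2p_2+\eta_3p_3$ with $\eta_1+\eta_2+\eta_3=1$. Let $s^L=\sum_{i=1}^{28}b^L_iB^L_i$ on $\Delta^L$ and $s^R=\sum_{i=1}^{28}b^R_iB^R_i$ on $\Delta^R$. Then: (i) $s^L$ and $s^R$ join continuously across $[p_1,p_2]$ if and only if $b^R_i=b^L_i$ for $i=1,2,4,7,10,13$; (ii) $s^L$ and $s^R$ join $C^1$ across $[p_1,p_2]$ if and only if they join continuously and $b^R_5=\eta_1b^L_1+\eta_2b^L_4+\eta_3b^L_5$, $b^R_{16}=(\eta_1+\tfrac{\eta_2}2)b^L_4+\tfrac{\eta_2}2b^L_{10}+\eta_3b^L_{16}$, $b^R_{19}=(\tfrac35\eta_1+\tfrac25\eta_2)b^L_{10}+(\tfrac25\eta_1+\tfrac35\eta_2)b^L_{13}+\eta_3b^L_{19}$, $b^R_{17}=(\tfrac{\eta_1}2+\eta_2)b^L_7+\tfrac{\eta_1}2b^L_{13}+\eta_3b^L_{17}$, $b^R_6=\eta_1b^L_7+\eta_2b^L_2+\eta_3b^L_6$.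
   Context: For a nondegenerate triangle $\Delta=\langle v_1,v_2,v_3\rangle$ with ordered vertices and area $|\Delta|$, define $v_{1,2}=\tfrac23v_2+\tfrac13v_3$, $v_{1,3}=\tfrac13v_2+\tfrac23v_3$, $v_{2,1}=\tfrac23v_1+\tfrac13v_3$, $v_{2,3}=\tfrac13v_1+\tfrac23v_3$, $v_{3,1}=\tfrac23v_1+\tfrac13v_2$, $v_{3,2}=\tfrac13v_1+\tfrac23v_2$. Simplex splines: for a multiset $\Xi=\{\xi_1,\dots,\xi_6\}\subset\mathbb R^2$ with convex hull of positive area, choose any simplex $\sigma\subset\mathbb R^5$ of positive volume whose vertices project (onto the first two coordinates, $\pi$) to the $\xi_i$, and set $M_\Xi(x)=\mathrm{vol}_3(\sigma\cap\pi^{-1}(x))/\mathrm{vol}_5(\sigma)$. The local basis of $\Delta$ is $B_i=w_iM_{\Xi_i}$ (on $\Delta$, boundary values by continuity from the interior), with $\Xi_1=\{v_1^{(4)},v_{3,1},v_{2,1}\}$, $\Xi_2=\{v_2^{(4)},v_{3,2},v_{1,2}\}$, $\Xi_3=\{v_3^{(4)},v_{1,3},v_{2,3}\}$, $\Xi_4=\{v_1^{(3)},v_{3,1},v_{3,2},v_{2,1}\}$, $\Xi_5=\{v_1^{(3)},v_{2,1},v_{2,3},v_{3,1}\}$, $\Xi_6=\{v_2^{(3)},v_{1,2},v_{1,3},v_{3,2}\}$, $\Xi_7=\{v_2^{(3)},v_{3,2},v_{3,1},v_{1,2}\}$, $\Xi_8=\{v_3^{(3)},v_{2,3},v_{2,1},v_{1,3}\}$,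 $\Xi_9=\{v_3^{(3)},v_{1,3},v_{1,2},v_{2,3}\}$, $\Xi_{10}=\{v_1^{(2)},v_{3,1},v_{3,2},v_2,v_{2,1}\}$, $\Xi_{11}=\{v_1^{(2)},v_{2,1},v_{2,3},v_3,v_{3,1}\}$, $\Xi_{12}=\{v_2^{(2)},v_{1,2},v_{1,3},v_3,v_{3,2}\}$, $\Xi_{13}=\{v_2^{(2)},v_{3,2},v_{3,1},v_1,v_{1,2}\}$, $\Xi_{14}=\{v_3^{(2)},v_{2,3},v_{2,1},v_1,v_{1,3}\}$, $\Xi_{15}=\{v_3^{(2)},v_{1,3},v_{1,2},v_2,v_{2,3}\}$, $\Xi_{16}=\{v_1^{(2)},v_{3,1},v_{3,2},v_{2,1},v_{2,3}\}$, $\Xi_{17}=\{v_2^{(2)},v_{3,2},v_{3,1},v_{1,2},v_{1,3}\}$, $\Xi_{18}=\{v_3^{(2)},v_{1,3},v_{1,2},v_{2,3},v_{2,1}\}$, $\Xi_{19}=\{v_1,v_2,v_{3,1},v_{3,2},v_{2,1},v_{1,2}\}$, $\Xi_{20}=\{v_2,v_3,v_{1,2},v_{1,3},v_{3,2},v_{2,3}\}$, $\Xi_{21}=\{v_3,v_1,v_{2,3},v_{2,1},v_{1,3},v_{3,1}\}$, $\Xi_{22}=\{v_1,v_{3,1},v_{3,2},v_{1,2},v_{2,3},v_{2,1}\}$, $\Xi_{23}=\{v_1,v_{2,1},v_{2,3},v_{1,3},v_{3,2},v_{3,1}\}$, $\Xi_{24}=\{v_2,v_{1,2},v_{1,3},v_{2,3},v_{3,1},v_{3,2}\}$,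 $\Xi_{25}=\{v_2,v_{3,1},v_{3,2},v_{1,2},v_{1,3},v_{2,1}\}$, $\Xi_{26}=\{v_3,v_{2,3},v_{2,1},v_{3,1},v_{1,2},v_{1,3}\}$, $\Xi_{27}=\{v_3,v_{1,2},v_{1,3},v_{2,3},v_{2,1},v_{3,2}\}$, $\Xi_{28}=\{v_{3,1},v_{3,2},v_{1,2},v_{1,3},v_{2,3},v_{2,1}\}$ (superscript $(m)$ = multiplicity $m$), and $w_i=\frac{|\Delta|}{15}c_i$, $c=(\tfrac16^{\times3},\tfrac13^{\times6},\tfrac12^{\times6},\tfrac23^{\times3},\tfrac56^{\times3},\tfrac23^{\times6},1)$. $B^L_i$ denotes this basis for $\Delta^L$ with $(v_1,v_2,v_3)=(p_1,p_2,p_3)$, and $B^R_i$ the basis for $\Delta^R$ with $(v_1,v_2,v_3)=(p_1,p_2,p_4)$. *)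

theory Defs
  imports "HOL-Analysis.Analysis"
begin

type_synonym pt = "real ^ 2"

text \<open>A knot multiset \<open>\<Xi>\<close> of 6 points in the plane is represented by a list of length 6.
  R^5 is modelled as \<open>real^2 \<times> real^3\<close>, the projection \<open>\<pi>\<close> onto the first two
  coordinates being \<open>fst\<close>.  A lifting simplex is a list of 6 points of R^5
  projecting to the knots (in order) whose convex hull has positive 5-volume.\<close>

definition simplex_lift :: "pt list \<Rightarrow> (pt \<times> (real ^ 3)) list \<Rightarrow> bool" where
  "simplex_lift Xi V \<longleftrightarrow> map fst V = Xi \<and> measure lebesgue (convex hull (set V)) > 0"

text \<open>M_Xi(x) = vol_3(sigma cap pi^-1(x)) / vol_5(sigma), for a chosen lifting simplex sigma
  (the value is independent of the choice).\<close>

definition simplex_spline :: "pt list \<Rightarrow> pt \<Rightarrow> real" where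
  "simplex_spline Xi x =
     (let V = (SOME V. simplex_lift Xi V) in
        measure lebesgue {y :: real ^ 3. (x, y) \<in> convex hull (set V)}
        / measure lebesgue (convex hull (set V)))"

definition knot_lists :: "pt \<Rightarrow> pt \<Rightarrow> pt \<Rightarrow> pt list list" where
  "knot_lists v1 v2 v3 =
    (let v12 = (2/3) *\<^sub>R v2 + (1/3) *\<^sub>R v3; v13 = (1/3) *\<^sub>R v2 + (2/3) *\<^sub>R v3;
         v21 = (2/3) *\<^sub>R v1 + (1/3) *\<^sub>R v3; v23 = (1/3) *\<^sub>R v1 + (2/3) *\<^sub>R v3;
         v31 = (2/3) *\<^sub>R v1 + (1/3) *\<^sub>R v2; v32 = (1/3) *\<^sub>R v1 + (2/3) *\<^sub>R v2
     in [ [v1,v1,v1,v1,v31,v21],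
          [v2,v2,v2,v2,v32,v12],
          [v3,v3,v3,v3,v13,v23],
          [v1,v1,v1,v31,v32,v21],
          [v1,v1,v1,v21,v23,v31],
          [v2,v2,v2,v12,v13,v32],
          [v2,v2,v2,v32,v31,v12],
          [v3,v3,v3,v23,v21,v13],
          [v3,v3,v3,v13,v12,v23],
          [v1,v1,v31,v32,v2,v21],
          [v1,v1,v21,v23,v3,v31],
          [v2,v2,v12,v13,v3,v32],
          [v2,v2,v32,v31,v1,v12],
          [v3,v3,v23,v21,v1,v13],
          [v3,v3,v13,v12,v2,v23],
          [v1,v1,v31,v32,v21,v23],
          [v2,v2,v32,v31,v12,v13],
          [v3,v3,v13,v12,v23,v21],
          [v1,v2,v31,v32,v21,v12],
          [v2,v3,v12,v13,v32,v23],
          [v3,v1,v23,v21,v13,v31],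
          [v1,v31,v32,v12,v23,v21],
          [v1,v21,v23,v13,v32,v31],
          [v2,v12,v13,v23,v31,v32],
          [v2,v31,v32,v12,v13,v21],
          [v3,v23,v21,v31,v12,v13],
          [v3,v12,v13,v23,v21,v32],
          [v31,v32,v12,v13,v23,v21] ])"

definition knots :: "pt \<Rightarrow> pt \<Rightarrow> pt \<Rightarrow> nat \<Rightarrow> pt list" where
  "knots v1 v2 v3 i = knot_lists v1 v2 v3 ! (i - 1)"

definition coef_list :: "real list" where
  "coef_list = [1/6,1/6,1/6, 1/3,1/3,1/3,1/3,1/3,1/3, 1/2,1/2,1/2,1/2,1/2,1/2,
                2/3,2/3,2/3, 5/6,5/6,5/6, 2/3,2/3,2/3,2/3,2/3,2/3, 1]"

definition tri_area :: "pt \<Rightarrow> pt \<Rightarrow> pt \<Rightarrow> real" where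
  "tri_area v1 v2 v3 = measure lebesgue (convex hull {v1, v2, v3})"

definition weight :: "pt \<Rightarrow> pt \<Rightarrow> pt \<Rightarrow> nat \<Rightarrow> real" where
  "weight v1 v2 v3 i = tri_area v1 v2 v3 / 15 * coef_list ! (i - 1)"

definition local_basis :: "pt \<Rightarrow> pt \<Rightarrow> pt \<Rightarrow> nat \<Rightarrow> pt \<Rightarrow> real" where
  "local_basis v1 v2 v3 i x =
    (let T = convex hull {v1, v2, v3};
         f = (\<lambda>y. weight v1 v2 v3 i * simplex_spline (knots v1 v2 v3 i) y)
     in if x \<in> interior T then f x else Lim (at x within interior T) f)"

definition tri_spline :: "pt \<Rightarrow> pt \<Rightarrow> pt \<Rightarrow> (nat \<Rightarrow> real) \<Rightarrow> pt \<Rightarrow> real" where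
  "tri_spline v1 v2 v3 b x = (\<Sum>i = 1..28. b i * local_basis v1 v2 v3 i x)"

definition glue :: "pt set \<Rightarrow> (pt \<Rightarrow> real) \<Rightarrow> (pt \<Rightarrow> real) \<Rightarrow> pt \<Rightarrow> real" where
  "glue TL sL sR x = (if x \<in> TL then sL x else sR x)"

definition joins_C0 :: "pt set \<Rightarrow> pt set \<Rightarrow> (pt \<Rightarrow> real) \<Rightarrow> (pt \<Rightarrow> real) \<Rightarrow> bool" where
  "joins_C0 TL TR sL sR \<longleftrightarrow> continuous_on (TL \<union> TR) (glue TL sL sR)"

definition joins_C1 :: "pt set \<Rightarrow> pt set \<Rightarrow> pt set \<Rightarrow> (pt \<Rightarrow> real) \<Rightarrow> (pt \<Rightarrow> real) \<Rightarrow> bool" where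
  "joins_C1 TL TR e sL sR \<longleftrightarrow> joins_C0 TL TR sL sR \<and>
     (\<forall>x\<in>e. \<exists>U. open U \<and> x \<in> U \<and> U \<subseteq> TL \<union> TR \<and>
        (\<exists>g'. (\<forall>y\<in>U. (glue TL sL sR has_derivative g' y) (at y)) \<and>
              (\<forall>v. continuous_on U (\<lambda>y. g' y v))))"

end

theory Submission
  imports Defs
begin

text \<open>Every simplex spline of the local basis restricts on the triangle to a sum of truncated cubes
  \<open>c (\<ell>\<^sub>+)\<^sup>3\<close>, where \<open>\<ell> = 0\<close> runs through the chords joining two of its knots on different edges: a chord
  carries only two knots, so the jump of the third derivative across it is constant, and it ends on the boundary.
  The formulas are verified by integrating the indicator of a triangle three times along knot directions.  They show that the basis
  functions are \<open>C\<^sup>2\<close> up to the boundary, so continuity and differentiability across the edge become equalities of values and of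
  transversal derivatives on the edge.  These are univariate splines with breakpoints at the edge knots, whose coefficients are compared
  on the three intervals of the edge.\<close>

section \<open>Truncated powers and integration along rays\<close>

text \<open>The definition of \<open>simplex_spline\<close> picks an unspecified lift, so the choice
  has to cancel before any formula can be proved. Over a point \<open>x\<close> the slice of the
  lifted simplex is an affine image of a fibre that depends only on the knots and the barycentric
  coordinates of \<open>x\<close>, and the linear part of this map is the same for all
  \<open>x\<close>. Its determinant therefore occurs in the slice volume and in the volume of the
  simplex alike, and drops out. The factor \<open>tri_area\<close> in \<open>weight\<close> cancels
  the size of the triangle, so both splines carry one common positive constant, under which the join
  conditions are invariant.

  The truncated cubes make sense on the whole plane. Replacing both splines by these global formulas
  gives each side genuine two-sided derivatives at the edge, which a spline given only on a closed
  triangle does not have. Across the edge the derivatives then differ by a multiple of one function,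
  and expanding it in the transversal traces of the basis functions 5, 16, 19, 17, 6 gives exactly
  five equations; the fractions in them are ratios of trace coefficients.\<close>

text \<open>For \<open>k = 0\<close> this is the indicator of the open half-line, so identities at level 0 hold only off the cut lines.\<close>

definition trunc_pow :: "nat \<Rightarrow> real \<Rightarrow> real" where
  "trunc_pow k y = (if 0 < y then y ^ k / fact k else 0)"

definition cut_spline :: "nat \<Rightarrow> (real \<times> (real ^ 'n)) list \<Rightarrow> real ^ 'n \<Rightarrow> real" where
  "cut_spline k L X = (\<Sum>(c, l)\<leftarrow>L. c * trunc_pow k (l \<bullet> X))"

text \<open>The derivative in direction \<open>v\<close> lowers the power and keeps the lines: this is why one list of cuts
  describes a spline together with all its iterated directional derivatives.\<close>

definition dir_cuts :: "real ^ 'n \<Rightarrow> (real \<times> (real ^ 'n)) list \<Rightarrow> (real \<times> (real ^ 'n)) list" where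
  "dir_cuts v L = map (\<lambda>(c, l). (c * (l \<bullet> v), l)) L"

lemma trunc_pow_nonpos: "y \<le> 0 \<Longrightarrow> trunc_pow k y = 0"
  by (simp add: trunc_pow_def)

lemma trunc_pow_Suc_has_derivative:
  assumes "y \<noteq> 0 \<or> 0 < k"
  shows "(trunc_pow (Suc k) has_real_derivative trunc_pow k y) (at y)"
proof (cases "y = 0")
  case False
  show ?thesis
  proof (cases "0 < y")
    case True
    have "((\<lambda>y. y ^ Suc k / fact (Suc k)) has_real_derivative trunc_pow k y) (at y)"
      using True by (auto intro!: derivative_eq_intros simp: trunc_pow_def field_simps simp del: power_Suc of_nat_Suc)
    moreover have "eventually (\<lambda>z. trunc_pow (Suc k) z = z ^ Suc k / fact (Suc k)) (nhds y)"
      using True by (intro eventually_mono[OF eventually_nhds_in_open[of "{0<..}" y]]) (auto simp: trunc_pow_def)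
    ultimately show ?thesis
      by (subst DERIV_cong_ev[OF refl _ refl]) auto
  next
    case neg: False
    have "((\<lambda>y. 0) has_real_derivative trunc_pow k y) (at y)"
      using neg by (auto simp: trunc_pow_def)
    moreover have "eventually (\<lambda>z. trunc_pow (Suc k) z = 0) (nhds y)"
      using neg False by (intro eventually_mono[OF eventually_nhds_in_open[of "{..<0}" y]]) (auto simp: trunc_pow_def)
    ultimately show ?thesis
      by (subst DERIV_cong_ev[OF refl _ refl]) auto
  qed
next
  case True
  with assms have k: "0 < k" by simp
  have "((\<lambda>h. trunc_pow (Suc k) h / h) \<longlongrightarrow> 0) (at 0)"
  proof (rule tendsto_rabs_zero_cancel, rule real_tendsto_sandwich)
    show "eventually (\<lambda>h. 0 \<le> \<bar>trunc_pow (Suc k) h / h\<bar>) (at 0)" by simp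
    show "eventually (\<lambda>h. \<bar>trunc_pow (Suc k) h / h\<bar> \<le> \<bar>h\<bar> ^ k) (at 0)"
    proof (rule always_eventually, rule)
      fix h :: real
      show "\<bar>trunc_pow (Suc k) h / h\<bar> \<le> \<bar>h\<bar> ^ k"
      proof (cases "0 < h")
        case True
        then have "\<bar>trunc_pow (Suc k) h / h\<bar> = h ^ k / fact (Suc k)"
          by (simp add: trunc_pow_def abs_mult)
        also have "\<dots> \<le> h ^ k / 1"
          using True by (intro divide_left_mono) (auto simp: fact_ge_1 simp del: fact_Suc)
        finally show ?thesis using True by simp
      qed (simp add: trunc_pow_def)
    qed
    show "((\<lambda>h. \<bar>h\<bar> ^ k) \<longlongrightarrow> 0) (at (0::real))"
      using k by (auto intro!: tendsto_eq_intros)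
  qed auto
  then show ?thesis
    using True k by (simp add: DERIV_def trunc_pow_def)
qed

lemma continuous_on_trunc_pow_Suc: "continuous_on A (trunc_pow (Suc k))"
proof -
  have "trunc_pow (Suc k) = (\<lambda>y. max 0 y ^ Suc k / fact (Suc k))"
    by (auto simp: trunc_pow_def max_def)
  then show ?thesis
    by (simp only:) (intro continuous_intros, auto)
qed

lemma continuous_on_trunc_pow_comp [continuous_intros]:
  "continuous_on A f \<Longrightarrow> continuous_on A (\<lambda>x. trunc_pow (Suc k) (f x))"
  by (rule continuous_on_compose2[OF continuous_on_trunc_pow_Suc[of UNIV]]) auto

lemma continuous_on_cut_spline_Suc: "continuous_on A (cut_spline (Suc k) L)"
  unfolding cut_spline_def
proof (induction L)
  case (Cons p L)
  then show ?case
    by (cases p) (auto intro!: continuous_intros)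
qed auto

text \<open>With a positive power left after differentiation there is no kink on the cut lines, so
  the derivative exists at every point of the space, also beyond the triangle. It is applied to
  cubes, that is with \<open>k = 2\<close>.\<close>

lemma cut_spline_has_derivative:
  assumes "0 < k"
  shows "(cut_spline (Suc k) L has_derivative (\<lambda>v. cut_spline k (dir_cuts v L) X)) (at X)"
  unfolding cut_spline_def dir_cuts_def
proof (induction L)
  case (Cons p L)
  obtain c l where p: "p = (c, l)" by force
  have "((\<lambda>X. trunc_pow (Suc k) (l \<bullet> X)) has_derivative (\<lambda>v. trunc_pow k (l \<bullet> X) * (l \<bullet> v))) (at X)"
    using trunc_pow_Suc_has_derivative[of "l \<bullet> X" k] assms
    by (intro has_derivative_compose[where f = "\<lambda>X. l \<bullet> X" and g = "trunc_pow (Suc k)"])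
       (auto intro!: derivative_eq_intros simp: has_field_derivative_def)
  then show ?case
    using Cons by (auto intro!: derivative_eq_intros simp: p algebra_simps)
qed auto

lemma cut_spline_ray_has_integral:
  fixes X v :: "real ^ 'n"
  assumes "0 \<le> T"
  shows "((\<lambda>t. cut_spline k (dir_cuts v L) (X - t *\<^sub>R v)) has_integral
           cut_spline (Suc k) L X - cut_spline (Suc k) L (X - T *\<^sub>R v)) {0..T}"
  unfolding cut_spline_def dir_cuts_def
proof (induction L)
  case (Cons p L)
  obtain c l where p: "p = (c, l)" by force
  have "((\<lambda>t. - (l \<bullet> v) * trunc_pow k (l \<bullet> X - t * (l \<bullet> v))) has_integral
           trunc_pow (Suc k) (l \<bullet> X - T * (l \<bullet> v)) - trunc_pow (Suc k) (l \<bullet> X - 0 * (l \<bullet> v))) {0..T}"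
  proof (cases "l \<bullet> v = 0")
    case False
    show ?thesis
    \<comment> \<open>For \<open>k = 0\<close> the integrand jumps where the ray crosses the line.
      The primitive stays continuous there, so one exceptional point is allowed.\<close>
    proof (rule fundamental_theorem_of_calculus_strong[where S = "{(l \<bullet> X) / (l \<bullet> v)}"])
      fix t assume "t \<in> {0..T} - {l \<bullet> X / (l \<bullet> v)}"
      then have "l \<bullet> X - t * (l \<bullet> v) \<noteq> 0"
        using False by (auto simp: field_simps)
      then have "((\<lambda>t. trunc_pow (Suc k) (l \<bullet> X - t * (l \<bullet> v))) has_real_derivative
          trunc_pow k (l \<bullet> X - t * (l \<bullet> v)) * (- (l \<bullet> v))) (at t)"
        by (intro DERIV_chain2[OF trunc_pow_Suc_has_derivative]) (auto intro!: derivative_eq_intros)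
      then show "((\<lambda>t. trunc_pow (Suc k) (l \<bullet> X - t * (l \<bullet> v))) has_vector_derivative
          - (l \<bullet> v) * trunc_pow k (l \<bullet> X - t * (l \<bullet> v))) (at t)"
        by (simp add: has_real_derivative_iff_has_vector_derivative[symmetric] mult.commute)
    next
      show "continuous_on {0..T} (\<lambda>t. trunc_pow (Suc k) (l \<bullet> X - t * (l \<bullet> v)))"
        by (intro continuous_intros)
    qed (use assms in auto)
  qed auto
  from has_integral_mult_right[OF this, of "- c"]
  have "((\<lambda>t. c * (l \<bullet> v) * trunc_pow k (l \<bullet> (X - t *\<^sub>R v))) has_integral
           c * trunc_pow (Suc k) (l \<bullet> X) - c * trunc_pow (Suc k) (l \<bullet> (X - T *\<^sub>R v))) {0..T}"
    by (simp add: inner_diff_right algebra_simps)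
  from has_integral_add[OF this Cons]
  show ?case by (simp add: p algebra_simps)
qed auto

text \<open>\<open>T\<close> is the smallest ratio \<open>X $ i / v $ i\<close> over the coordinates
  with \<open>v $ i \<noteq> 0\<close>. The coordinate attaining it decreases strictly, so after
  \<open>T\<close> the ray stays outside the orthant.\<close>

lemma ray_exit:
  fixes X v :: "real ^ 'n"
  assumes "\<And>i. 0 < X $ i" "\<And>i. 0 \<le> v $ i" "v \<noteq> 0"
  obtains T i where "0 < T" "v $ i \<noteq> 0" "(X - T *\<^sub>R v) $ i = 0"
    "\<And>j. 0 \<le> (X - T *\<^sub>R v) $ j" "\<And>t j. t < T \<Longrightarrow> 0 < (X - t *\<^sub>R v) $ j"
    "\<And>t. T < t \<Longrightarrow> (X - t *\<^sub>R v) $ i < 0"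
proof -
  let ?I = "{i. v $ i \<noteq> 0}"
  have "?I \<noteq> {}" using assms(3) by (auto simp: vec_eq_iff)
  then obtain i where i: "i \<in> ?I" and min: "\<And>j. j \<in> ?I \<Longrightarrow> X $ i / v $ i \<le> X $ j / v $ j"
    using ex_min_if_finite[of "(\<lambda>j. X $ j / v $ j) ` ?I"] by (fastforce simp: not_less)
  have vpos: "0 < v $ j" if "j \<in> ?I" for j using that assms(2)[of j] by auto
  define T where "T = X $ i / v $ i"
  have lt: "0 < (X - t *\<^sub>R v) $ j" if "t < T" for t j
  proof (cases "j \<in> ?I")
    case True
    then have "t < X $ j / v $ j" using min[of j] that by (simp add: T_def)
    then show ?thesis using vpos[OF True] by (simp add: field_simps)
  qed (use assms(1)[of j] in auto)
  have le: "0 \<le> (X - T *\<^sub>R v) $ j" for j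
  proof (cases "j \<in> ?I")
    case True
    then show ?thesis using min[of j] vpos[OF True] by (simp add: T_def field_simps)
  qed (use assms(1)[of j] in auto)
  show ?thesis
  proof (rule that[of T i])
    show "0 < T" using assms(1)[of i] vpos[OF i] by (simp add: T_def)
    show "(X - T *\<^sub>R v) $ i = 0" using i by (simp add: T_def)
    show "(X - t *\<^sub>R v) $ i < 0" if "T < t" for t
      using that vpos[OF i] by (simp add: T_def field_simps)
  qed (use i lt le in auto)
qed

text \<open>Adding a knot \<open>v\<close> to a simplex spline integrates it along the rays in direction \<open>- v\<close>.  The truncated power
  representation is only valid inside the triangle, so the primitive must vanish where the ray leaves it.\<close>

lemma ray_integral_step:
  fixes f :: "real ^ 'n \<Rightarrow> ennreal" and v X :: "real ^ 'n"
  assumes v: "\<And>i. 0 \<le> v $ i" "v \<noteq> 0"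
    and out: "\<And>Y i. Y $ i < 0 \<Longrightarrow> f Y = 0"
    and ins: "\<And>Y. \<lbrakk>\<And>i. 0 < Y $ i; \<And>c l. \<lbrakk>(c, l) \<in> set L; l \<bullet> v \<noteq> 0\<rbrakk> \<Longrightarrow> l \<bullet> Y \<noteq> 0\<rbrakk>
        \<Longrightarrow> f Y = ennreal (cut_spline k (dir_cuts v L) Y) \<and> 0 \<le> cut_spline k (dir_cuts v L) Y"
    and bdy: "\<And>Y i. \<lbrakk>\<And>j. 0 \<le> Y $ j; Y $ i = 0; v $ i \<noteq> 0\<rbrakk> \<Longrightarrow> cut_spline (Suc k) L Y = 0"
    and X: "\<And>i. 0 < X $ i"
  shows "(\<integral>\<^sup>+t. indicator {0..} t * f (X - t *\<^sub>R v) \<partial>lborel) = ennreal (cut_spline (Suc k) L X)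
         \<and> 0 \<le> cut_spline (Suc k) L X"
proof -
  obtain T i where T: "0 < T" "v $ i \<noteq> 0" "(X - T *\<^sub>R v) $ i = 0"
    "\<And>j. 0 \<le> (X - T *\<^sub>R v) $ j" "\<And>t j. t < T \<Longrightarrow> 0 < (X - t *\<^sub>R v) $ j"
    "\<And>t. T < t \<Longrightarrow> (X - t *\<^sub>R v) $ i < 0"
    using ray_exit[OF X v] by metis
  \<comment> \<open>The exit time and all crossings with cut lines. A line parallel to
    \<open>v\<close> contributes the harmless point 0, since division by zero gives 0.\<close>
  define E where "E = insert T ((\<lambda>(c, l). (l \<bullet> X) / (l \<bullet> v)) ` set L)"
  define g where "g t = cut_spline k (dir_cuts v L) (X - t *\<^sub>R v)" for t
  \<comment> \<open>Nonnegativity of \<open>g\<close> is known only away from \<open>E\<close>,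
    while passing to the nonnegative integral asks for it on all of \<open>{0..T}\<close>; changing
    finitely many values repairs this.\<close>
  define h where "h t = (if t \<in> E then 0 else g t)" for t
  have E: "finite E" by (auto simp: E_def)
  have good: "f (X - t *\<^sub>R v) = ennreal (g t) \<and> 0 \<le> g t" if "t \<in> {0..T} - E" for t
    unfolding g_def
  proof (rule ins)
    fix j show "0 < (X - t *\<^sub>R v) $ j" using that T(5)[of t j] by (auto simp: E_def)
  next
    fix c l assume cl: "(c, l) \<in> set L" and nz: "l \<bullet> v \<noteq> 0"
    show "l \<bullet> (X - t *\<^sub>R v) \<noteq> 0"
    proof
      assume "l \<bullet> (X - t *\<^sub>R v) = 0"
      then have "t = (l \<bullet> X) / (l \<bullet> v)" using nz by (simp add: inner_diff_right field_simps)
      then have "t \<in> E" using cl unfolding E_def by (auto intro!: image_eqI[of _ _ "(c, l)"])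
      then show False using that by simp
    qed
  qed
  have "(g has_integral cut_spline (Suc k) L X - cut_spline (Suc k) L (X - T *\<^sub>R v)) {0..T}"
    unfolding g_def by (rule cut_spline_ray_has_integral) (use T in simp)
  also have "cut_spline (Suc k) L (X - T *\<^sub>R v) = 0"
    by (rule bdy[of _ i]) (use T in auto)
  finally have g: "(g has_integral cut_spline (Suc k) L X) {0..T}" by simp
  have h: "(h has_integral cut_spline (Suc k) L X) {0..T}"
    by (rule has_integral_spike[OF negligible_finite[OF E] _ g]) (auto simp: h_def)
  have hnn: "0 \<le> h t" if "t \<in> {0..T}" for t
    using good[of t] that by (auto simp: h_def)
  have "(\<integral>\<^sup>+t. indicator {0..} t * f (X - t *\<^sub>R v) \<partial>lborel)
        = (\<integral>\<^sup>+t. ennreal (h t) * indicator {0..T} t \<partial>lborel)"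
  proof (rule nn_integral_cong_AE)
    have "AE t in lborel. t \<notin> E"
      using E by (intro AE_not_in) (auto intro: finite_imp_null_set_lborel)
    then show "AE t in lborel. indicator {0..} t * f (X - t *\<^sub>R v) = ennreal (h t) * indicator {0..T} t"
    proof eventually_elim
      case (elim t)
      show ?case
      proof (cases "t \<in> {0..T}")
        case True
        then show ?thesis using good[of t] elim by (simp add: h_def)
      next
        case False
        then show ?thesis
          using out[of "X - t *\<^sub>R v" i] T(6)[of t] by (auto simp: indicator_def)
      qed
    qed
  qed
  also have "\<dots> = ennreal (cut_spline (Suc k) L X)"
    by (rule nn_integral_has_integral_lebesgue'[OF hnn h])
  finally show ?thesis
    using has_integral_nonneg[OF h hnn] by simp
qed

section \<open>Knot volumes\<close>

lemma trunc_pow_nonneg: "0 < k \<Longrightarrow> 0 \<le> y \<Longrightarrow> trunc_pow k y = y ^ k / fact k"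
  by (auto simp: trunc_pow_def)

definition det3 :: "real ^ 3 \<Rightarrow> real ^ 3 \<Rightarrow> real ^ 3 \<Rightarrow> real" where
  "det3 x y z = x $ 1 * (y $ 2 * z $ 3 - y $ 3 * z $ 2) - x $ 2 * (y $ 1 * z $ 3 - y $ 3 * z $ 1)
     + x $ 3 * (y $ 1 * z $ 2 - y $ 2 * z $ 1)"

text \<open>The quotients are the coordinates of \<open>Y\<close> given by Cramer's rule. For
  concrete vectors membership thus unfolds to signs of linear forms; \<open>mem_cone3\<close>
  recovers the nonnegative combinations of \<open>d\<close>, \<open>e\<close>,
  \<open>f\<close>.\<close>

definition cone3 :: "real ^ 3 \<Rightarrow> real ^ 3 \<Rightarrow> real ^ 3 \<Rightarrow> (real ^ 3) set" where
  "cone3 d e f = {Y. 0 \<le> det3 Y e f / det3 d e f \<and> 0 \<le> det3 d Y f / det3 d e f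
                    \<and> 0 \<le> det3 d e Y / det3 d e f}"

lemma cramer3:
  assumes "det3 d e f \<noteq> 0"
  shows "Y = (det3 Y e f / det3 d e f) *\<^sub>R d + (det3 d Y f / det3 d e f) *\<^sub>R e
           + (det3 d e Y / det3 d e f) *\<^sub>R f"
proof -
  have "det3 d e f *\<^sub>R Y = det3 Y e f *\<^sub>R d + det3 d Y f *\<^sub>R e + det3 d e Y *\<^sub>R f"
    by (simp add: vec_eq_iff forall_3 det3_def algebra_simps)
  then have "(1 / det3 d e f) *\<^sub>R (det3 d e f *\<^sub>R Y)
     = (1 / det3 d e f) *\<^sub>R (det3 Y e f *\<^sub>R d + det3 d Y f *\<^sub>R e + det3 d e Y *\<^sub>R f)"
    by simp
  then show ?thesis using assms by (simp add: scaleR_add_right)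
qed

lemma cone3_nonneg:
  assumes "det3 d e f \<noteq> 0" "\<And>i. 0 \<le> d $ i" "\<And>i. 0 \<le> e $ i" "\<And>i. 0 \<le> f $ i" "Y \<in> cone3 d e f"
  shows "0 \<le> Y $ i"
proof -
  have "0 \<le> (det3 Y e f / det3 d e f) * d $ i + (det3 d Y f / det3 d e f) * e $ i
      + (det3 d e Y / det3 d e f) * f $ i"
    using assms by (intro add_nonneg_nonneg mult_nonneg_nonneg) (auto simp: cone3_def)
  then show ?thesis
    by (subst cramer3[OF assms(1), of Y]) simp
qed

text \<open>Up to normalisation, the simplex spline with knots \<open>a, \<dots>, f\<close>: the volume of
  \<open>{(s, t, u) \<ge> 0. X - s a - t b - u c \<in> cone (d, e, f)}\<close>.\<close>

definition knot_vol :: "real ^ 3 \<Rightarrow> real ^ 3 \<Rightarrow> real ^ 3 \<Rightarrow> real ^ 3 \<Rightarrow> real ^ 3 \<Rightarrow> real ^ 3 \<Rightarrow> real ^ 3 \<Rightarrow> ennreal" where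
  "knot_vol a b c d e f X =
    (\<integral>\<^sup>+s. indicator {0..} s *
      (\<integral>\<^sup>+t. indicator {0..} t *
        (\<integral>\<^sup>+u. indicator {0..} u * indicator (cone3 d e f) (X - s *\<^sub>R a - t *\<^sub>R b - u *\<^sub>R c) \<partial>lborel)
       \<partial>lborel) \<partial>lborel)"

definition scale_cuts :: "real \<Rightarrow> (real \<times> (real ^ 'n)) list \<Rightarrow> (real \<times> (real ^ 'n)) list" where
  "scale_cuts r L = map (\<lambda>(c, l). (r * c, l)) L"

lemma cut_spline_scale_cuts: "cut_spline k (scale_cuts r L) X = r * cut_spline k L X"
  unfolding cut_spline_def scale_cuts_def by (induction L) (auto simp: algebra_simps)

lemma dir_cuts_scale_cuts: "dir_cuts v (scale_cuts r L) = scale_cuts r (dir_cuts v L)"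
  unfolding dir_cuts_def scale_cuts_def by (induction L) (auto simp: algebra_simps)

text \<open>The boundary condition of \<open>ray_integral_step\<close>: a ray in direction
  \<open>- v\<close> can leave the orthant only through a face with
  \<open>v $ i \<noteq> 0\<close>.\<close>

definition vanishes :: "nat \<Rightarrow> (real \<times> (real ^ 'n)) list \<Rightarrow> real ^ 'n \<Rightarrow> bool" where
  "vanishes k L v \<longleftrightarrow> (\<forall>Y i. (\<forall>j. 0 \<le> Y $ j) \<longrightarrow> Y $ i = 0 \<longrightarrow> v $ i \<noteq> 0 \<longrightarrow> cut_spline k L Y = 0)"

lemma vanishesD:
  "\<lbrakk>vanishes k L v; \<And>j. 0 \<le> Y $ j; Y $ i = 0; v $ i \<noteq> 0\<rbrakk> \<Longrightarrow> cut_spline k L Y = 0"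
  by (auto simp: vanishes_def)

text \<open>\<open>ray_integral_step\<close> is applied from the inside out, along \<open>c\<close>,
  \<open>b\<close> and \<open>a\<close>, raising the power from 0 to 3. The determinant is moved
  into the list first, so that the innermost function is exactly the indicator of the cone. Its
  formula may fail on lines transversal to \<open>c\<close>, but one integration already removes
  these exceptions.\<close>

lemma knot_vol_eq:
  assumes det: "det3 d e f \<noteq> 0"
    and nn: "\<And>i. 0 \<le> a $ i" "\<And>i. 0 \<le> b $ i" "\<And>i. 0 \<le> c $ i"
      "\<And>i. 0 \<le> d $ i" "\<And>i. 0 \<le> e $ i" "\<And>i. 0 \<le> f $ i"
    and nz: "a \<noteq> 0" "b \<noteq> 0" "c \<noteq> 0"
    and base: "\<And>Y. \<lbrakk>\<And>i. 0 < Y $ i; list_all (\<lambda>(r, l). l \<bullet> c \<noteq> 0 \<longrightarrow> l \<bullet> Y \<noteq> 0) L\<rbrakk>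
        \<Longrightarrow> \<bar>det3 d e f\<bar> * cut_spline 0 (dir_cuts c (dir_cuts b (dir_cuts a L))) Y = indicator (cone3 d e f) Y"
    and van: "vanishes 3 L a" "vanishes 2 (dir_cuts a L) b" "vanishes 1 (dir_cuts b (dir_cuts a L)) c"
    and X: "\<And>i. 0 < X $ i"
  shows "knot_vol a b c d e f X = ennreal (\<bar>det3 d e f\<bar> * cut_spline 3 L X) \<and> 0 \<le> cut_spline 3 L X"
proof -
  let ?r = "\<bar>det3 d e f\<bar>"
  let ?L = "scale_cuts ?r L"
  define f1 where "f1 Y = (\<integral>\<^sup>+u. indicator {0..} u * indicator (cone3 d e f) (Y - u *\<^sub>R c) \<partial>lborel)" for Y
  define f2 where "f2 Y = (\<integral>\<^sup>+t. indicator {0..} t * f1 (Y - t *\<^sub>R b) \<partial>lborel)" for Y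
  have out0: "indicator (cone3 d e f) Y = (0::ennreal)" if "Y $ i < 0" for Y i
    using cone3_nonneg[OF det nn(4-6), of Y i] that by (auto simp: indicator_def)
  have out1: "f1 Y = 0" if "Y $ i < 0" for Y i
  proof -
    have "(Y - u *\<^sub>R c) $ i < 0" if "0 \<le> u" for u
      using \<open>Y $ i < 0\<close> mult_nonneg_nonneg[OF that nn(3)[of i]] by simp
    then have "indicator {0..} u * indicator (cone3 d e f) (Y - u *\<^sub>R c) = (0::ennreal)" for u
      using out0[of "Y - u *\<^sub>R c" i] by (cases "0 \<le> u") auto
    then show ?thesis unfolding f1_def by (simp only: nn_integral_const mult_zero_left)
  qed
  have out2: "f2 Y = 0" if "Y $ i < 0" for Y i
  proof -
    have "(Y - u *\<^sub>R b) $ i < 0" if "0 \<le> u" for u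
      using \<open>Y $ i < 0\<close> mult_nonneg_nonneg[OF that nn(2)[of i]] by simp
    then have "indicator {0..} u * f1 (Y - u *\<^sub>R b) = (0::ennreal)" for u
      using out1[of "Y - u *\<^sub>R b" i] by (cases "0 \<le> u") auto
    then show ?thesis unfolding f2_def by (simp only: nn_integral_const mult_zero_left)
  qed
  have s1: "f1 Y = ennreal (cut_spline (Suc 0) (dir_cuts b (dir_cuts a ?L)) Y) \<and> 0 \<le> cut_spline (Suc 0) (dir_cuts b (dir_cuts a ?L)) Y"
    if Y: "\<And>i. 0 < Y $ i" for Y
    unfolding f1_def
  proof (rule ray_integral_step[OF nn(3) nz(3) out0 _ _ Y])
    fix Z :: "real ^ 3"
    assume Z: "\<And>i. 0 < Z $ i"
      and gen: "\<And>r l. \<lbrakk>(r, l) \<in> set (dir_cuts b (dir_cuts a ?L)); l \<bullet> c \<noteq> 0\<rbrakk> \<Longrightarrow> l \<bullet> Z \<noteq> 0"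
    have "?r * cut_spline 0 (dir_cuts c (dir_cuts b (dir_cuts a L))) Z = indicator (cone3 d e f) Z"
    proof (rule base[OF Z])
      have "l \<bullet> Z \<noteq> 0" if "(r, l) \<in> set L" "l \<bullet> c \<noteq> 0" for r l
        using that
        by (intro gen[of "?r * r * (l \<bullet> a) * (l \<bullet> b)" l]) (force simp: dir_cuts_def scale_cuts_def image_iff)+
      then show "list_all (\<lambda>(r, l). l \<bullet> c \<noteq> 0 \<longrightarrow> l \<bullet> Z \<noteq> 0) L"
        by (auto simp: list_all_iff)
    qed
    then show "indicator (cone3 d e f) Z = ennreal (cut_spline 0 (dir_cuts c (dir_cuts b (dir_cuts a ?L))) Z)
        \<and> 0 \<le> cut_spline 0 (dir_cuts c (dir_cuts b (dir_cuts a ?L))) Z"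
      by (simp add: dir_cuts_scale_cuts cut_spline_scale_cuts indicator_def)
  next
    fix Z :: "real ^ 3" and i
    assume "\<And>j. 0 \<le> Z $ j" "Z $ i = 0" "c $ i \<noteq> 0"
    then show "cut_spline (Suc 0) (dir_cuts b (dir_cuts a ?L)) Z = 0"
      using vanishesD[OF van(3)] by (simp add: dir_cuts_scale_cuts cut_spline_scale_cuts)
  qed
  have s2: "f2 Y = ennreal (cut_spline (Suc (Suc 0)) (dir_cuts a ?L) Y) \<and> 0 \<le> cut_spline (Suc (Suc 0)) (dir_cuts a ?L) Y"
    if Y: "\<And>i. 0 < Y $ i" for Y
    unfolding f2_def
  proof (rule ray_integral_step[OF nn(2) nz(2) out1 _ _ Y])
    fix Z :: "real ^ 3" and i
    assume "\<And>j. 0 \<le> Z $ j" "Z $ i = 0" "b $ i \<noteq> 0"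
    then show "cut_spline (Suc (Suc 0)) (dir_cuts a ?L) Z = 0"
      using vanishesD[OF van(2)] by (simp add: dir_cuts_scale_cuts cut_spline_scale_cuts numeral_2_eq_2)
  qed (assumption, rule s1)
  have "(\<integral>\<^sup>+t. indicator {0..} t * f2 (X - t *\<^sub>R a) \<partial>lborel) = ennreal (cut_spline (Suc (Suc (Suc 0))) ?L X)
    \<and> 0 \<le> cut_spline (Suc (Suc (Suc 0))) ?L X"
  proof (rule ray_integral_step[OF nn(1) nz(1) out2 _ _ X])
    fix Z :: "real ^ 3" and i
    assume "\<And>j. 0 \<le> Z $ j" "Z $ i = 0" "a $ i \<noteq> 0"
    then show "cut_spline (Suc (Suc (Suc 0))) ?L Z = 0"
      using vanishesD[OF van(1)] by (simp add: cut_spline_scale_cuts numeral_3_eq_3)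
  qed (assumption, rule s2)
  then show ?thesis
    using det by (simp add: knot_vol_def f2_def f1_def cut_spline_scale_cuts numeral_3_eq_3 zero_le_mult_iff)
qed

text \<open>The knots divide an edge into three intervals, on each of which all cuts have constant sign.\<close>

lemma edge_cases:
  fixes y z :: real
  assumes "0 \<le> y" "0 \<le> z"
  obtains p q where "0 \<le> p" "0 \<le> q" "y = p + 2 * q" "z = q"
  | p q where "0 \<le> p" "0 \<le> q" "y = 2 * p + q" "z = p + 2 * q"
  | p q where "0 \<le> p" "0 \<le> q" "y = p" "z = 2 * p + q"
proof -
  consider "2 * z \<le> y" | "2 * y \<le> z" | "y < 2 * z" "z < 2 * y" by linarith
  then show thesis
  proof cases
    case 1
    then show thesis using that(1)[of "y - 2 * z" z] assms by simp
  next
    case 2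
    then show thesis using that(3)[of y "z - 2 * y"] assms by simp
  next
    case 3
    then show thesis using that(2)[of "(2 * y - z) / 3" "(2 * z - y) / 3"] by (simp add: field_simps)
  qed
qed

text \<open>Barycentric coordinates are scaled by 3, which makes all knots integral.\<close>

abbreviation k1 :: "real ^ 3" where "k1 \<equiv> vector [3, 0, 0]"
abbreviation k2 :: "real ^ 3" where "k2 \<equiv> vector [0, 3, 0]"
abbreviation k3 :: "real ^ 3" where "k3 \<equiv> vector [0, 0, 3]"
abbreviation k12 :: "real ^ 3" where "k12 \<equiv> vector [0, 2, 1]"
abbreviation k13 :: "real ^ 3" where "k13 \<equiv> vector [0, 1, 2]"
abbreviation k21 :: "real ^ 3" where "k21 \<equiv> vector [2, 0, 1]"
abbreviation k23 :: "real ^ 3" where "k23 \<equiv> vector [1, 0, 2]"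
abbreviation k31 :: "real ^ 3" where "k31 \<equiv> vector [2, 1, 0]"
abbreviation k32 :: "real ^ 3" where "k32 \<equiv> vector [1, 2, 0]"

text \<open>One list for each orbit of knot multisets under permutations of the vertices.  The forms are
  \<open>\<ell> = \<plusminus> det (e, f, \<cdot>)\<close> for the pairs of knots \<open>e, f\<close> not on a common edge, negative at a vertex outside the hull of
  the knots, and the coefficient of \<open>\<ell>\<close> is the inverse of the product of the values of \<open>\<ell>\<close> at the other four knots
  (after which common factors of \<open>\<ell>\<close> are cleared).\<close>

definition cuts1 :: "(real \<times> (real ^ 3)) list" where
  "cuts1 = [(1/81, vector [1, -2, -2])]"

definition cuts4 :: "(real \<times> (real ^ 3)) list" where
  "cuts4 = [(-1/81, vector [1, -2, -2]),
    (1/648, vector [2, -1, -4])]"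

definition cuts10 :: "(real \<times> (real ^ 3)) list" where
  "cuts10 = [(1/162, vector [1, -2, -2]),
    (-1/324, vector [2, -1, -4]),
    (1/54, vector [1, 0, -2])]"

definition cuts16 :: "(real \<times> (real ^ 3)) list" where
  "cuts16 = [(1/81, vector [1, -2, -2]),
    (-1/648, vector [2, -4, -1]),
    (-1/648, vector [2, -1, -4]),
    (1/648, vector [2, -1, -1])]"

definition cuts19 :: "(real \<times> (real ^ 3)) list" where
  "cuts19 = [(-1/36, vector [0, 1, -2]),
    (-1/36, vector [1, 0, -2]),
    (-1/324, vector [1, -2, -2]),
    (1/324, vector [-1, 2, -4]),
    (1/324, vector [2, -1, -4]),
    (-1/324, vector [-2, 1, -2]),
    (1/162, vector [1, 1, -2])]"

definition cuts22 :: "(real \<times> (real ^ 3)) list" where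
  "cuts22 = [(1/48, vector [0, 1, -2]),
    (-1/486, vector [-1, 2, -4]),
    (1/972, vector [2, -4, -1]),
    (-1/162, vector [1, -2, -2]),
    (1/648, vector [-2, 1, -2]),
    (-1/324, vector [2, -1, -1]),
    (1/648, vector [2, -1, -4]),
    (1/3888, vector [4, 1, -2]),
    (-1/162, vector [1, 1, -2])]"

definition cuts28 :: "(real \<times> (real ^ 3)) list" where
  "cuts28 = [(-1/972, vector [-1, 2, -4]),
    (1/162, vector [-1, 2, -1]),
    (-1/972, vector [2, -4, -1]),
    (1/324, vector [1, -2, -2]),
    (1/324, vector [-2, 1, -2]),
    (-1/972, vector [-4, 2, -1]),
    (1/162, vector [2, -1, -1]),
    (-1/972, vector [2, -1, -4]),
    (-1/972, vector [4, 1, -2]),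
    (1/162, vector [1, 1, -2]),
    (1/324, vector [2, 2, -1]),
    (-1/972, vector [1, 4, -2])]"

lemmas cuts_defs = cuts1_def cuts4_def cuts10_def cuts16_def cuts19_def cuts22_def cuts28_def

section \<open>Verification of the seven cut lists\<close>

text \<open>The two free coordinates of each face get names of their own, so that the hypotheses
  have the shape consumed by elimination with \<open>edge_cases\<close>.\<close>

lemma vanishes_face:
  fixes L :: "(real \<times> (real ^ 3)) list" and v :: "real ^ 3"
  assumes "\<And>y z Y. \<lbrakk>v $ 1 \<noteq> 0; 0 \<le> y; 0 \<le> z; Y $ 1 = 0; Y $ 2 = y; Y $ 3 = z\<rbrakk> \<Longrightarrow> cut_spline k L Y = 0"
    and "\<And>y z Y. \<lbrakk>v $ 2 \<noteq> 0; 0 \<le> y; 0 \<le> z; Y $ 1 = y; Y $ 2 = 0; Y $ 3 = z\<rbrakk> \<Longrightarrow> cut_spline k L Y = 0"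
    and "\<And>y z Y. \<lbrakk>v $ 3 \<noteq> 0; 0 \<le> y; 0 \<le> z; Y $ 1 = y; Y $ 2 = z; Y $ 3 = 0\<rbrakk> \<Longrightarrow> cut_spline k L Y = 0"
  shows "vanishes k L v"
  unfolding vanishes_def
proof (intro allI impI)
  fix Y :: "real ^ 3" and i :: 3
  assume "\<forall>j. 0 \<le> Y $ j" "Y $ i = 0" "v $ i \<noteq> 0"
  then show "cut_spline k L Y = 0"
    using assms exhaust_3[of i] by metis
qed

lemma cut_spline_Nil: "cut_spline k [] X = 0" by (simp add: cut_spline_def)
lemma cut_spline_Cons: "cut_spline k ((c, l) # L) X = c * trunc_pow k (l \<bullet> X) + cut_spline k L X" by (simp add: cut_spline_def)
lemma dir_cuts_Nil: "dir_cuts v [] = []" by (simp add: dir_cuts_def)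
lemma dir_cuts_Cons: "dir_cuts v ((c, l) # L) = (c * (l \<bullet> v), l) # dir_cuts v L" by (simp add: dir_cuts_def)
lemma inner_vector3: "vector [a, b, c] \<bullet> (Y :: real ^ 3) = a * Y $ 1 + b * Y $ 2 + c * Y $ 3"
  by (simp add: inner_vec_def sum_3)

lemma nonneg_vector3: "0 \<le> a \<Longrightarrow> 0 \<le> b \<Longrightarrow> 0 \<le> c \<Longrightarrow> 0 \<le> (vector [a, b, c] :: real ^ 3) $ i"
  using exhaust_3[of i] by auto

lemmas cut_spline_simps = cut_spline_Nil cut_spline_Cons dir_cuts_Nil dir_cuts_Cons inner_vector3 vector_3

text \<open>On each interval of a face every cut is a form in \<open>p, q \<ge> 0\<close> whose
  coefficients have one sign. Its truncated power is then zero or an ordinary power, and the claim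
  becomes a polynomial identity. The other six lists are treated alike.\<close>

lemma vanishes_cuts1:
  "vanishes 3 cuts1 k1"
  "vanishes 2 (dir_cuts k1 cuts1) k1"
  "vanishes 1 (dir_cuts k1 (dir_cuts k1 cuts1)) k1"
  by (rule vanishes_face; erule (1) edge_cases;
      simp only: cut_spline_simps cuts1_def; simp add: trunc_pow_nonpos;
      simp add: trunc_pow_nonneg fact_numeral algebra_simps power2_eq_square power3_eq_cube;
      (simp add: field_simps)?)+

text \<open>Differentiating in the direction of a knot kills every cut through that knot. A chord
  not joining two of the last three knots passes through one of the first three and disappears. What
  remains is one half-plane indicator here, and in the later lists a difference of two, because the
  third side of the base triangle lies on the boundary of the orthant.\<close>

lemma base_cuts1:
  assumes "\<And>i. 0 < Y $ i" "list_all (\<lambda>(r, l). l \<bullet> k1 \<noteq> 0 \<longrightarrow> l \<bullet> Y \<noteq> 0) cuts1"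
  shows "\<bar>det3 k21 k31 k1\<bar> * cut_spline 0 (dir_cuts k1 (dir_cuts k1 (dir_cuts k1 cuts1))) Y = indicator (cone3 k21 k31 k1) Y"
  using assms(1)[of 1] assms(1)[of 2] assms(1)[of 3] assms(2)
  by (simp add: cut_spline_simps cuts1_def trunc_pow_def cone3_def det3_def indicator_def; auto?)

lemma knot_vol_cuts1:
  assumes "\<And>i. 0 < X $ i"
  shows "knot_vol k1 k1 k1 k21 k31 k1 X = ennreal (\<bar>det3 k21 k31 k1\<bar> * cut_spline 3 cuts1 X) \<and> 0 \<le> cut_spline 3 cuts1 X"
  by (rule knot_vol_eq[OF _ _ _ _ _ _ _ _ _ _ base_cuts1 vanishes_cuts1 assms])
     (auto simp: det3_def forall_3 vec_eq_iff nonneg_vector3)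

lemma vanishes_cuts4:
  "vanishes 3 cuts4 k1"
  "vanishes 2 (dir_cuts k1 cuts4) k1"
  "vanishes 1 (dir_cuts k1 (dir_cuts k1 cuts4)) k1"
  by (rule vanishes_face; erule (1) edge_cases;
      simp only: cut_spline_simps cuts4_def; simp add: trunc_pow_nonpos;
      simp add: trunc_pow_nonneg fact_numeral algebra_simps power2_eq_square power3_eq_cube;
      (simp add: field_simps)?)+

lemma base_cuts4:
  assumes "\<And>i. 0 < Y $ i" "list_all (\<lambda>(r, l). l \<bullet> k1 \<noteq> 0 \<longrightarrow> l \<bullet> Y \<noteq> 0) cuts4"
  shows "\<bar>det3 k32 k21 k31\<bar> * cut_spline 0 (dir_cuts k1 (dir_cuts k1 (dir_cuts k1 cuts4))) Y = indicator (cone3 k32 k21 k31) Y"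
  using assms(1)[of 1] assms(1)[of 2] assms(1)[of 3] assms(2)
  by (simp add: cut_spline_simps cuts4_def trunc_pow_def cone3_def det3_def indicator_def; auto?)

lemma knot_vol_cuts4:
  assumes "\<And>i. 0 < X $ i"
  shows "knot_vol k1 k1 k1 k32 k21 k31 X = ennreal (\<bar>det3 k32 k21 k31\<bar> * cut_spline 3 cuts4 X) \<and> 0 \<le> cut_spline 3 cuts4 X"
  by (rule knot_vol_eq[OF _ _ _ _ _ _ _ _ _ _ base_cuts4 vanishes_cuts4 assms])
     (auto simp: det3_def forall_3 vec_eq_iff nonneg_vector3)

lemma vanishes_cuts10:
  "vanishes 3 cuts10 k2"
  "vanishes 2 (dir_cuts k2 cuts10) k1"
  "vanishes 1 (dir_cuts k1 (dir_cuts k2 cuts10)) k1"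
  by (rule vanishes_face; erule (1) edge_cases;
      simp only: cut_spline_simps cuts10_def; simp add: trunc_pow_nonpos;
      simp add: trunc_pow_nonneg fact_numeral algebra_simps power2_eq_square power3_eq_cube;
      (simp add: field_simps)?)+

lemma base_cuts10:
  assumes "\<And>i. 0 < Y $ i" "list_all (\<lambda>(r, l). l \<bullet> k1 \<noteq> 0 \<longrightarrow> l \<bullet> Y \<noteq> 0) cuts10"
  shows "\<bar>det3 k32 k21 k31\<bar> * cut_spline 0 (dir_cuts k1 (dir_cuts k1 (dir_cuts k2 cuts10))) Y = indicator (cone3 k32 k21 k31) Y"
  using assms(1)[of 1] assms(1)[of 2] assms(1)[of 3] assms(2)
  by (simp add: cut_spline_simps cuts10_def trunc_pow_def cone3_def det3_def indicator_def; auto?)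

lemma knot_vol_cuts10:
  assumes "\<And>i. 0 < X $ i"
  shows "knot_vol k2 k1 k1 k32 k21 k31 X = ennreal (\<bar>det3 k32 k21 k31\<bar> * cut_spline 3 cuts10 X) \<and> 0 \<le> cut_spline 3 cuts10 X"
  by (rule knot_vol_eq[OF _ _ _ _ _ _ _ _ _ _ base_cuts10 vanishes_cuts10 assms])
     (auto simp: det3_def forall_3 vec_eq_iff nonneg_vector3)

lemma vanishes_cuts16:
  "vanishes 3 cuts16 k23"
  "vanishes 2 (dir_cuts k23 cuts16) k1"
  "vanishes 1 (dir_cuts k1 (dir_cuts k23 cuts16)) k1"
  by (rule vanishes_face; erule (1) edge_cases;
      simp only: cut_spline_simps cuts16_def; simp add: trunc_pow_nonpos;
      simp add: trunc_pow_nonneg fact_numeral algebra_simps power2_eq_square power3_eq_cube;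
      (simp add: field_simps)?)+

lemma base_cuts16:
  assumes "\<And>i. 0 < Y $ i" "list_all (\<lambda>(r, l). l \<bullet> k1 \<noteq> 0 \<longrightarrow> l \<bullet> Y \<noteq> 0) cuts16"
  shows "\<bar>det3 k32 k21 k31\<bar> * cut_spline 0 (dir_cuts k1 (dir_cuts k1 (dir_cuts k23 cuts16))) Y = indicator (cone3 k32 k21 k31) Y"
  using assms(1)[of 1] assms(1)[of 2] assms(1)[of 3] assms(2)
  by (simp add: cut_spline_simps cuts16_def trunc_pow_def cone3_def det3_def indicator_def; auto?)

lemma knot_vol_cuts16:
  assumes "\<And>i. 0 < X $ i"
  shows "knot_vol k23 k1 k1 k32 k21 k31 X = ennreal (\<bar>det3 k32 k21 k31\<bar> * cut_spline 3 cuts16 X) \<and> 0 \<le> cut_spline 3 cuts16 X"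
  by (rule knot_vol_eq[OF _ _ _ _ _ _ _ _ _ _ base_cuts16 vanishes_cuts16 assms])
     (auto simp: det3_def forall_3 vec_eq_iff nonneg_vector3)

lemma vanishes_cuts19:
  "vanishes 3 cuts19 k12"
  "vanishes 2 (dir_cuts k12 cuts19) k2"
  "vanishes 1 (dir_cuts k2 (dir_cuts k12 cuts19)) k1"
  by (rule vanishes_face; erule (1) edge_cases;
      simp only: cut_spline_simps cuts19_def; simp add: trunc_pow_nonpos;
      simp add: trunc_pow_nonneg fact_numeral algebra_simps power2_eq_square power3_eq_cube;
      (simp add: field_simps)?)+

lemma base_cuts19:
  assumes "\<And>i. 0 < Y $ i" "list_all (\<lambda>(r, l). l \<bullet> k1 \<noteq> 0 \<longrightarrow> l \<bullet> Y \<noteq> 0) cuts19"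
  shows "\<bar>det3 k32 k21 k31\<bar> * cut_spline 0 (dir_cuts k1 (dir_cuts k2 (dir_cuts k12 cuts19))) Y = indicator (cone3 k32 k21 k31) Y"
  using assms(1)[of 1] assms(1)[of 2] assms(1)[of 3] assms(2)
  by (simp add: cut_spline_simps cuts19_def trunc_pow_def cone3_def det3_def indicator_def; auto?)

lemma knot_vol_cuts19:
  assumes "\<And>i. 0 < X $ i"
  shows "knot_vol k12 k2 k1 k32 k21 k31 X = ennreal (\<bar>det3 k32 k21 k31\<bar> * cut_spline 3 cuts19 X) \<and> 0 \<le> cut_spline 3 cuts19 X"
  by (rule knot_vol_eq[OF _ _ _ _ _ _ _ _ _ _ base_cuts19 vanishes_cuts19 assms])
     (auto simp: det3_def forall_3 vec_eq_iff nonneg_vector3)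

lemma vanishes_cuts22:
  "vanishes 3 cuts22 k12"
  "vanishes 2 (dir_cuts k12 cuts22) k23"
  "vanishes 1 (dir_cuts k23 (dir_cuts k12 cuts22)) k1"
  by (rule vanishes_face; erule (1) edge_cases;
      simp only: cut_spline_simps cuts22_def; simp add: trunc_pow_nonpos;
      simp add: trunc_pow_nonneg fact_numeral algebra_simps power2_eq_square power3_eq_cube;
      (simp add: field_simps)?)+

lemma base_cuts22:
  assumes "\<And>i. 0 < Y $ i" "list_all (\<lambda>(r, l). l \<bullet> k1 \<noteq> 0 \<longrightarrow> l \<bullet> Y \<noteq> 0) cuts22"
  shows "\<bar>det3 k32 k21 k31\<bar> * cut_spline 0 (dir_cuts k1 (dir_cuts k23 (dir_cuts k12 cuts22))) Y = indicator (cone3 k32 k21 k31) Y"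
  using assms(1)[of 1] assms(1)[of 2] assms(1)[of 3] assms(2)
  by (simp add: cut_spline_simps cuts22_def trunc_pow_def cone3_def det3_def indicator_def; auto?)

lemma knot_vol_cuts22:
  assumes "\<And>i. 0 < X $ i"
  shows "knot_vol k12 k23 k1 k32 k21 k31 X = ennreal (\<bar>det3 k32 k21 k31\<bar> * cut_spline 3 cuts22 X) \<and> 0 \<le> cut_spline 3 cuts22 X"
  by (rule knot_vol_eq[OF _ _ _ _ _ _ _ _ _ _ base_cuts22 vanishes_cuts22 assms])
     (auto simp: det3_def forall_3 vec_eq_iff nonneg_vector3)

lemma vanishes_cuts28:
  "vanishes 3 cuts28 k12"
  "vanishes 2 (dir_cuts k12 cuts28) k13"
  "vanishes 1 (dir_cuts k13 (dir_cuts k12 cuts28)) k23"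
  by (rule vanishes_face; erule (1) edge_cases;
      simp only: cut_spline_simps cuts28_def; simp add: trunc_pow_nonpos;
      simp add: trunc_pow_nonneg fact_numeral algebra_simps power2_eq_square power3_eq_cube;
      (simp add: field_simps)?)+

lemma base_cuts28:
  assumes "\<And>i. 0 < Y $ i" "list_all (\<lambda>(r, l). l \<bullet> k23 \<noteq> 0 \<longrightarrow> l \<bullet> Y \<noteq> 0) cuts28"
  shows "\<bar>det3 k32 k21 k31\<bar> * cut_spline 0 (dir_cuts k23 (dir_cuts k13 (dir_cuts k12 cuts28))) Y = indicator (cone3 k32 k21 k31) Y"
  using assms(1)[of 1] assms(1)[of 2] assms(1)[of 3] assms(2)
  by (simp add: cut_spline_simps cuts28_def trunc_pow_def cone3_def det3_def indicator_def; auto?)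

lemma knot_vol_cuts28:
  assumes "\<And>i. 0 < X $ i"
  shows "knot_vol k12 k13 k23 k32 k21 k31 X = ennreal (\<bar>det3 k32 k21 k31\<bar> * cut_spline 3 cuts28 X) \<and> 0 \<le> cut_spline 3 cuts28 X"
  by (rule knot_vol_eq[OF _ _ _ _ _ _ _ _ _ _ base_cuts28 vanishes_cuts28 assms])
     (auto simp: det3_def forall_3 vec_eq_iff nonneg_vector3)

section \<open>Barycentric coordinates\<close>

text \<open>Twice the signed area.\<close>

definition area2 :: "real ^ 2 \<Rightarrow> real ^ 2 \<Rightarrow> real ^ 2 \<Rightarrow> real" where
  "area2 p q r = (q $ 1 - p $ 1) * (r $ 2 - p $ 2) - (q $ 2 - p $ 2) * (r $ 1 - p $ 1)"

text \<open>Defined linearly on all of \<open>real ^ 3\<close>, although only vectors of coordinate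
  sum 3 are coordinates of points: partial sums of a convex combination have a smaller sum, and
  linearity splits them off.\<close>

definition bary_point :: "real ^ 2 \<Rightarrow> real ^ 2 \<Rightarrow> real ^ 2 \<Rightarrow> real ^ 3 \<Rightarrow> real ^ 2" where
  "bary_point v1 v2 v3 W = (W $ 1 / 3) *\<^sub>R v1 + (W $ 2 / 3) *\<^sub>R v2 + (W $ 3 / 3) *\<^sub>R v3"

definition coord_sum :: "real ^ 3 \<Rightarrow> real" where
  "coord_sum W = W $ 1 + W $ 2 + W $ 3"

definition bary_coords :: "real ^ 2 \<Rightarrow> real ^ 2 \<Rightarrow> real ^ 2 \<Rightarrow> real ^ 2 \<Rightarrow> real ^ 3" where
  "bary_coords v1 v2 v3 x = (3 / area2 v1 v2 v3) *\<^sub>R vector [area2 x v2 v3, area2 v1 x v3, area2 v1 v2 x]"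

lemma collinear_area2: "collinear {p, q, r} \<longleftrightarrow> area2 p q r = 0"
proof
  assume "collinear {p, q, r}"
  then have "p = r \<or> (\<exists>u. q = u *\<^sub>R p + (1 - u) *\<^sub>R r)" by (simp add: collinear_3_expand)
  then show "area2 p q r = 0"
  proof (elim disjE exE)
    fix u assume q: "q = u *\<^sub>R p + (1 - u) *\<^sub>R r"
    show ?thesis unfolding q by (simp add: area2_def algebra_simps)
  qed (simp add: area2_def algebra_simps)
next
  assume a: "area2 p q r = 0"
  show "collinear {p, q, r}"
  proof (cases "p = r")
    case False
    then consider "r $ 1 \<noteq> p $ 1" | "r $ 2 \<noteq> p $ 2" by (auto simp: vec_eq_iff forall_2)
    then have "\<exists>u. q = u *\<^sub>R p + (1 - u) *\<^sub>R r"
    proof cases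
      case 1
      have "(r $ 1 - p $ 1) *\<^sub>R q = (r $ 1 - q $ 1) *\<^sub>R p + (q $ 1 - p $ 1) *\<^sub>R r"
        using a by (simp add: vec_eq_iff forall_2 area2_def algebra_simps)
      then have "(1 / (r $ 1 - p $ 1)) *\<^sub>R ((r $ 1 - p $ 1) *\<^sub>R q)
          = ((r $ 1 - q $ 1) / (r $ 1 - p $ 1)) *\<^sub>R p + ((q $ 1 - p $ 1) / (r $ 1 - p $ 1)) *\<^sub>R r"
        by (simp add: scaleR_add_right)
      moreover have "(q $ 1 - p $ 1) / (r $ 1 - p $ 1) = 1 - (r $ 1 - q $ 1) / (r $ 1 - p $ 1)"
        using 1 by (simp add: field_simps)
      ultimately show ?thesis using 1 by auto
    next
      case 2
      have "(r $ 2 - p $ 2) *\<^sub>R q = (r $ 2 - q $ 2) *\<^sub>R p + (q $ 2 - p $ 2) *\<^sub>R r"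
        using a by (simp add: vec_eq_iff forall_2 area2_def algebra_simps)
      then have "(1 / (r $ 2 - p $ 2)) *\<^sub>R ((r $ 2 - p $ 2) *\<^sub>R q)
          = ((r $ 2 - q $ 2) / (r $ 2 - p $ 2)) *\<^sub>R p + ((q $ 2 - p $ 2) / (r $ 2 - p $ 2)) *\<^sub>R r"
        by (simp add: scaleR_add_right)
      moreover have "(q $ 2 - p $ 2) / (r $ 2 - p $ 2) = 1 - (r $ 2 - q $ 2) / (r $ 2 - p $ 2)"
        using 2 by (simp add: field_simps)
      ultimately show ?thesis using 2 by auto
    qed
    then show ?thesis by (simp add: collinear_3_expand)
  qed (simp add: collinear_3_expand)
qed

lemma bary_point_linear:
  "bary_point v1 v2 v3 (X + Y) = bary_point v1 v2 v3 X + bary_point v1 v2 v3 Y"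
  "bary_point v1 v2 v3 (r *\<^sub>R X) = r *\<^sub>R bary_point v1 v2 v3 X"
  by (simp_all add: bary_point_def algebra_simps add_divide_distrib)

lemma coord_sum_linear: "coord_sum (X + Y) = coord_sum X + coord_sum Y" "coord_sum (X - Y) = coord_sum X - coord_sum Y" "coord_sum (r *\<^sub>R X) = r * coord_sum X"
  by (simp_all add: coord_sum_def algebra_simps)

lemma bary_coords_bary_point:
  assumes "area2 v1 v2 v3 \<noteq> 0" "coord_sum W = 3"
  shows "bary_coords v1 v2 v3 (bary_point v1 v2 v3 W) = W"
proof -
  have W: "W $ 3 = 3 - W $ 1 - W $ 2" using assms by (simp add: coord_sum_def)
  have abc: "area2 (bary_point v1 v2 v3 W) v2 v3 = W $ 1 / 3 * area2 v1 v2 v3"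
    "area2 v1 (bary_point v1 v2 v3 W) v3 = W $ 2 / 3 * area2 v1 v2 v3"
    "area2 v1 v2 (bary_point v1 v2 v3 W) = W $ 3 / 3 * area2 v1 v2 v3"
    by (simp_all add: area2_def bary_point_def W field_simps)
  show ?thesis unfolding bary_coords_def abc using assms(1) by (simp add: vec_eq_iff forall_3)
qed

lemma coord_sum_bary_coords:
  assumes "area2 v1 v2 v3 \<noteq> 0" shows "coord_sum (bary_coords v1 v2 v3 x) = 3"
proof -
  have "area2 x v2 v3 + area2 v1 x v3 + area2 v1 v2 x = area2 v1 v2 v3"
    by (simp add: area2_def algebra_simps)
  then have "3 / area2 v1 v2 v3 * (area2 x v2 v3 + area2 v1 x v3 + area2 v1 v2 x) = 3"
    using assms by simp
  then show ?thesis by (simp add: coord_sum_def bary_coords_def algebra_simps add_divide_distrib)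
qed

lemma bary_point_bary_coords:
  assumes "area2 v1 v2 v3 \<noteq> 0" shows "bary_point v1 v2 v3 (bary_coords v1 v2 v3 x) = x"
proof -
  have "area2 x v2 v3 *\<^sub>R v1 + area2 v1 x v3 *\<^sub>R v2 + area2 v1 v2 x *\<^sub>R v3 = area2 v1 v2 v3 *\<^sub>R x"
    by (simp add: vec_eq_iff forall_2 area2_def algebra_simps)
  then have "(1 / area2 v1 v2 v3) *\<^sub>R (area2 x v2 v3 *\<^sub>R v1 + area2 v1 x v3 *\<^sub>R v2 + area2 v1 v2 x *\<^sub>R v3) = x"
    using assms by simp
  then show ?thesis by (simp add: bary_point_def bary_coords_def scaleR_add_right)
qed

text \<open>Multiplicativity of the determinant in homogeneous coordinates; 27 is the cube of the
  scale 3.\<close>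

lemma area2_bary_point:
  assumes "coord_sum A = 3" "coord_sum B = 3" "coord_sum C = 3"
  shows "area2 (bary_point v1 v2 v3 A) (bary_point v1 v2 v3 B) (bary_point v1 v2 v3 C) = det3 A B C / 27 * area2 v1 v2 v3"
proof -
  have W: "A $ 3 = 3 - A $ 1 - A $ 2" "B $ 3 = 3 - B $ 1 - B $ 2" "C $ 3 = 3 - C $ 1 - C $ 2"
    using assms by (simp_all add: coord_sum_def)
  show ?thesis unfolding area2_def bary_point_def det3_def W
    by (simp add: field_simps)
qed

lemma emeasure_lebesgue_compact:
  "compact S \<Longrightarrow> emeasure lebesgue S = emeasure lborel S"
  "compact S \<Longrightarrow> measure lebesgue S = measure lborel S"
  by (auto simp: compact_imp_closed borel_closed measure_def)

lemma measure_hull_triangle: "measure lebesgue (convex hull {p, q, r}) = \<bar>area2 p q r\<bar> / 2"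
  by (subst emeasure_lebesgue_compact)
     (auto simp: content_triangle area2_def algebra_simps finite_imp_compact_convex_hull)

lemma mem_hull_triangle:
  assumes "area2 v1 v2 v3 \<noteq> 0"
  shows "x \<in> convex hull {v1, v2, v3} \<longleftrightarrow> (\<forall>i. 0 \<le> bary_coords v1 v2 v3 x $ i)"
proof
  assume "x \<in> convex hull {v1, v2, v3}"
  then obtain u v w where u: "0 \<le> u" "0 \<le> v" "0 \<le> w" "u + v + w = 1" "x = u *\<^sub>R v1 + v *\<^sub>R v2 + w *\<^sub>R v3"
    by (auto simp: convex_hull_3)
  have "x = bary_point v1 v2 v3 (vector [3 * u, 3 * v, 3 * w])" using u(5) by (simp add: bary_point_def)
  then have "bary_coords v1 v2 v3 x = vector [3 * u, 3 * v, 3 * w]"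
    using bary_coords_bary_point[OF assms, of "vector [3 * u, 3 * v, 3 * w]"] u(4) by (simp add: coord_sum_def)
  then show "\<forall>i. 0 \<le> bary_coords v1 v2 v3 x $ i" using u by (simp add: forall_3)
next
  let ?X = "bary_coords v1 v2 v3 x"
  assume "\<forall>i. 0 \<le> ?X $ i"
  moreover have "x = (?X $ 1 / 3) *\<^sub>R v1 + (?X $ 2 / 3) *\<^sub>R v2 + (?X $ 3 / 3) *\<^sub>R v3"
    using bary_point_bary_coords[OF assms, of x] by (simp add: bary_point_def)
  moreover have "?X $ 1 / 3 + ?X $ 2 / 3 + ?X $ 3 / 3 = 1"
    using coord_sum_bary_coords[OF assms, of x] by (simp add: coord_sum_def)
  ultimately have "\<exists>u v w. x = u *\<^sub>R v1 + v *\<^sub>R v2 + w *\<^sub>R v3 \<and> 0 \<le> u \<and> 0 \<le> v \<and> 0 \<le> w \<and> u + v + w = 1"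
    by - (rule exI[of _ "?X $ 1 / 3"], rule exI[of _ "?X $ 2 / 3"], rule exI[of _ "?X $ 3 / 3"], simp add: forall_3)
  then show "x \<in> convex hull {v1, v2, v3}" unfolding convex_hull_3 by simp
qed

lemma mem_interior_hull_triangle:
  assumes "area2 v1 v2 v3 \<noteq> 0"
  shows "x \<in> interior (convex hull {v1, v2, v3}) \<longleftrightarrow> (\<forall>i. 0 < bary_coords v1 v2 v3 x $ i)"
proof -
  have nc: "\<not> collinear {v1, v2, v3}" using assms by (simp add: collinear_area2)
  show ?thesis
  proof
    assume "x \<in> interior (convex hull {v1, v2, v3})"
    then obtain u v w where u: "0 < u" "0 < v" "0 < w" "u + v + w = 1" "x = u *\<^sub>R v1 + v *\<^sub>R v2 + w *\<^sub>R v3"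
      by (auto simp: interior_convex_hull_3_minimal[OF nc])
    have "x = bary_point v1 v2 v3 (vector [3 * u, 3 * v, 3 * w])" using u(5) by (simp add: bary_point_def)
    then have "bary_coords v1 v2 v3 x = vector [3 * u, 3 * v, 3 * w]"
      using bary_coords_bary_point[OF assms, of "vector [3 * u, 3 * v, 3 * w]"] u(4) by (simp add: coord_sum_def)
    then show "\<forall>i. 0 < bary_coords v1 v2 v3 x $ i" using u by (simp add: forall_3)
  next
    let ?X = "bary_coords v1 v2 v3 x"
    assume "\<forall>i. 0 < ?X $ i"
    moreover have "x = (?X $ 1 / 3) *\<^sub>R v1 + (?X $ 2 / 3) *\<^sub>R v2 + (?X $ 3 / 3) *\<^sub>R v3"
      using bary_point_bary_coords[OF assms, of x] by (simp add: bary_point_def)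
    moreover have "?X $ 1 / 3 + ?X $ 2 / 3 + ?X $ 3 / 3 = 1"
      using coord_sum_bary_coords[OF assms, of x] by (simp add: coord_sum_def)
    ultimately have "\<exists>u v w. 0 < u \<and> 0 < v \<and> 0 < w \<and> u + v + w = 1 \<and> u *\<^sub>R v1 + v *\<^sub>R v2 + w *\<^sub>R v3 = x"
      by - (rule exI[of _ "?X $ 1 / 3"], rule exI[of _ "?X $ 2 / 3"], rule exI[of _ "?X $ 3 / 3"], simp add: forall_3)
    then show "x \<in> interior (convex hull {v1, v2, v3})"
      by (simp add: interior_convex_hull_3_minimal[OF nc])
  qed
qed

lemma bary_coords_affine: "bary_coords v1 v2 v3 (x + t *\<^sub>R y) = bary_coords v1 v2 v3 x + t *\<^sub>R (bary_coords v1 v2 v3 y - bary_coords v1 v2 v3 0)"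
  by (simp add: vec_eq_iff forall_3 bary_coords_def area2_def diff_divide_distrib[symmetric] add_divide_distrib[symmetric] algebra_simps)

lemma continuous_on_bary_coords: "continuous_on A (bary_coords v1 v2 v3)"
proof -
  define c where "c = 3 / area2 v1 v2 v3"
  have "continuous_on A (\<lambda>x. c *\<^sub>R vector [area2 x v2 v3, area2 v1 x v3, area2 v1 v2 x] $ i)" for i :: 3
    using exhaust_3[of i] by (elim disjE) (simp add: area2_def; intro continuous_intros)+
  then have "continuous_on A (\<lambda>x. \<chi> i::3. c *\<^sub>R vector [area2 x v2 v3, area2 v1 x v3, area2 v1 v2 x] $ i)"
    by (rule continuous_on_vec_lambda)
  moreover have "bary_coords v1 v2 v3 = (\<lambda>x. \<chi> i::3. c *\<^sub>R vector [area2 x v2 v3, area2 v1 x v3, area2 v1 v2 x] $ i)"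
    by (auto simp: fun_eq_iff bary_coords_def c_def vec_eq_iff)
  ultimately show ?thesis by simp
qed

text \<open>Six separate weights, one per list entry, so that coinciding points are covered as
  well.\<close>

lemma convex_hull_six:
  fixes A B C D E F :: "'a::real_vector"
  shows "convex hull (set [A, B, C, D, E, F]) =
    {s *\<^sub>R A + t *\<^sub>R B + u *\<^sub>R C + p *\<^sub>R D + q *\<^sub>R E + r *\<^sub>R F | s t u p q r.
       0 \<le> s \<and> 0 \<le> t \<and> 0 \<le> u \<and> 0 \<le> p \<and> 0 \<le> q \<and> 0 \<le> r \<and> s + t + u + p + q + r = 1}"
    (is "_ = ?R")
proof
  have mem: "s *\<^sub>R A + t *\<^sub>R B + u *\<^sub>R C + p *\<^sub>R D + q *\<^sub>R E + r *\<^sub>R F \<in> ?R"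
    if "0 \<le> s \<and> 0 \<le> t \<and> 0 \<le> u \<and> 0 \<le> p \<and> 0 \<le> q \<and> 0 \<le> r \<and> s + t + u + p + q + r = 1" for s t u p q r
    using that by blast
  have "convex ?R"
  proof (rule convexI)
    fix x y :: 'a and a b :: real
    assume x: "x \<in> ?R" and y: "y \<in> ?R" and ab: "0 \<le> a" "0 \<le> b" "a + b = 1"
    obtain s t u p q r where 1: "0 \<le> s" "0 \<le> t" "0 \<le> u" "0 \<le> p" "0 \<le> q" "0 \<le> r" "s + t + u + p + q + r = 1"
      and xe: "x = s *\<^sub>R A + t *\<^sub>R B + u *\<^sub>R C + p *\<^sub>R D + q *\<^sub>R E + r *\<^sub>R F"
      using x by blast
    obtain s' t' u' p' q' r' where 2: "0 \<le> s'" "0 \<le> t'" "0 \<le> u'" "0 \<le> p'" "0 \<le> q'" "0 \<le> r'" "s' + t' + u' + p' + q' + r' = 1"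
      and ye: "y = s' *\<^sub>R A + t' *\<^sub>R B + u' *\<^sub>R C + p' *\<^sub>R D + q' *\<^sub>R E + r' *\<^sub>R F"
      using y by blast
    have "a * s + b * s' + (a * t + b * t') + (a * u + b * u') + (a * p + b * p') + (a * q + b * q') + (a * r + b * r')
       = a * (s + t + u + p + q + r) + b * (s' + t' + u' + p' + q' + r')"
      by (simp add: algebra_simps)
    also have "\<dots> = 1" using ab 1 2 by simp
    finally have "(a * s + b * s') *\<^sub>R A + (a * t + b * t') *\<^sub>R B + (a * u + b * u') *\<^sub>R C
        + (a * p + b * p') *\<^sub>R D + (a * q + b * q') *\<^sub>R E + (a * r + b * r') *\<^sub>R F \<in> ?R"
      using ab 1 2 by (intro mem) simp
    then show "a *\<^sub>R x + b *\<^sub>R y \<in> ?R" unfolding xe ye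
      by (rule back_subst[of "\<lambda>z. z \<in> ?R"]) (simp add: algebra_simps)
  qed
  moreover have "set [A, B, C, D, E, F] \<subseteq> ?R"
    using mem[of 1 0 0 0 0 0] mem[of 0 1 0 0 0 0] mem[of 0 0 1 0 0 0] mem[of 0 0 0 1 0 0]
      mem[of 0 0 0 0 1 0] mem[of 0 0 0 0 0 1] by simp
  ultimately show "convex hull (set [A, B, C, D, E, F]) \<subseteq> ?R" by (intro hull_minimal)
next
  show "?R \<subseteq> convex hull (set [A, B, C, D, E, F])"
  proof clarify
    fix s t u p q r :: real
    assume nn: "0 \<le> s" "0 \<le> t" "0 \<le> u" "0 \<le> p" "0 \<le> q" "0 \<le> r" and "s + t + u + p + q + r = 1"
    have "(\<Sum>i<6. ([s, t, u, p, q, r] ! i) *\<^sub>R ([A, B, C, D, E, F] ! i)) \<in> convex hull (set [A, B, C, D, E, F])"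
    proof (rule convex_sum)
      show "(\<Sum>i<6. [s, t, u, p, q, r] ! i) = 1"
        using \<open>s + t + u + p + q + r = 1\<close> by (simp add: eval_nat_numeral lessThan_Suc)
    next
      fix i :: nat assume i: "i \<in> {..<6}"
      then have "i < length [s, t, u, p, q, r]" "i < length [A, B, C, D, E, F]" by auto
      then have "[s, t, u, p, q, r] ! i \<in> set [s, t, u, p, q, r]" "[A, B, C, D, E, F] ! i \<in> set [A, B, C, D, E, F]"
        using nth_mem by blast+
      then show "0 \<le> [s, t, u, p, q, r] ! i"
        "[A, B, C, D, E, F] ! i \<in> convex hull (set [A, B, C, D, E, F])"
        using nn by (auto intro: hull_inc simp del: set_simps(2)) (auto intro: hull_inc)
    qed auto
    then show "s *\<^sub>R A + t *\<^sub>R B + u *\<^sub>R C + p *\<^sub>R D + q *\<^sub>R E + r *\<^sub>R F \<in> convex hull (set [A, B, C, D, E, F])"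
      by (rule back_subst[of "\<lambda>z. z \<in> _"]) (simp add: eval_nat_numeral lessThan_Suc add_ac)
  qed
qed

section \<open>Fibres of lifted simplices\<close>

text \<open>The entries of \<open>z\<close> are the weights of \<open>a\<close>, \<open>b\<close>,
  \<open>c\<close> in a convex combination giving \<open>X\<close>. The cone condition says that
  \<open>d\<close>, \<open>e\<close>, \<open>f\<close> can supply the rest; that the six weights add
  up to 1 then follows by comparing coordinate sums.\<close>

definition fibre :: "real ^ 3 \<Rightarrow> real ^ 3 \<Rightarrow> real ^ 3 \<Rightarrow> real ^ 3 \<Rightarrow> real ^ 3 \<Rightarrow> real ^ 3 \<Rightarrow> real ^ 3 \<Rightarrow> (real ^ 3) set" where
  "fibre a b c d e f X = {z. (\<forall>i. 0 \<le> z $ i) \<and> X - z $ 1 *\<^sub>R a - z $ 2 *\<^sub>R b - z $ 3 *\<^sub>R c \<in> cone3 d e f}"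

text \<open>Its value (1/60) is never needed: all basis functions of both triangles share this factor.\<close>

definition simplex_const :: real where
  "simplex_const = enn2real (\<integral>\<^sup>+z. indicator {z :: real ^ 3. \<forall>i. 0 \<le> z $ i} z
      * ennreal ((max 0 (1 - z $ 1 - z $ 2 - z $ 3))\<^sup>2) \<partial>lborel)"

lemma det3_linear:
  "det3 (X + Y) e f = det3 X e f + det3 Y e f" "det3 (r *\<^sub>R X) e f = r * det3 X e f"
  "det3 d (X + Y) f = det3 d X f + det3 d Y f" "det3 d (r *\<^sub>R X) f = r * det3 d X f"
  "det3 d e (X + Y) = det3 d e X + det3 d e Y" "det3 d e (r *\<^sub>R X) = r * det3 d e X"
  "det3 d d f = 0" "det3 d e d = 0" "det3 d e e = 0"
  by (simp_all add: det3_def algebra_simps)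

lemma mem_cone3:
  assumes "det3 d e f \<noteq> 0"
  shows "Y \<in> cone3 d e f \<longleftrightarrow> (\<exists>p q r. 0 \<le> p \<and> 0 \<le> q \<and> 0 \<le> r \<and> Y = p *\<^sub>R d + q *\<^sub>R e + r *\<^sub>R f)"
proof
  assume "Y \<in> cone3 d e f"
  then show "\<exists>p q r. 0 \<le> p \<and> 0 \<le> q \<and> 0 \<le> r \<and> Y = p *\<^sub>R d + q *\<^sub>R e + r *\<^sub>R f"
    using cramer3[OF assms, of Y] unfolding cone3_def by blast
qed (use assms in \<open>auto simp: cone3_def det3_linear\<close>)

lemma emeasure_compact_eq: "compact S \<Longrightarrow> emeasure lborel S = ennreal (measure lborel S)"
  by (rule emeasure_eq_ennreal_measure) (use emeasure_compact_finite[of S] in auto)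

lemma emeasure_linear_image3:
  fixes G :: "real ^ 3 \<Rightarrow> real ^ 3"
  assumes G: "linear G" and S: "compact S"
  shows "emeasure lborel ((\<lambda>z. k + G z) ` S) = ennreal \<bar>det (matrix G)\<bar> * emeasure lborel S"
proof -
  have GS: "compact (G ` S)" using S G by (intro compact_continuous_image linear_continuous_on) (auto simp: linear_conv_bounded_linear)
  have "(\<lambda>z. k + G z) ` S = (+) k ` (G ` S)" by auto
  then have "emeasure lborel ((\<lambda>z. k + G z) ` S) = emeasure lebesgue ((+) k ` (G ` S))"
    using emeasure_lebesgue_compact(1)[of "(+) k ` (G ` S)"] compact_translation[OF GS, of k] by simp
  also have "\<dots> = ennreal (measure lebesgue ((+) k ` (G ` S)))"
    using compact_translation[OF GS, of k] by (intro emeasure_eq_ennreal_measure) (metis emeasure_lebesgue_compact(1) emeasure_compact_finite infinity_ennreal_def order_less_irrefl)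
  also have "\<dots> = ennreal (\<bar>det (matrix G)\<bar> * measure lebesgue S)"
    using G S by (simp add: measure_translation measure_linear_image lmeasurable_compact)
  also have "\<dots> = ennreal \<bar>det (matrix G)\<bar> * emeasure lborel S"
    using S emeasure_compact_finite[OF S]
    by (simp add: ennreal_mult emeasure_lebesgue_compact(2)) (simp add: emeasure_eq_ennreal_measure less_top[symmetric])
  finally show ?thesis .
qed

lemma closed_fibres:
  "closed {(X, z). z \<in> fibre a b c d e f X}"
proof -
  have "{(X, z). z \<in> fibre a b c d e f X} = {p. (\<forall>i. 0 \<le> snd p $ i) \<and>
      0 \<le> det3 (fst p - snd p $ 1 *\<^sub>R a - snd p $ 2 *\<^sub>R b - snd p $ 3 *\<^sub>R c) e f / det3 d e f \<and>
      0 \<le> det3 d (fst p - snd p $ 1 *\<^sub>R a - snd p $ 2 *\<^sub>R b - snd p $ 3 *\<^sub>R c) f / det3 d e f \<and>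
      0 \<le> det3 d e (fst p - snd p $ 1 *\<^sub>R a - snd p $ 2 *\<^sub>R b - snd p $ 3 *\<^sub>R c) / det3 d e f}"
    by (auto simp: fibre_def cone3_def)
  also have "closed \<dots>"
    \<comment> \<open>For a zero determinant each cone condition reads \<open>0 \<le> 0\<close>;
      otherwise it is an inequality between continuous functions.\<close>
    by (cases "det3 d e f = 0")
       (auto simp: det3_def intro!: closed_Collect_conj closed_Collect_all closed_Collect_le continuous_intros)
  finally show ?thesis .
qed

lemma closed_fibre: "closed (fibre a b c d e f X)"
proof -
  have "fibre a b c d e f X = Pair X -` {(X, z). z \<in> fibre a b c d e f X}" by auto
  then show ?thesis
    by (simp only:) (intro closed_vimage closed_fibres continuous_intros)
qed

locale knots6 =
  fixes v1 v2 v3 :: "real ^ 2" and a b c d e f :: "real ^ 3"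
  assumes nondeg: "area2 v1 v2 v3 \<noteq> 0" and det: "det3 d e f \<noteq> 0"
    and cs: "coord_sum a = 3" "coord_sum b = 3" "coord_sum c = 3" "coord_sum d = 3" "coord_sum e = 3" "coord_sum f = 3"
begin

abbreviation "pt \<equiv> bary_point v1 v2 v3"
abbreviation "co \<equiv> bary_coords v1 v2 v3"
abbreviation "fib \<equiv> fibre a b c d e f"

lemma cone_coord_sum: "Y \<in> cone3 d e f \<Longrightarrow> 0 \<le> coord_sum Y"
  by (auto simp: mem_cone3[OF det] coord_sum_linear cs)

lemma fibre_le: "z \<in> fib (co x) \<Longrightarrow> z $ 1 + z $ 2 + z $ 3 \<le> 1"
proof -
  assume z: "z \<in> fib (co x)"
  have "coord_sum (co x - z $ 1 *\<^sub>R a - z $ 2 *\<^sub>R b - z $ 3 *\<^sub>R c) = 3 - 3 * (z $ 1 + z $ 2 + z $ 3)"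
    by (simp add: coord_sum_bary_coords[OF nondeg] coord_sum_linear cs)
  then show ?thesis using cone_coord_sum z by (fastforce simp: fibre_def)
qed

lemma compact_fibre: "compact (fib (co x))"
proof -
  have "fib (co x) \<subseteq> cbox 0 (\<chi> i. 1)"
  proof
    fix z assume z: "z \<in> fib (co x)"
    then have "\<forall>i. 0 \<le> z $ i" by (simp add: fibre_def)
    then show "z \<in> cbox 0 (\<chi> i. 1)"
      using fibre_le[OF z] by (auto simp: mem_box_cart forall_3) 
  qed
  then show ?thesis
    using closed_fibre bounded_subset[OF bounded_cbox] by (auto simp: compact_eq_bounded_closed)
qed

text \<open>With the weights of \<open>a\<close>, \<open>b\<close>, \<open>c\<close> fixed, the
  remaining weight \<open>r\<close> is distributed over \<open>d\<close>, \<open>e\<close>,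
  \<open>f\<close>. Hence \<open>x\<close> runs through a translate of the triangle on these three
  points scaled by \<open>r\<close>, whose area is scaled by the square of \<open>r\<close>; for
  negative \<open>r\<close> the section is empty.\<close>

lemma fibre_plane_section:
  assumes "\<forall>i. 0 \<le> z $ i"
  shows "emeasure lborel {x. z \<in> fib (co x)}
    = ennreal ((max 0 (1 - z $ 1 - z $ 2 - z $ 3))\<^sup>2) * ennreal (\<bar>area2 (pt d) (pt e) (pt f)\<bar> / 2)"
proof -
  define r where "r = 1 - z $ 1 - z $ 2 - z $ 3"
  define w where "w = z $ 1 *\<^sub>R a + z $ 2 *\<^sub>R b + z $ 3 *\<^sub>R c"
  have csw: "coord_sum w = 3 * (1 - r)" by (simp add: w_def r_def coord_sum_linear cs)
  have mem: "z \<in> fib (co x) \<longleftrightarrow> co x - w \<in> cone3 d e f" for x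
    using assms by (simp add: fibre_def w_def algebra_simps)
  show ?thesis
  proof (cases "r < 0")
    case True
    have "{x. z \<in> fib (co x)} = {}"
      using fibre_le[of z] True by (fastforce simp: r_def)
    then show ?thesis using True by (simp add: r_def max_def)
  next
    case False
    define S where "S = convex hull {pt d, pt e, pt f}"
    have "{x. z \<in> fib (co x)} = (\<lambda>x. r *\<^sub>R x + pt w) ` S"
    proof (intro equalityI subsetI)
      fix x assume "x \<in> {x. z \<in> fib (co x)}"
      then obtain p q s where pqs: "0 \<le> p" "0 \<le> q" "0 \<le> s" and eq: "co x - w = p *\<^sub>R d + q *\<^sub>R e + s *\<^sub>R f"
        by (auto simp: mem mem_cone3[OF det])
      have xw: "co x = p *\<^sub>R d + q *\<^sub>R e + s *\<^sub>R f + w" using eq by (simp add: algebra_simps)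
      have sum: "p + q + s = r"
        using arg_cong[OF xw, of coord_sum] coord_sum_bary_coords[OF nondeg, of x] by (simp add: coord_sum_linear cs csw)
      have x: "x = p *\<^sub>R pt d + q *\<^sub>R pt e + s *\<^sub>R pt f + pt w"
        using arg_cong[OF xw, of pt] by (simp add: bary_point_bary_coords[OF nondeg] bary_point_linear)
      show "x \<in> (\<lambda>x. r *\<^sub>R x + pt w) ` S"
      proof (cases "r = 0")
        case True
        then have "p = 0" "q = 0" "s = 0" using sum pqs by linarith+
        then have "x = r *\<^sub>R pt d + pt w" using x True by simp
        moreover have "pt d \<in> S" by (simp add: S_def hull_inc)
        ultimately show ?thesis by blast
      next
        case rn: False
        with False have r: "0 < r" by simp
        define y where "y = (p / r) *\<^sub>R pt d + (q / r) *\<^sub>R pt e + (s / r) *\<^sub>R pt f"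
        have "p / r + q / r + s / r = 1" using sum r by (simp add: field_simps)
        then have "y \<in> S" unfolding S_def convex_hull_3 y_def using pqs r by fastforce
        moreover have "x = r *\<^sub>R y + pt w" using x r by (simp add: y_def scaleR_add_right)
        ultimately show ?thesis by blast
      qed
    next
      fix x assume "x \<in> (\<lambda>x. r *\<^sub>R x + pt w) ` S"
      then obtain p q s where pqs: "0 \<le> p" "0 \<le> q" "0 \<le> s" "p + q + s = 1"
        and x: "x = r *\<^sub>R (p *\<^sub>R pt d + q *\<^sub>R pt e + s *\<^sub>R pt f) + pt w"
        by (auto simp: S_def convex_hull_3)
      define Y where "Y = r *\<^sub>R (p *\<^sub>R d + q *\<^sub>R e + s *\<^sub>R f) + w"
      have "coord_sum Y = 3 * r * (p + q + s) + 3 * (1 - r)"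
        by (simp add: Y_def coord_sum_linear cs csw algebra_simps)
      then have "coord_sum Y = 3" by (simp add: pqs(4))
      moreover have "x = pt Y" by (simp add: x Y_def bary_point_linear)
      ultimately have "co x = Y" using bary_coords_bary_point[OF nondeg] by simp
      then have "co x - w = (r * p) *\<^sub>R d + (r * q) *\<^sub>R e + (r * s) *\<^sub>R f" by (simp add: Y_def algebra_simps)
      moreover have "0 \<le> r * p" "0 \<le> r * q" "0 \<le> r * s" using pqs False by auto
      ultimately have "co x - w \<in> cone3 d e f" unfolding mem_cone3[OF det] by blast
      then show "x \<in> {x. z \<in> fib (co x)}" by (simp add: mem)
    qed
    moreover have cS: "compact S" by (simp add: S_def finite_imp_compact_convex_hull)
    moreover from cS have "compact ((\<lambda>x. r *\<^sub>R x + pt w) ` S)"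
      by (intro compact_continuous_image continuous_intros)
    ultimately have "emeasure lborel {x. z \<in> fib (co x)} = ennreal (\<bar>r\<bar> ^ 2) * emeasure lebesgue S"
      using emeasure_lebesgue_affine[of r "pt w" S] by (simp add: emeasure_lebesgue_compact(1)[symmetric])
    also have "emeasure lebesgue S = ennreal (measure lebesgue S)"
      using cS by (simp only: emeasure_lebesgue_compact emeasure_compact_eq)
    finally show ?thesis
      using False by (simp add: S_def measure_hull_triangle r_def max_def)
  qed
qed

lemma fibres_measurable: "{(x, z). z \<in> fib (co x)} \<in> sets (lborel \<Otimes>\<^sub>M lborel)"
proof -
  have "{(x, z). z \<in> fib (co x)} = (\<lambda>p. (co (fst p), snd p)) -` {(X, z). z \<in> fib X}" by auto
  then have "closed {(x, z). z \<in> fib (co x)}"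
    by (simp only:) (intro closed_vimage closed_fibres continuous_on_Pair continuous_on_fst continuous_on_snd
        continuous_on_id continuous_on_compose2[OF continuous_on_bary_coords[of UNIV]], auto intro!: continuous_intros)
  then show ?thesis unfolding lborel_prod by (simp add: borel_closed)
qed

lemma measurable_fibre: "(\<lambda>x. emeasure lborel (fib (co x))) \<in> borel_measurable lborel"
  using lborel.measurable_emeasure_Pair[OF fibres_measurable] by (simp add: vimage_def)

text \<open>The set of pairs \<open>(x, z)\<close> is measured in both orders. Integrating over
  \<open>x\<close> first leaves an integral over \<open>z\<close> in which the knots no longer
  occur.\<close>

lemma integral_fibres:
  "(\<integral>\<^sup>+x. emeasure lborel (fib (co x)) \<partial>lborel)
     = (\<integral>\<^sup>+z. indicator {z :: real ^ 3. \<forall>i. 0 \<le> z $ i} z * ennreal ((max 0 (1 - z $ 1 - z $ 2 - z $ 3))\<^sup>2) \<partial>lborel)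
       * ennreal (\<bar>area2 (pt d) (pt e) (pt f)\<bar> / 2)"
proof -
  define S where "S = {(x, z). z \<in> fib (co x)}"
  have S: "S \<in> sets (lborel \<Otimes>\<^sub>M lborel)" unfolding S_def by (rule fibres_measurable)
  have "emeasure (lborel \<Otimes>\<^sub>M lborel) S = (\<integral>\<^sup>+x. emeasure lborel (Pair x -` S) \<partial>lborel)"
    by (rule lborel.emeasure_pair_measure_alt[OF S])
  also have "\<dots> = (\<integral>\<^sup>+x. emeasure lborel (fib (co x)) \<partial>lborel)"
    by (intro nn_integral_cong) (simp add: S_def vimage_def)
  finally have 1: "emeasure (lborel \<Otimes>\<^sub>M lborel) S = (\<integral>\<^sup>+x. emeasure lborel (fib (co x)) \<partial>lborel)" .
  have "emeasure (lborel \<Otimes>\<^sub>M lborel) S = (\<integral>\<^sup>+z. emeasure lborel ((\<lambda>x. (x, z)) -` S) \<partial>lborel)"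
    by (rule lborel_pair.emeasure_pair_measure_alt2[OF S])
  also have "\<dots> = (\<integral>\<^sup>+z. (indicator {z :: real ^ 3. \<forall>i. 0 \<le> z $ i} z * ennreal ((max 0 (1 - z $ 1 - z $ 2 - z $ 3))\<^sup>2))
       * ennreal (\<bar>area2 (pt d) (pt e) (pt f)\<bar> / 2) \<partial>lborel)"
  proof (rule nn_integral_cong)
    fix z :: "real ^ 3"
    show "emeasure lborel ((\<lambda>x. (x, z)) -` S) = (indicator {z. \<forall>i. 0 \<le> z $ i} z * ennreal ((max 0 (1 - z $ 1 - z $ 2 - z $ 3))\<^sup>2))
       * ennreal (\<bar>area2 (pt d) (pt e) (pt f)\<bar> / 2)"
    proof (cases "\<forall>i. 0 \<le> z $ i")
      case True
      then show ?thesis using fibre_plane_section[OF True] by (simp add: S_def vimage_def)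
    next
      case False
      then have "(\<lambda>x. (x, z)) -` S = {}" by (auto simp: S_def fibre_def)
      then show ?thesis using False by simp
    qed
  qed
  also have "\<dots> = (\<integral>\<^sup>+z. indicator {z :: real ^ 3. \<forall>i. 0 \<le> z $ i} z * ennreal ((max 0 (1 - z $ 1 - z $ 2 - z $ 3))\<^sup>2) \<partial>lborel)
       * ennreal (\<bar>area2 (pt d) (pt e) (pt f)\<bar> / 2)"
  proof (rule nn_integral_multc)
    have "closed {z :: real ^ 3. \<forall>i. 0 \<le> z $ i}" by (intro closed_Collect_all closed_Collect_le continuous_intros)
    then have [measurable]: "{z :: real ^ 3. \<forall>i. 0 \<le> z $ i} \<in> sets borel" by (rule borel_closed)
    have [measurable]: "(\<lambda>z :: real ^ 3. (max 0 (1 - z $ 1 - z $ 2 - z $ 3))\<^sup>2) \<in> borel_measurable borel"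
      by (intro borel_measurable_continuous_onI continuous_intros)
    show "(\<lambda>z :: real ^ 3. indicator {z. \<forall>i. 0 \<le> z $ i} z * ennreal ((max 0 (1 - z $ 1 - z $ 2 - z $ 3))\<^sup>2)) \<in> borel_measurable lborel"
      by measurable
  qed
  finally show ?thesis using 1 by simp
qed

end

section \<open>Lebesgue measure on three-space as an iterated integral\<close>

lemma measurable_vec3:
  "(\<lambda>(s, t, u). vector [s, t, u] :: real ^ 3) \<in> (lborel \<Otimes>\<^sub>M (lborel \<Otimes>\<^sub>M lborel)) \<rightarrow>\<^sub>M borel"
proof -
  have "continuous_on UNIV (\<lambda>(s, t, u). \<chi> i :: 3. if i = 1 then s else if i = 2 then t else (u :: real))"
    unfolding case_prod_beta
  proof (rule continuous_on_vec_lambda)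
    fix i :: 3
    show "continuous_on UNIV (\<lambda>p :: real \<times> real \<times> real. if i = 1 then fst p else if i = 2 then fst (snd p) else snd (snd p))"
      using exhaust_3[of i] by (elim disjE) (simp; intro continuous_intros)+
  qed
  also have "(\<lambda>(s, t, u). \<chi> i :: 3. if i = 1 then s else if i = 2 then t else (u :: real)) = (\<lambda>(s, t, u). vector [s, t, u])"
    by (auto simp: fun_eq_iff vec_eq_iff forall_3)
  finally show "(\<lambda>(s, t, u). vector [s, t, u] :: real ^ 3) \<in> (lborel \<Otimes>\<^sub>M (lborel \<Otimes>\<^sub>M lborel)) \<rightarrow>\<^sub>M borel"
    unfolding lborel_prod by (simp add: borel_measurable_continuous_onI)
qed

lemma prod_UNIV_3: "prod f (UNIV :: 3 set) = f 1 * f 2 * f 3"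
  unfolding UNIV_3 by (simp add: ac_simps)

lemma sigma_finite_lborel2: "sigma_finite_measure (lborel \<Otimes>\<^sub>M lborel :: ('a::euclidean_space \<times> 'b::euclidean_space) measure)"
  unfolding lborel_prod by (rule sigma_finite_lborel)

lemma lborel_vec3:
  "(lborel :: (real ^ 3) measure) = distr (lborel \<Otimes>\<^sub>M (lborel \<Otimes>\<^sub>M lborel)) borel (\<lambda>(s, t, u). vector [s, t, u])"
proof (rule lborel_eqI)
  fix l u :: "real ^ 3"
  assume "\<And>b. b \<in> Basis \<Longrightarrow> l \<bullet> b \<le> u \<bullet> b"
  from this[of "axis _ 1"] have le: "l $ i \<le> u $ i" for i
    by (simp add: inner_axis axis_in_Basis_iff)
  have B: "Basis = range (\<lambda>i :: 3. axis i (1 :: real))"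
    by (auto simp: Basis_vec_def)
  have "emeasure (distr (lborel \<Otimes>\<^sub>M (lborel \<Otimes>\<^sub>M lborel)) borel (\<lambda>(s, t, u). vector [s, t, u])) (box l u)
     = emeasure (lborel \<Otimes>\<^sub>M (lborel \<Otimes>\<^sub>M lborel)) ((\<lambda>(s, t, u). vector [s, t, u]) -` box l u)"
    using measurable_vec3 by (subst emeasure_distr) (auto simp: space_pair_measure)
  also have "(\<lambda>(s, t, u). vector [s, t, u]) -` box l u = {l $ 1<..<u $ 1} \<times> {l $ 2<..<u $ 2} \<times> {l $ 3<..<u $ 3}"
    by (auto simp: mem_box_cart forall_3)
  also have "emeasure (lborel \<Otimes>\<^sub>M (lborel \<Otimes>\<^sub>M lborel)) \<dots>
      = ennreal (u $ 1 - l $ 1) * (ennreal (u $ 2 - l $ 2) * ennreal (u $ 3 - l $ 3))"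
    using le by (simp add: sigma_finite_measure.emeasure_pair_measure_Times[OF sigma_finite_lborel2]
        lborel.emeasure_pair_measure_Times)
  also have "\<dots> = ennreal (\<Prod>b\<in>Basis. (u - l) \<bullet> b)"
  proof -
    have "(\<Prod>b\<in>Basis. (u - l) \<bullet> b) = (\<Prod>i\<in>UNIV. u $ i - l $ i)"
      unfolding B by (subst prod.reindex) (simp_all add: inj_on_def axis_eq_axis inner_axis)
    also have "\<dots> = (u $ 1 - l $ 1) * ((u $ 2 - l $ 2) * (u $ 3 - l $ 3))"
      by (simp add: prod_UNIV_3 mult.assoc)
    finally have p: "(\<Prod>b\<in>Basis. (u - l) \<bullet> b) = (u $ 1 - l $ 1) * ((u $ 2 - l $ 2) * (u $ 3 - l $ 3))" .
    have "0 \<le> u $ 1 - l $ 1" "0 \<le> u $ 2 - l $ 2" "0 \<le> u $ 3 - l $ 3" using le by simp_all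
    then show ?thesis unfolding p by (simp only: ennreal_mult mult_nonneg_nonneg)
  qed
  finally show "emeasure (distr (lborel \<Otimes>\<^sub>M (lborel \<Otimes>\<^sub>M lborel)) borel (\<lambda>(s, t, u). vector [s, t, u])) (box l u)
    = ennreal (\<Prod>b\<in>Basis. (u - l) \<bullet> b)" .
qed simp

text \<open>Tonelli in the three weights. This connects the volume of a fibre with the ray integrals
  that the cut lists evaluate.\<close>

lemma emeasure_fibre: "emeasure lborel (fibre a b c d e f X) = knot_vol a b c d e f X"
proof -
  let ?F = "fibre a b c d e f X" and ?v = "\<lambda>(s, t, u). vector [s, t, u] :: real ^ 3"
  let ?M = "lborel \<Otimes>\<^sub>M (lborel \<Otimes>\<^sub>M lborel) :: (real \<times> real \<times> real) measure"
  note v = measurable_vec3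
  have F: "?F \<in> sets borel" by (rule borel_closed[OF closed_fibre])
  have mF: "(\<lambda>p. indicator ?F (?v p) :: ennreal) \<in> borel_measurable ?M"
    by (rule measurable_compose[OF v borel_measurable_indicator]) (simp add: F)
  have "emeasure lborel ?F = emeasure (distr ?M borel ?v) ?F"
    by (simp only: lborel_vec3[symmetric])
  also have "\<dots> = (\<integral>\<^sup>+z. indicator ?F z \<partial>distr ?M borel ?v)"
    by (rule nn_integral_indicator[symmetric]) (simp add: F)
  also have "\<dots> = (\<integral>\<^sup>+p. indicator ?F (?v p) \<partial>?M)"
    by (rule nn_integral_distr[OF v borel_measurable_indicator]) (simp add: F)
  also have "\<dots> = (\<integral>\<^sup>+s. \<integral>\<^sup>+q. indicator ?F (?v (s, q)) \<partial>(lborel \<Otimes>\<^sub>M lborel) \<partial>lborel)"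
    by (rule sigma_finite_measure.nn_integral_fst[OF sigma_finite_lborel2 mF, symmetric])
  also have "\<dots> = (\<integral>\<^sup>+s. \<integral>\<^sup>+t. \<integral>\<^sup>+u. indicator ?F (?v (s, t, u)) \<partial>lborel \<partial>lborel \<partial>lborel)"
  proof (intro nn_integral_cong lborel.nn_integral_fst[symmetric])
    fix s :: real
    show "(\<lambda>q. indicator ?F (?v (s, q)) :: ennreal) \<in> borel_measurable (lborel \<Otimes>\<^sub>M lborel)"
      by (rule measurable_compose_Pair1[OF _ mF]) simp
  qed
  also have "\<dots> = (\<integral>\<^sup>+s. \<integral>\<^sup>+t. \<integral>\<^sup>+u. indicator {0..} s * (indicator {0..} t * (indicator {0..} u *
      indicator (cone3 d e f) (X - s *\<^sub>R a - t *\<^sub>R b - u *\<^sub>R c))) \<partial>lborel \<partial>lborel \<partial>lborel)"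
    by (intro nn_integral_cong) (auto simp: fibre_def forall_3 indicator_def)
  also have "\<dots> = knot_vol a b c d e f X"
  proof -
    have "(\<integral>\<^sup>+t. indicator A s * f t \<partial>lborel) = indicator A s * (\<integral>\<^sup>+t. f t \<partial>lborel)"
      for A and s :: real and f :: "real \<Rightarrow> ennreal"
      by (cases "s \<in> A") auto
    then show ?thesis by (simp add: knot_vol_def)
  qed
  finally show ?thesis .
qed

lemma simplex_const_eq:
  "(\<integral>\<^sup>+z. indicator {z :: real ^ 3. \<forall>i. 0 \<le> z $ i} z * ennreal ((max 0 (1 - z $ 1 - z $ 2 - z $ 3))\<^sup>2) \<partial>lborel)
     = ennreal simplex_const" (is "?I = _")
  and simplex_const_pos: "0 < simplex_const"
proof -
  let ?f = "\<lambda>z :: real ^ 3. indicator {z. \<forall>i. 0 \<le> z $ i} z * ennreal ((max 0 (1 - z $ 1 - z $ 2 - z $ 3))\<^sup>2)"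
  have "?I \<le> (\<integral>\<^sup>+(z :: real ^ 3). indicator (cbox 0 (\<chi> i. 1)) z \<partial>lborel)"
  proof (rule nn_integral_mono)
    fix z :: "real ^ 3"
    show "?f z \<le> indicator (cbox 0 (\<chi> i. 1)) z"
    proof (cases "(\<forall>i. 0 \<le> z $ i) \<and> z $ 1 + z $ 2 + z $ 3 \<le> 1")
      case True
      then have "z \<in> cbox 0 (\<chi> i. 1)" by (auto simp: mem_box_cart forall_3)
      moreover have "(max 0 (1 - z $ 1 - z $ 2 - z $ 3))\<^sup>2 \<le> 1"
        using True by (intro power_le_one) (auto simp: forall_3)
      ultimately show ?thesis using True by (simp add: ennreal_le_1)
    next
      case False
      then have "?f z = 0" by (auto simp: indicator_def max_def)
      then show ?thesis by (simp only: zero_le)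
    qed
  qed
  also have "\<dots> < \<infinity>" using emeasure_lborel_cbox_finite[of "0 :: real ^ 3" "\<chi> i. 1"] by (simp add: less_top)
  finally show fin: "?I = ennreal simplex_const" by (simp add: simplex_const_def)
  \<comment> \<open>On this cube the three coordinates add up to less than 1/2, so the integrand is
    at least 1/4. The earlier bound by the indicator of the unit cube gives finiteness.\<close>
  define B where "B = box (0 :: real ^ 3) ((1 / 6) *\<^sub>R One)"
  have "emeasure lborel B = ennreal (\<Prod>b\<in>(Basis :: (real ^ 3) set). 1 / 6)"
    unfolding B_def by (subst emeasure_lborel_box) (auto intro!: arg_cong[where f = ennreal] prod.cong)
  then have "0 < emeasure lborel B"
    by (simp add: prod_pos)
  then have "0 < (\<integral>\<^sup>+z. ennreal (1 / 4) * indicator B z \<partial>lborel)"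
    by (subst nn_integral_cmult_indicator) (auto simp: B_def ennreal_zero_less_mult_iff)
  also have "\<dots> \<le> ?I"
  proof (rule nn_integral_mono)
    fix z :: "real ^ 3"
    show "ennreal (1 / 4) * indicator B z \<le> ?f z"
    proof (cases "z \<in> B")
      case True
      then have "0 < z \<bullet> axis i 1 \<and> z \<bullet> axis i 1 < 1 / 6" for i
        using axis_in_Basis_iff[of i "1 :: real"] by (auto simp: B_def mem_box)
      then have z: "\<forall>i. 0 < z $ i \<and> z $ i < 1 / 6" by (simp add: inner_axis)
      then have "(1 / 2)\<^sup>2 \<le> (max 0 (1 - z $ 1 - z $ 2 - z $ 3))\<^sup>2"
        by (intro power_mono) (auto simp: forall_3)
      then show ?thesis using True z by (auto simp: power2_eq_square less_imp_le intro!: ennreal_leI)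
    qed simp
  qed
  finally show "0 < simplex_const" unfolding fin by simp
qed

text \<open>Turns a lift of the knots in one order into a lift in another order with the same set of
  vertices.\<close>

lemma rearrange_map:
  assumes "mset (map g V) = mset Ys"
  shows "\<exists>V'. mset V' = mset V \<and> map g V' = Ys"
  using assms
proof (induction Ys arbitrary: V)
  case Nil
  then have "V = []" by simp
  then show ?case by (intro exI[of _ "[]"]) simp
next
  case (Cons y Ys)
  have "set (map g V) = set (y # Ys)" by (rule mset_eq_setD[OF Cons.prems])
  then have "y \<in> g ` set V" by simp
  then obtain v where v: "v \<in> set V" "g v = y" by blast
  then obtain as bs where V: "V = as @ v # bs" using split_list[OF v(1)] by blast
  have "mset (map g (as @ bs)) = mset Ys" using Cons.prems v(2) by (simp add: V)
  from Cons.IH[OF this] obtain V' where V': "mset V' = mset (as @ bs)" "map g V' = Ys" by blast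
  show ?case by (rule exI[of _ "v # V'"]) (simp add: V V' v(2))
qed

section \<open>Independence of the lift\<close>

context knots6 begin

abbreviation "harea \<equiv> \<bar>area2 (pt d) (pt e) (pt f)\<bar> / 2"

lemma harea_eq: "harea = \<bar>det3 d e f\<bar> * tri_area v1 v2 v3 / 27"
  using cs by (simp add: area2_bary_point tri_area_def measure_hull_triangle abs_mult)

lemma harea_pos: "0 < harea"
  using nondeg det cs by (simp add: area2_bary_point)

text \<open>The linear map taking \<open>d\<close>, \<open>e\<close>, \<open>f\<close> to
  \<open>yd\<close>, \<open>ye\<close>, \<open>yf\<close>. Subtracting it shears the lifted simplex
  until these three vertices have height 0.\<close>

definition comb :: "'v::real_vector \<Rightarrow> 'v \<Rightarrow> 'v \<Rightarrow> real ^ 3 \<Rightarrow> 'v" where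
  "comb yd ye yf Y = (det3 Y e f / det3 d e f) *\<^sub>R yd + (det3 d Y f / det3 d e f) *\<^sub>R ye
     + (det3 d e Y / det3 d e f) *\<^sub>R yf"

lemma comb_linear:
  "comb yd ye yf (X + Y) = comb yd ye yf X + comb yd ye yf Y"
  "comb yd ye yf (r *\<^sub>R X) = r *\<^sub>R comb yd ye yf X"
  "comb yd ye yf d = yd" "comb yd ye yf e = ye" "comb yd ye yf f = yf"
proof -
  show "comb yd ye yf (X + Y) = comb yd ye yf X + comb yd ye yf Y"
    by (simp only: comb_def det3_linear add_divide_distrib scaleR_add_left ac_simps)
  show "comb yd ye yf (r *\<^sub>R X) = r *\<^sub>R comb yd ye yf X"
    by (simp only: comb_def det3_linear scaleR_add_right scaleR_scaleR times_divide_eq_right)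
  show "comb yd ye yf d = yd" "comb yd ye yf e = ye" "comb yd ye yf f = yf"
    using det by (simp_all add: comb_def det3_linear)
qed

text \<open>The weights of \<open>d\<close>, \<open>e\<close>, \<open>f\<close> are determined by
  \<open>x\<close> and the weights \<open>z\<close> of the other three vertices. Eliminating them
  makes the height affine in \<open>z\<close>, with a linear part that does not involve
  \<open>x\<close>.\<close>

lemma hull_slice:
  "{y. (x, y) \<in> convex hull (set [(pt a, ya), (pt b, yb), (pt c, yc), (pt d, yd), (pt e, ye), (pt f, yf)])}
   = (\<lambda>z. comb yd ye yf (co x) + (z $ 1 *\<^sub>R (ya - comb yd ye yf a) + z $ 2 *\<^sub>R (yb - comb yd ye yf b)
        + z $ 3 *\<^sub>R (yc - comb yd ye yf c))) ` fib (co x)"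
    (is "?L = ?g ` _")
proof (intro equalityI subsetI)
  fix y assume "y \<in> ?L"
  then obtain s t u p q r where nn: "0 \<le> s" "0 \<le> t" "0 \<le> u" "0 \<le> p" "0 \<le> q" "0 \<le> r"
    and sum: "s + t + u + p + q + r = 1"
    and xy: "(x, y) = s *\<^sub>R (pt a, ya) + t *\<^sub>R (pt b, yb) + u *\<^sub>R (pt c, yc) + p *\<^sub>R (pt d, yd)
        + q *\<^sub>R (pt e, ye) + r *\<^sub>R (pt f, yf)"
    unfolding mem_Collect_eq convex_hull_six by (elim exE conjE) (rule that)
  then have x: "x = s *\<^sub>R pt a + t *\<^sub>R pt b + u *\<^sub>R pt c + p *\<^sub>R pt d + q *\<^sub>R pt e + r *\<^sub>R pt f"
    and y: "y = s *\<^sub>R ya + t *\<^sub>R yb + u *\<^sub>R yc + p *\<^sub>R yd + q *\<^sub>R ye + r *\<^sub>R yf"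
    by simp_all
  define Y where "Y = s *\<^sub>R a + t *\<^sub>R b + u *\<^sub>R c + p *\<^sub>R d + q *\<^sub>R e + r *\<^sub>R f"
  have "coord_sum Y = 3 * (s + t + u + p + q + r)" by (simp add: Y_def coord_sum_linear cs)
  moreover have "x = pt Y" by (simp add: x Y_def bary_point_linear)
  ultimately have co: "co x = Y" using bary_coords_bary_point[OF nondeg] sum by simp
  have "co x - s *\<^sub>R a - t *\<^sub>R b - u *\<^sub>R c = p *\<^sub>R d + q *\<^sub>R e + r *\<^sub>R f"
    by (simp add: co Y_def)
  then have "co x - s *\<^sub>R a - t *\<^sub>R b - u *\<^sub>R c \<in> cone3 d e f"
    unfolding mem_cone3[OF det] using nn by blast
  then have "vector [s, t, u] \<in> fib (co x)"
    using nn by (simp add: fibre_def forall_3)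
  moreover have "y = ?g (vector [s, t, u])"
    by (simp add: co Y_def comb_linear y algebra_simps)
  ultimately show "y \<in> ?g ` fib (co x)" by blast
next
  fix y assume "y \<in> ?g ` fib (co x)"
  then obtain z where z: "z \<in> fib (co x)" and y: "y = ?g z" by blast
  then obtain p q r where nn: "0 \<le> p" "0 \<le> q" "0 \<le> r"
    and eq: "co x - z $ 1 *\<^sub>R a - z $ 2 *\<^sub>R b - z $ 3 *\<^sub>R c = p *\<^sub>R d + q *\<^sub>R e + r *\<^sub>R f"
    by (auto simp: fibre_def mem_cone3[OF det])
  have co: "co x = z $ 1 *\<^sub>R a + z $ 2 *\<^sub>R b + z $ 3 *\<^sub>R c + p *\<^sub>R d + q *\<^sub>R e + r *\<^sub>R f"
    using eq by (simp add: algebra_simps)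
  have "coord_sum (co x) = 3 * (z $ 1 + z $ 2 + z $ 3 + p + q + r)"
    by (subst co) (simp add: coord_sum_linear cs)
  then have sum: "z $ 1 + z $ 2 + z $ 3 + p + q + r = 1" by (simp add: coord_sum_bary_coords[OF nondeg])
  have x: "x = z $ 1 *\<^sub>R pt a + z $ 2 *\<^sub>R pt b + z $ 3 *\<^sub>R pt c + p *\<^sub>R pt d + q *\<^sub>R pt e + r *\<^sub>R pt f"
    using arg_cong[OF co, of pt] by (simp add: bary_point_bary_coords[OF nondeg] bary_point_linear)
  have y': "y = z $ 1 *\<^sub>R ya + z $ 2 *\<^sub>R yb + z $ 3 *\<^sub>R yc + p *\<^sub>R yd + q *\<^sub>R ye + r *\<^sub>R yf"
    unfolding y co by (simp add: comb_linear algebra_simps)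
  have "\<forall>i. 0 \<le> z $ i" using z by (simp add: fibre_def)
  then have "(x, y) = z $ 1 *\<^sub>R (pt a, ya) + z $ 2 *\<^sub>R (pt b, yb) + z $ 3 *\<^sub>R (pt c, yc)
      + p *\<^sub>R (pt d, yd) + q *\<^sub>R (pt e, ye) + r *\<^sub>R (pt f, yf) \<and>
      0 \<le> z $ 1 \<and> 0 \<le> z $ 2 \<and> 0 \<le> z $ 3 \<and> 0 \<le> p \<and> 0 \<le> q \<and> 0 \<le> r \<and> z $ 1 + z $ 2 + z $ 3 + p + q + r = 1"
    using x y' nn sum by simp
  then show "y \<in> ?L" unfolding mem_Collect_eq convex_hull_six
    by - (rule exI[of _ "z $ 1"], rule exI[of _ "z $ 2"], rule exI[of _ "z $ 3"],
      rule exI[of _ p], rule exI[of _ q], rule exI[of _ r])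
qed

text \<open>The same determinant scales every slice, and by Fubini the whole simplex, so it cancels
  in the quotient defining the simplex spline. No nondegeneracy of the lift is assumed: for a
  singular \<open>G\<close> both volumes are zero.\<close>

lemma slice_volumes:
  fixes ya yb yc yd ye yf :: "real ^ 3"
  defines "H \<equiv> convex hull (set [(pt a, ya), (pt b, yb), (pt c, yc), (pt d, yd), (pt e, ye), (pt f, yf)])"
  defines "G \<equiv> (\<lambda>z :: real ^ 3. z $ 1 *\<^sub>R (ya - comb yd ye yf a) + z $ 2 *\<^sub>R (yb - comb yd ye yf b)
        + z $ 3 *\<^sub>R (yc - comb yd ye yf c))"
  shows "measure lebesgue {y. (x, y) \<in> H} = \<bar>det (matrix G)\<bar> * measure lebesgue (fib (co x))"
    and "measure lebesgue H = \<bar>det (matrix G)\<bar> * (simplex_const * harea)"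
proof -
  have G: "linear G" by (rule linearI) (simp_all add: G_def algebra_simps)
  have sl: "{y. (x, y) \<in> H} = (\<lambda>z. comb yd ye yf (co x) + G z) ` fib (co x)" for x
    unfolding H_def G_def by (rule hull_slice)
  have esl: "emeasure lborel {y. (x, y) \<in> H} = ennreal \<bar>det (matrix G)\<bar> * emeasure lborel (fib (co x))" for x
    unfolding sl by (rule emeasure_linear_image3[OF G compact_fibre])
  have cH: "compact H" unfolding H_def by (intro finite_imp_compact_convex_hull) simp
  have csl: "compact {y. (x, y) \<in> H}" for x
    unfolding sl using G
    by (intro compact_continuous_image compact_fibre continuous_intros linear_continuous_on)
       (simp add: linear_conv_bounded_linear)
  have "ennreal (measure lborel {y. (x, y) \<in> H}) = ennreal (\<bar>det (matrix G)\<bar> * measure lborel (fib (co x)))"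
    using esl[of x] csl[of x] compact_fibre[of x] by (simp add: emeasure_compact_eq ennreal_mult)
  then show "measure lebesgue {y. (x, y) \<in> H} = \<bar>det (matrix G)\<bar> * measure lebesgue (fib (co x))"
    using csl compact_fibre by (simp add: emeasure_lebesgue_compact)
  have H: "H \<in> sets (lborel \<Otimes>\<^sub>M lborel)"
    unfolding lborel_prod using cH by (simp add: borel_closed compact_imp_closed)
  have "emeasure lborel H = (\<integral>\<^sup>+x. emeasure lborel (Pair x -` H) \<partial>lborel)"
    using lborel.emeasure_pair_measure_alt[OF H] by (simp add: lborel_prod)
  also have "\<dots> = (\<integral>\<^sup>+x. ennreal \<bar>det (matrix G)\<bar> * emeasure lborel (fib (co x)) \<partial>lborel)"
    by (simp add: vimage_def esl)
  also have "\<dots> = ennreal \<bar>det (matrix G)\<bar> * (\<integral>\<^sup>+x. emeasure lborel (fib (co x)) \<partial>lborel)"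
    by (rule nn_integral_cmult) (rule measurable_fibre)
  also have "\<dots> = ennreal (\<bar>det (matrix G)\<bar> * (simplex_const * harea))"
    using harea_pos simplex_const_pos
    by (simp add: integral_fibres simplex_const_eq ennreal_mult[symmetric] less_imp_le)
  finally have "ennreal (measure lborel H) = ennreal (\<bar>det (matrix G)\<bar> * (simplex_const * harea))"
    using cH by (simp add: emeasure_compact_eq)
  then show "measure lebesgue H = \<bar>det (matrix G)\<bar> * (simplex_const * harea)"
    using cH harea_pos simplex_const_pos by (simp add: emeasure_lebesgue_compact)
qed

lemma lift_exists: "\<exists>V. simplex_lift [pt a, pt b, pt c, pt d, pt e, pt f] V"
proof -
  \<comment> \<open>Heights 0 over \<open>d\<close>, \<open>e\<close>, \<open>f\<close> make
    \<open>comb\<close> vanish, and unit vectors over \<open>a\<close>, \<open>b\<close>,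
    \<open>c\<close> make the slice map the identity.\<close>
  let ?V = "[(pt a, axis 1 1), (pt b, axis 2 1), (pt c, axis 3 1), (pt d, 0), (pt e, 0), (pt f, 0)] :: ((real ^ 2) \<times> (real ^ 3)) list"
  have "(\<lambda>z :: real ^ 3. z $ 1 *\<^sub>R (axis 1 1 - comb 0 0 0 a) + z $ 2 *\<^sub>R (axis 2 1 - comb 0 0 0 b)
        + z $ 3 *\<^sub>R (axis 3 1 - comb 0 0 0 c)) = (\<lambda>z. z)"
    by (auto simp: comb_def fun_eq_iff vec_eq_iff forall_3 axis_def)
  then have "measure lebesgue (convex hull (set ?V)) = simplex_const * harea"
    using slice_volumes(2)[of "axis 1 1" "axis 2 1" "axis 3 1" 0 0 0] by (simp add: matrix_id[unfolded id_def])
  then have "0 < measure lebesgue (convex hull (set ?V))"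
    using mult_pos_pos[OF simplex_const_pos harea_pos] by (simp only:)
  then have "simplex_lift [pt a, pt b, pt c, pt d, pt e, pt f] ?V"
    by (simp add: simplex_lift_def)
  then show ?thesis by blast
qed

lemma lift_ratio:
  assumes "simplex_lift [pt a, pt b, pt c, pt d, pt e, pt f] V"
  shows "measure lebesgue {y. (x, y) \<in> convex hull (set V)} / measure lebesgue (convex hull (set V))
    = measure lebesgue (fib (co x)) / (simplex_const * harea)"
proof -
  have m: "map fst V = [pt a, pt b, pt c, pt d, pt e, pt f]" and pos: "0 < measure lebesgue (convex hull (set V))"
    using assms by (auto simp: simplex_lift_def)
  obtain ya yb yc yd ye yf where V: "V = [(pt a, ya), (pt b, yb), (pt c, yc), (pt d, yd), (pt e, ye), (pt f, yf)]"
    using m by (auto simp: map_eq_Cons_conv)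
  have ratio: "m / h = F / k" if "0 < h" "m = D * F" "h = D * k" for m h D F k :: real
    using that by auto
  show ?thesis
    by (rule ratio[OF pos]) (simp_all only: V slice_volumes)
qed

text \<open>The chosen lift follows the order of \<open>Xi\<close>. Reordering its vertices leaves
  the hull unchanged and yields a lift of \<open>a, ..., f\<close>, to which
  \<open>lift_ratio\<close> applies.\<close>

lemma simplex_spline_eq:
  assumes "mset Xi = mset [pt a, pt b, pt c, pt d, pt e, pt f]"
  shows "simplex_spline Xi x = measure lebesgue (fib (co x)) / (simplex_const * harea)"
proof -
  have perm: "\<exists>V'. simplex_lift Ys V' \<and> set V' = set V" if "mset Xs = mset Ys" "simplex_lift Xs V" for Xs Ys V
  proof -
    have "mset (map fst V) = mset Ys" using that by (simp add: simplex_lift_def)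
    then obtain V' where "mset V' = mset V" "map fst V' = Ys"
      using rearrange_map by metis
    then have "simplex_lift Ys V' \<and> set V' = set V"
      using that(2) mset_eq_setD[of V' V] by (simp add: simplex_lift_def)
    then show ?thesis by blast
  qed
  obtain V0 where "simplex_lift [pt a, pt b, pt c, pt d, pt e, pt f] V0" using lift_exists by blast
  then have "\<exists>V. simplex_lift Xi V" using perm[OF assms[symmetric]] by blast
  then have "simplex_lift Xi (SOME V. simplex_lift Xi V)" by (rule someI_ex)
  from perm[OF assms this] obtain V' where "simplex_lift [pt a, pt b, pt c, pt d, pt e, pt f] V'"
    "set V' = set (SOME V. simplex_lift Xi V)" by blast
  then show ?thesis
    using lift_ratio[of V' x] by (simp add: simplex_spline_def Let_def)
qed

text \<open>The determinant in the knot volume also occurs in \<open>harea\<close> and cancels,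
  which leaves a normalisation common to all knot multisets of the triangle.\<close>

lemma simplex_spline_knot_vol:
  assumes "mset Xi = mset [pt a, pt b, pt c, pt d, pt e, pt f]"
    and "knot_vol a b c d e f (co x) = ennreal (\<bar>det3 d e f\<bar> * r)" "0 \<le> r"
  shows "simplex_spline Xi x = 27 / (simplex_const * tri_area v1 v2 v3) * r"
proof -
  have "ennreal (measure lborel (fib (co x))) = ennreal (\<bar>det3 d e f\<bar> * r)"
    using assms(2) emeasure_compact_eq[OF compact_fibre] by (simp add: emeasure_fibre)
  then have "measure lebesgue (fib (co x)) = \<bar>det3 d e f\<bar> * r"
    using assms(3) compact_fibre by (simp add: emeasure_lebesgue_compact)
  then show ?thesis
    unfolding simplex_spline_eq[OF assms(1)] harea_eq using det by (simp add: field_simps)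
qed

end

section \<open>The basis functions as truncated power sums\<close>

text \<open>Quantified over all triangles, so that permuting the vertices becomes an instantiation,
  and stated with multisets, so that the order of the knots in the given lists does not
  matter.\<close>

definition represents :: "(real ^ 3) list \<Rightarrow> (real \<times> (real ^ 3)) list \<Rightarrow> bool" where
  "represents Ws L \<longleftrightarrow> (\<forall>v1 v2 v3 x Xi. area2 v1 v2 v3 \<noteq> 0 \<longrightarrow> (\<forall>i. 0 < bary_coords v1 v2 v3 x $ i) \<longrightarrow>
     mset Xi = mset (map (bary_point v1 v2 v3) Ws) \<longrightarrow>
     simplex_spline Xi x = 27 / (simplex_const * tri_area v1 v2 v3) * cut_spline 3 L (bary_coords v1 v2 v3 x))"

lemma representsI:
  assumes "\<And>X. (\<And>i. 0 < X $ i) \<Longrightarrow>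
      knot_vol a b c d e f X = ennreal (\<bar>det3 d e f\<bar> * cut_spline 3 L X) \<and> 0 \<le> cut_spline 3 L X"
    and "det3 d e f \<noteq> 0"
    and "coord_sum a = 3" "coord_sum b = 3" "coord_sum c = 3" "coord_sum d = 3" "coord_sum e = 3" "coord_sum f = 3"
  shows "represents [a, b, c, d, e, f] L"
  unfolding represents_def
proof (intro allI impI)
  fix v1 v2 v3 x Xi
  assume "area2 v1 v2 v3 \<noteq> 0" and x: "\<forall>i. 0 < bary_coords v1 v2 v3 x $ i"
    and Xi: "mset Xi = mset (map (bary_point v1 v2 v3) [a, b, c, d, e, f])"
  then interpret knots6 v1 v2 v3 a b c d e f using assms by unfold_locales
  show "simplex_spline Xi x = 27 / (simplex_const * tri_area v1 v2 v3) * cut_spline 3 L (co x)"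
    using simplex_spline_knot_vol[of Xi x "cut_spline 3 L (co x)"] assms(1)[of "co x"] Xi x by simp
qed

section \<open>Transport under permutations of the vertices\<close>

lemma perms3:
  fixes i j m :: 3
  assumes "i \<noteq> j" "i \<noteq> m" "j \<noteq> m"
  obtains "i = 1" "j = 2" "m = 3" | "i = 1" "j = 3" "m = 2" | "i = 2" "j = 1" "m = 3"
    | "i = 2" "j = 3" "m = 1" | "i = 3" "j = 1" "m = 2" | "i = 3" "j = 2" "m = 1"
  using assms exhaust_3[of i] exhaust_3[of j] exhaust_3[of m] by metis
definition place :: "3 \<Rightarrow> 3 \<Rightarrow> 3 \<Rightarrow> real ^ 3 \<Rightarrow> real ^ 3" where
  "place i j m W = W $ 1 *\<^sub>R axis i 1 + W $ 2 *\<^sub>R axis j 1 + W $ 3 *\<^sub>R axis m 1"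

lemma place_eval:
  "place 1 2 3 W = vector [W $ 1, W $ 2, W $ 3]"
  "place 1 3 2 W = vector [W $ 1, W $ 3, W $ 2]"
  "place 2 1 3 W = vector [W $ 2, W $ 1, W $ 3]"
  "place 2 3 1 W = vector [W $ 3, W $ 1, W $ 2]"
  "place 3 1 2 W = vector [W $ 2, W $ 3, W $ 1]"
  "place 3 2 1 W = vector [W $ 3, W $ 2, W $ 1]"
  by (simp_all add: place_def axis_def vec_eq_iff forall_3)

definition relabel :: "3 \<Rightarrow> 3 \<Rightarrow> 3 \<Rightarrow> (real \<times> (real ^ 3)) list \<Rightarrow> (real \<times> (real ^ 3)) list" where
  "relabel i j m L = map (\<lambda>(c, l). (c, place i j m l)) L"

lemma inner_place: "place i j m l \<bullet> X = l \<bullet> vector [X $ i, X $ j, X $ m]"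
  by (simp add: place_def inner_add_left inner_axis' inner_vec_def[of l] sum_3)

lemma cut_spline_relabel: "cut_spline k (relabel i j m L) X = cut_spline k L (vector [X $ i, X $ j, X $ m])"
  unfolding cut_spline_def relabel_def by (induction L) (auto simp: inner_place)

lemma dir_cuts_relabel: "dir_cuts v (relabel i j m L) = relabel i j m (dir_cuts (vector [v $ i, v $ j, v $ m]) L)"
  unfolding dir_cuts_def relabel_def by (induction L) (auto simp: inner_place)

lemma area2_perms:
  "area2 p r q = - area2 p q r" "area2 q p r = - area2 p q r" "area2 r q p = - area2 p q r"
  "area2 q r p = area2 p q r" "area2 r p q = area2 p q r"
  by (simp_all add: area2_def algebra_simps)

lemma tri_area_perms:
  "tri_area p r q = tri_area p q r" "tri_area q p r = tri_area p q r" "tri_area r q p = tri_area p q r"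
  "tri_area q r p = tri_area p q r" "tri_area r p q = tri_area p q r"
  by (simp_all add: tri_area_def insert_commute)

text \<open>The hypothesis is applied to the same triangle with its vertices listed as
  \<open>w i\<close>, \<open>w j\<close>, \<open>w m\<close>: points and area are unchanged, and the
  coordinates are permuted in the way \<open>relabel\<close> permutes the forms.\<close>

lemma represents_relabel:
  assumes L: "represents Ws L" and d: "i \<noteq> j" "i \<noteq> m" "j \<noteq> m"
  shows "represents (map (place i j m) Ws) (relabel i j m L)"
  unfolding represents_def
proof (intro allI impI)
  fix v1 v2 v3 x Xi
  assume area: "area2 v1 v2 v3 \<noteq> 0" and x: "\<forall>i. 0 < bary_coords v1 v2 v3 x $ i"
    and Xi: "mset Xi = mset (map (bary_point v1 v2 v3) (map (place i j m) Ws))"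
  let ?X = "bary_coords v1 v2 v3 x"
  define w :: "3 \<Rightarrow> real ^ 2" where "w n = (if n = 1 then v1 else if n = 2 then v2 else v3)" for n
  have w123: "w 1 = v1" "w 2 = v2" "w 3 = v3" by (simp_all add: w_def)
  have bary_point: "bary_point v1 v2 v3 (place i j m W) = bary_point (w i) (w j) (w m) W" for W
  proof (cases rule: perms3[OF d])
  qed (simp_all add: place_eval bary_point_def w123)
  have w: "area2 (w i) (w j) (w m) \<noteq> 0" "tri_area (w i) (w j) (w m) = tri_area v1 v2 v3"
    using area area2_perms[of v1 v2 v3] tri_area_perms[of v1 v2 v3]
    by (cases rule: perms3[OF d]; simp add: w123)+
  have "place i j m (vector [?X $ i, ?X $ j, ?X $ m]) = ?X"
  proof (cases rule: perms3[OF d])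
  qed (simp_all add: place_eval vec_eq_iff forall_3)
  moreover have "coord_sum (vector [?X $ i, ?X $ j, ?X $ m]) = coord_sum ?X"
  proof (cases rule: perms3[OF d])
  qed (simp_all add: coord_sum_def)
  ultimately have co: "bary_coords (w i) (w j) (w m) x = vector [?X $ i, ?X $ j, ?X $ m]"
    using bary_coords_bary_point[OF w(1), of "vector [?X $ i, ?X $ j, ?X $ m]"] bary_point[of "vector [?X $ i, ?X $ j, ?X $ m]"]
    by (simp add: coord_sum_bary_coords[OF area] bary_point_bary_coords[OF area])
  have "\<forall>n. 0 < bary_coords (w i) (w j) (w m) x $ n" unfolding co forall_3 vector_3 using x by blast
  moreover have "mset Xi = mset (map (bary_point (w i) (w j) (w m)) Ws)"
    using Xi by (simp add: bary_point comp_def)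
  ultimately have "simplex_spline Xi x = 27 / (simplex_const * tri_area (w i) (w j) (w m)) * cut_spline 3 L (bary_coords (w i) (w j) (w m) x)"
    using L w(1) unfolding represents_def by blast
  then show "simplex_spline Xi x = 27 / (simplex_const * tri_area v1 v2 v3) * cut_spline 3 (relabel i j m L) ?X"
    unfolding cut_spline_relabel w(2) co .
qed

definition knots1 :: "(real ^ 3) list" where
  "knots1 = [k1, k1, k1, k21, k31, k1]"
definition knots4 :: "(real ^ 3) list" where
  "knots4 = [k1, k1, k1, k32, k21, k31]"
definition knots10 :: "(real ^ 3) list" where
  "knots10 = [k2, k1, k1, k32, k21, k31]"
definition knots16 :: "(real ^ 3) list" where
  "knots16 = [k23, k1, k1, k32, k21, k31]"
definition knots19 :: "(real ^ 3) list" where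
  "knots19 = [k12, k2, k1, k32, k21, k31]"
definition knots22 :: "(real ^ 3) list" where
  "knots22 = [k12, k23, k1, k32, k21, k31]"
definition knots28 :: "(real ^ 3) list" where
  "knots28 = [k12, k13, k23, k32, k21, k31]"

lemmas knots_defs = knots1_def knots4_def knots10_def knots16_def knots19_def knots22_def knots28_def

lemma represents1: "represents knots1 cuts1"
  unfolding knots1_def using knot_vol_cuts1 by (rule representsI) (simp_all add: det3_def coord_sum_def)

lemma represents4: "represents knots4 cuts4"
  unfolding knots4_def using knot_vol_cuts4 by (rule representsI) (simp_all add: det3_def coord_sum_def)

lemma represents10: "represents knots10 cuts10"
  unfolding knots10_def using knot_vol_cuts10 by (rule representsI) (simp_all add: det3_def coord_sum_def)

lemma represents16: "represents knots16 cuts16"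
  unfolding knots16_def using knot_vol_cuts16 by (rule representsI) (simp_all add: det3_def coord_sum_def)

lemma represents19: "represents knots19 cuts19"
  unfolding knots19_def using knot_vol_cuts19 by (rule representsI) (simp_all add: det3_def coord_sum_def)

lemma represents22: "represents knots22 cuts22"
  unfolding knots22_def using knot_vol_cuts22 by (rule representsI) (simp_all add: det3_def coord_sum_def)

lemma represents28: "represents knots28 cuts28"
  unfolding knots28_def using knot_vol_cuts28 by (rule representsI) (simp_all add: det3_def coord_sum_def)

text \<open>The entry with index \<open>i - 1\<close> is the orbit representative and vertex permutation giving \<open>\<Xi>\<^sub>i\<close>.\<close>

definition pieces :: "((real ^ 3) list \<times> (real \<times> (real ^ 3)) list) list" where
  "pieces = [(map (place 1 2 3) knots1, relabel 1 2 3 cuts1),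
    (map (place 2 1 3) knots1, relabel 2 1 3 cuts1),
    (map (place 3 1 2) knots1, relabel 3 1 2 cuts1),
    (map (place 1 2 3) knots4, relabel 1 2 3 cuts4),
    (map (place 1 3 2) knots4, relabel 1 3 2 cuts4),
    (map (place 2 3 1) knots4, relabel 2 3 1 cuts4),
    (map (place 2 1 3) knots4, relabel 2 1 3 cuts4),
    (map (place 3 1 2) knots4, relabel 3 1 2 cuts4),
    (map (place 3 2 1) knots4, relabel 3 2 1 cuts4),
    (map (place 1 2 3) knots10, relabel 1 2 3 cuts10),
    (map (place 1 3 2) knots10, relabel 1 3 2 cuts10),
    (map (place 2 3 1) knots10, relabel 2 3 1 cuts10),
    (map (place 2 1 3) knots10, relabel 2 1 3 cuts10),
    (map (place 3 1 2) knots10, relabel 3 1 2 cuts10),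
    (map (place 3 2 1) knots10, relabel 3 2 1 cuts10),
    (map (place 1 2 3) knots16, relabel 1 2 3 cuts16),
    (map (place 2 1 3) knots16, relabel 2 1 3 cuts16),
    (map (place 3 1 2) knots16, relabel 3 1 2 cuts16),
    (map (place 1 2 3) knots19, relabel 1 2 3 cuts19),
    (map (place 2 3 1) knots19, relabel 2 3 1 cuts19),
    (map (place 1 3 2) knots19, relabel 1 3 2 cuts19),
    (map (place 1 2 3) knots22, relabel 1 2 3 cuts22),
    (map (place 1 3 2) knots22, relabel 1 3 2 cuts22),
    (map (place 2 3 1) knots22, relabel 2 3 1 cuts22),
    (map (place 2 1 3) knots22, relabel 2 1 3 cuts22),
    (map (place 3 1 2) knots22, relabel 3 1 2 cuts22),
    (map (place 3 2 1) knots22, relabel 3 2 1 cuts22),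
    (map (place 1 2 3) knots28, relabel 1 2 3 cuts28)]"

lemma represents_pieces: "list_all (\<lambda>(Ws, L). represents Ws L) pieces"
  unfolding pieces_def list.pred_inject prod.case
  by (intro conjI TrueI represents_relabel represents1 represents4 represents10 represents16 represents19 represents22 represents28) simp_all

lemma mset_knot_lists:
  "map mset (knot_lists v1 v2 v3) = map (\<lambda>(Ws, L). mset (map (bary_point v1 v2 v3) Ws)) pieces"
  unfolding pieces_def knot_lists_def Let_def
  by (simp add: knots_defs place_eval) (simp add: bary_point_def add_mset_commute add.commute)

definition cuts :: "nat \<Rightarrow> (real \<times> (real ^ 3)) list" where
  "cuts i = snd (pieces ! (i - 1))"

text \<open>The 27 from \<open>represents\<close> over the 15 in \<open>weight\<close>. The area of
  the triangle has cancelled, so the two triangles share this constant.\<close>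

definition basis_const :: real where
  "basis_const = 9 / (5 * simplex_const)"

lemma basis_const_pos: "0 < basis_const"
  using simplex_const_pos by (simp add: basis_const_def)

lemma length_pieces: "length pieces = 28"
  by (simp add: pieces_def)

lemma tri_area_pos: "area2 v1 v2 v3 \<noteq> 0 \<Longrightarrow> 0 < tri_area v1 v2 v3"
  by (simp add: tri_area_def measure_hull_triangle)

section \<open>Formulas on the closed triangle\<close>

lemma simplex_spline_interior:
  assumes "area2 v1 v2 v3 \<noteq> 0" "1 \<le> i" "i \<le> 28" "x \<in> interior (convex hull {v1, v2, v3})"
  shows "weight v1 v2 v3 i * simplex_spline (knots v1 v2 v3 i) x
    = basis_const * (coef_list ! (i - 1)) * cut_spline 3 (cuts i) (bary_coords v1 v2 v3 x)"
proof -
  obtain Ws L where WL: "pieces ! (i - 1) = (Ws, L)" by force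
  have i: "i - 1 < length pieces" using assms by (simp add: length_pieces)
  have "length (knot_lists v1 v2 v3) = 28" by (simp add: knot_lists_def Let_def)
  then have "mset (knots v1 v2 v3 i) = map mset (knot_lists v1 v2 v3) ! (i - 1)"
    using i by (simp add: knots_def length_pieces)
  also have "\<dots> = mset (map (bary_point v1 v2 v3) Ws)"
    unfolding mset_knot_lists using i WL by simp
  finally have m: "mset (knots v1 v2 v3 i) = mset (map (bary_point v1 v2 v3) Ws)" .
  have "represents Ws L"
    using represents_pieces i WL by (auto simp: list_all_length)
  then have "simplex_spline (knots v1 v2 v3 i) x
      = 27 / (simplex_const * tri_area v1 v2 v3) * cut_spline 3 L (bary_coords v1 v2 v3 x)"
    using assms m mem_interior_hull_triangle[OF assms(1)] unfolding represents_def by blast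
  moreover have "cuts i = L" unfolding cuts_def WL by simp
  ultimately show ?thesis
    using tri_area_pos[OF assms(1)] simplex_const_pos
    by (simp add: weight_def basis_const_def field_simps)
qed

lemma closure_interior_triangle:
  assumes "area2 v1 v2 v3 \<noteq> 0"
  shows "closure (interior (convex hull {v1, v2, v3})) = convex hull {v1, v2, v3}"
proof -
  have "bary_point v1 v2 v3 (vector [1, 1, 1]) \<in> interior (convex hull {v1, v2, v3})"
    unfolding mem_interior_hull_triangle[OF assms] by (simp add: bary_coords_bary_point[OF assms] coord_sum_def forall_3)
  then have "interior (convex hull {v1, v2, v3}) \<noteq> {}" by blast
  moreover have "closed (convex hull {v1, v2, v3})"
    by (simp add: compact_imp_closed finite_imp_compact_convex_hull)
  ultimately show ?thesis
    by (simp add: convex_closure_interior)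
qed

text \<open>The right-hand side is continuous on the whole plane, so the limits defining the
  boundary values are simply its values.\<close>

lemma local_basis_eq:
  assumes area: "area2 v1 v2 v3 \<noteq> 0" and i: "1 \<le> i" "i \<le> 28" and x: "x \<in> convex hull {v1, v2, v3}"
  shows "local_basis v1 v2 v3 i x = basis_const * (coef_list ! (i - 1)) * cut_spline 3 (cuts i) (bary_coords v1 v2 v3 x)"
    (is "_ = ?g x")
proof -
  let ?I = "interior (convex hull {v1, v2, v3})"
  let ?f = "\<lambda>y. weight v1 v2 v3 i * simplex_spline (knots v1 v2 v3 i) y"
  show ?thesis
  proof (cases "x \<in> ?I")
    case True
    then show ?thesis by (simp add: local_basis_def simplex_spline_interior[OF area i True])
  next
    case False
    \<comment> \<open>Every point of the triangle lies in the closure of the interior, so the filter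
      is proper and \<open>Lim\<close> is determined by convergence.\<close>
    then have nt: "at x within ?I \<noteq> bot"
      using x closure_interior_triangle[OF area]
      by (simp add: trivial_limit_within islimpt_in_closure)
    have "continuous_on UNIV ?g"
      using continuous_on_cut_spline_Suc[of UNIV 2 "cuts i"]
      by (intro continuous_intros continuous_on_compose2[OF _ continuous_on_bary_coords]) (auto simp: numeral_3_eq_3 numeral_2_eq_2)
    then have "(?g \<longlongrightarrow> ?g x) (at x within ?I)"
      by (meson UNIV_I continuous_on_def tendsto_within_subset subset_UNIV)
    then have "(?f \<longlongrightarrow> ?g x) (at x within ?I)"
      by (rule Lim_transform_eventually)
         (simp add: eventually_at_filter simplex_spline_interior[OF area i])
    then have "Lim (at x within ?I) ?f = ?g x" by (rule tendsto_Lim[OF nt])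
    then show ?thesis using False by (simp add: local_basis_def)
  qed
qed

text \<open>A single list for the whole linear combination, which makes the calculus of
  \<open>cut_spline\<close> and \<open>dir_cuts\<close> available for the spline itself.\<close>

definition spline_cuts :: "(nat \<Rightarrow> real) \<Rightarrow> (real \<times> (real ^ 3)) list" where
  "spline_cuts b = concat (map (\<lambda>i. scale_cuts (b i * coef_list ! (i - 1)) (cuts i)) [1..<29])"

lemma cut_spline_concat_map: "cut_spline k (concat (map f xs)) X = (\<Sum>x\<leftarrow>xs. cut_spline k (f x) X)"
  by (induction xs) (auto simp: cut_spline_def)

lemma dir_cuts_concat_map: "dir_cuts v (concat (map f xs)) = concat (map (\<lambda>x. dir_cuts v (f x)) xs)"
  by (induction xs) (auto simp: dir_cuts_def)

lemma tri_spline_eq: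
  assumes "area2 v1 v2 v3 \<noteq> 0" "x \<in> convex hull {v1, v2, v3}"
  shows "tri_spline v1 v2 v3 b x = basis_const * cut_spline 3 (spline_cuts b) (bary_coords v1 v2 v3 x)"
proof -
  have "tri_spline v1 v2 v3 b x = (\<Sum>i = 1..28. b i * (basis_const * coef_list ! (i - 1) * cut_spline 3 (cuts i) (bary_coords v1 v2 v3 x)))"
    unfolding tri_spline_def using local_basis_eq[OF assms(1) _ _ assms(2)] by (intro sum.cong) auto
  also have "\<dots> = basis_const * (\<Sum>i\<in>{1..<29}. b i * coef_list ! (i - 1) * cut_spline 3 (cuts i) (bary_coords v1 v2 v3 x))"
    unfolding sum_distrib_left by (intro sum.cong) auto
  also have "\<dots> = basis_const * cut_spline 3 (spline_cuts b) (bary_coords v1 v2 v3 x)"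
    by (simp add: spline_cuts_def cut_spline_concat_map cut_spline_scale_cuts interv_sum_list_conv_sum_set_nat del: upt_conv_Cons_Cons)
  finally show ?thesis .
qed

section \<open>Values and derivatives on the edge of the first two vertices\<close>

text \<open>Written with a map over \<open>pieces\<close>, so that the 28 edge values, computed as
  one list, can be substituted in one step.\<close>

lemma cut_spline_spline_cuts:
  "cut_spline k (spline_cuts b) X = (\<Sum>i\<leftarrow>[1,2,3,4,5,6,7,8,9,10,11,12,13,14,15,16,17,18,19,20,21,22,23,24,25,26,27,28].
     b i * coef_list ! (i - 1) * map (\<lambda>(Ws, L). cut_spline k L X) pieces ! (i - 1))" (is "_ = ?S X")
  and cut_spline_dir_cuts_spline_cuts:
  "cut_spline k (dir_cuts v (spline_cuts b)) X = (\<Sum>i\<leftarrow>[1,2,3,4,5,6,7,8,9,10,11,12,13,14,15,16,17,18,19,20,21,22,23,24,25,26,27,28].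
     b i * coef_list ! (i - 1) * map (\<lambda>(Ws, L). cut_spline k (dir_cuts v L) X) pieces ! (i - 1))" (is "_ = ?T X")
proof -
  have u: "[1,2,3,4,5,6,7,8,9,10,11,12,13,14,15,16,17,18,19,20,21,22,23,24,25,26,27,28] = [1..<29]"
    by (simp add: upt_rec)
  have *: "map g pieces ! (i - 1) = g (pieces ! (i - 1))" if "i \<in> set [1..<29]" for g :: "_ \<Rightarrow> real" and i
    using that by (intro nth_map) (auto simp: length_pieces)
  show "cut_spline k (spline_cuts b) X = ?S X"
    unfolding spline_cuts_def cut_spline_concat_map u
    by (intro arg_cong[where f = sum_list] map_cong refl) (simp only: * cut_spline_scale_cuts cuts_def case_prod_beta)
  show "cut_spline k (dir_cuts v (spline_cuts b)) X = ?T X"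
    unfolding spline_cuts_def dir_cuts_concat_map cut_spline_concat_map u
    by (intro arg_cong[where f = sum_list] map_cong refl) (simp only: * dir_cuts_scale_cuts cut_spline_scale_cuts cuts_def case_prod_beta)
qed

lemma axis_eval: "axis 1 1 $ (1 :: 3) = (1 :: real)" "axis 1 1 $ (2 :: 3) = (0 :: real)" "axis 1 1 $ (3 :: 3) = (0 :: real)"
  "axis 2 1 $ (1 :: 3) = (0 :: real)" "axis 2 1 $ (2 :: 3) = (1 :: real)" "axis 2 1 $ (3 :: 3) = (0 :: real)"
  "axis 3 1 $ (1 :: 3) = (0 :: real)" "axis 3 1 $ (2 :: 3) = (0 :: real)" "axis 3 1 $ (3 :: 3) = (1 :: real)"
  by (simp_all add: axis_def)

text \<open>The interval from \<open>k1\<close> to \<open>k31\<close>. Values involve only the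
  functions 1, 4, 10, 13; the transversal derivative adds 5, 16, 19.\<close>

lemma edge_pieces_a:
  assumes "0 \<le> p" "0 \<le> q" "X $ 1 = p + 2 * q" "X $ 2 = q" "X $ 3 = 0"
  shows "map (\<lambda>(Ws, L). cut_spline 3 L X) pieces =
    [1/486 * p^3, 0, 0, 1/108 * p^2 * q + 1/72 * p * q^2 + 1/144 * q^3, 0, 0, 0, 0, 0, 1/108 * p * q^2 + 7/648 * q^3, 0, 0, 1/324 * q^3, 0, 0, 0, 0, 0, 0, 0, 0, 0, 0, 0, 0, 0, 0, 0]"
    "map (\<lambda>(Ws, L). cut_spline 2 (dir_cuts (axis 1 1) L) X) pieces =
    [1/162 * p^2, 0, 0, 1/54 * p * q + 1/72 * q^2, 0, 0, 0, 0, 0, 1/108 * q^2, 0, 0, 0, 0, 0, 0, 0, 0, 0, 0, 0, 0, 0, 0, 0, 0, 0, 0]"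
    "map (\<lambda>(Ws, L). cut_spline 2 (dir_cuts (axis 2 1) L) X) pieces =
    [-1/81 * p^2, 0, 0, 1/108 * p^2 + -1/108 * p * q + -1/144 * q^2, 0, 0, 0, 0, 0, 1/54 * p * q + 1/72 * q^2, 0, 0, 1/108 * q^2, 0, 0, 0, 0, 0, 0, 0, 0, 0, 0, 0, 0, 0, 0, 0]"
    "map (\<lambda>(Ws, L). cut_spline 2 (dir_cuts (axis 3 1) L) X) pieces =
    [-1/81 * p^2, 0, 0, -1/27 * p * q + -1/36 * q^2, 1/108 * p^2, 0, 0, 0, 0, -1/54 * q^2, 0, 0, -1/54 * q^2, 0, 0, 1/36 * p * q + 1/48 * q^2, 0, 0, 1/36 * q^2, 0, 0, 0, 0, 0, 0, 0, 0, 0]"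
  using assms(1,2) unfolding pieces_def
  by (simp only: list.map prod.case dir_cuts_relabel cut_spline_relabel cut_spline_simps cuts_defs axis_eval assms(3-5); simp add: trunc_pow_nonpos;
      simp add: trunc_pow_nonneg fact_numeral field_simps power2_eq_square power3_eq_cube)+

text \<open>The middle interval from \<open>k31\<close> to \<open>k32\<close>: values from 4, 7, 10,
  13, and 16, 17, 19 in the transversal derivative.\<close>

lemma edge_pieces_b:
  assumes "0 \<le> p" "0 \<le> q" "X $ 1 = 2 * p + q" "X $ 2 = p + 2 * q" "X $ 3 = 0"
  shows "map (\<lambda>(Ws, L). cut_spline 3 L X) pieces =
    [0, 0, 0, 1/144 * p^3, 0, 0, 1/144 * q^3, 0, 0, 7/648 * p^3 + 1/27 * p^2 * q + 1/54 * p * q^2 + 1/324 * q^3, 0, 0, 1/324 * p^3 + 1/54 * p^2 * q + 1/27 * p * q^2 + 7/648 * q^3, 0, 0, 0, 0, 0, 0, 0, 0, 0, 0, 0, 0, 0, 0, 0]"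
    "map (\<lambda>(Ws, L). cut_spline 2 (dir_cuts (axis 1 1) L) X) pieces =
    [0, 0, 0, 1/72 * p^2, 0, 0, -1/144 * q^2, 0, 0, 1/108 * p^2 + 1/27 * p * q + 1/108 * q^2, 0, 0, 1/72 * q^2, 0, 0, 0, 0, 0, 0, 0, 0, 0, 0, 0, 0, 0, 0, 0]"
    "map (\<lambda>(Ws, L). cut_spline 2 (dir_cuts (axis 2 1) L) X) pieces =
    [0, 0, 0, -1/144 * p^2, 0, 0, 1/72 * q^2, 0, 0, 1/72 * p^2, 0, 0, 1/108 * p^2 + 1/27 * p * q + 1/108 * q^2, 0, 0, 0, 0, 0, 0, 0, 0, 0, 0, 0, 0, 0, 0, 0]"
    "map (\<lambda>(Ws, L). cut_spline 2 (dir_cuts (axis 3 1) L) X) pieces =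
    [0, 0, 0, -1/36 * p^2, 0, 0, -1/36 * q^2, 0, 0, -1/54 * p^2 + -2/27 * p * q + -1/54 * q^2, 0, 0, -1/54 * p^2 + -2/27 * p * q + -1/54 * q^2, 0, 0, 1/48 * p^2, 1/48 * q^2, 0, 1/36 * p^2 + 1/9 * p * q + 1/36 * q^2, 0, 0, 0, 0, 0, 0, 0, 0, 0]"
  using assms(1,2) unfolding pieces_def
  by (simp only: list.map prod.case dir_cuts_relabel cut_spline_relabel cut_spline_simps cuts_defs axis_eval assms(3-5); simp add: trunc_pow_nonpos;
      simp add: trunc_pow_nonneg fact_numeral field_simps power2_eq_square power3_eq_cube)+

text \<open>The interval from \<open>k32\<close> to \<open>k2\<close>, the mirror image of the
  first: values from 2, 7, 10, 13, and 6, 17, 19 in the transversal derivative.\<close>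

lemma edge_pieces_c:
  assumes "0 \<le> p" "0 \<le> q" "X $ 1 = p" "X $ 2 = 2 * p + q" "X $ 3 = 0"
  shows "map (\<lambda>(Ws, L). cut_spline 3 L X) pieces =
    [0, 1/486 * q^3, 0, 0, 0, 0, 1/144 * p^3 + 1/72 * p^2 * q + 1/108 * p * q^2, 0, 0, 1/324 * p^3, 0, 0, 7/648 * p^3 + 1/108 * p^2 * q, 0, 0, 0, 0, 0, 0, 0, 0, 0, 0, 0, 0, 0, 0, 0]"
    "map (\<lambda>(Ws, L). cut_spline 2 (dir_cuts (axis 1 1) L) X) pieces =
    [0, -1/81 * q^2, 0, 0, 0, 0, -1/144 * p^2 + -1/108 * p * q + 1/108 * q^2, 0, 0, 1/108 * p^2, 0, 0, 1/72 * p^2 + 1/54 * p * q, 0, 0, 0, 0, 0, 0, 0, 0, 0, 0, 0, 0, 0, 0, 0]"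
    "map (\<lambda>(Ws, L). cut_spline 2 (dir_cuts (axis 2 1) L) X) pieces =
    [0, 1/162 * q^2, 0, 0, 0, 0, 1/72 * p^2 + 1/54 * p * q, 0, 0, 0, 0, 0, 1/108 * p^2, 0, 0, 0, 0, 0, 0, 0, 0, 0, 0, 0, 0, 0, 0, 0]"
    "map (\<lambda>(Ws, L). cut_spline 2 (dir_cuts (axis 3 1) L) X) pieces =
    [0, -1/81 * q^2, 0, 0, 0, 1/108 * q^2, -1/36 * p^2 + -1/27 * p * q, 0, 0, -1/54 * p^2, 0, 0, -1/54 * p^2, 0, 0, 0, 1/48 * p^2 + 1/36 * p * q, 0, 1/36 * p^2, 0, 0, 0, 0, 0, 0, 0, 0, 0]"
  using assms(1,2) unfolding pieces_def
  by (simp only: list.map prod.case dir_cuts_relabel cut_spline_relabel cut_spline_simps cuts_defs axis_eval assms(3-5); simp add: trunc_pow_nonpos;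
      simp add: trunc_pow_nonneg fact_numeral field_simps power2_eq_square power3_eq_cube)+

lemma edge_spline_a:
  assumes "0 \<le> p" "0 \<le> q" "X $ 1 = p + 2 * q" "X $ 2 = q" "X $ 3 = 0"
  shows "cut_spline 3 (spline_cuts b) X =
      b 1 * (1/2916 * p^3)
      + b 4 * (1/324 * p^2 * q + 1/216 * p * q^2 + 1/432 * q^3)
      + b 10 * (1/216 * p * q^2 + 7/1296 * q^3)
      + b 13 * (1/648 * q^3)"
    "cut_spline 2 (dir_cuts (axis 1 1) (spline_cuts b)) X =
      b 1 * (1/972 * p^2)
      + b 4 * (1/162 * p * q + 1/216 * q^2)
      + b 10 * (1/216 * q^2)"
    "cut_spline 2 (dir_cuts (axis 2 1) (spline_cuts b)) X =
      b 1 * (-1/486 * p^2)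
      + b 4 * (1/324 * p^2 + -1/324 * p * q + -1/432 * q^2)
      + b 10 * (1/108 * p * q + 1/144 * q^2)
      + b 13 * (1/216 * q^2)"
    "cut_spline 2 (dir_cuts (axis 3 1) (spline_cuts b)) X =
      b 1 * (-1/486 * p^2)
      + b 4 * (-1/81 * p * q + -1/108 * q^2)
      + b 5 * (1/324 * p^2)
      + b 10 * (-1/108 * q^2)
      + b 13 * (-1/108 * q^2)
      + b 16 * (1/54 * p * q + 1/72 * q^2)
      + b 19 * (5/216 * q^2)"
  unfolding cut_spline_spline_cuts cut_spline_dir_cuts_spline_cuts edge_pieces_a[OF assms]
  by (simp_all add: coef_list_def algebra_simps)

lemma edge_spline_b:
  assumes "0 \<le> p" "0 \<le> q" "X $ 1 = 2 * p + q" "X $ 2 = p + 2 * q" "X $ 3 = 0"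
  shows "cut_spline 3 (spline_cuts b) X =
      b 4 * (1/432 * p^3)
      + b 7 * (1/432 * q^3)
      + b 10 * (7/1296 * p^3 + 1/54 * p^2 * q + 1/108 * p * q^2 + 1/648 * q^3)
      + b 13 * (1/648 * p^3 + 1/108 * p^2 * q + 1/54 * p * q^2 + 7/1296 * q^3)"
    "cut_spline 2 (dir_cuts (axis 1 1) (spline_cuts b)) X =
      b 4 * (1/216 * p^2)
      + b 7 * (-1/432 * q^2)
      + b 10 * (1/216 * p^2 + 1/54 * p * q + 1/216 * q^2)
      + b 13 * (1/144 * q^2)"
    "cut_spline 2 (dir_cuts (axis 2 1) (spline_cuts b)) X =
      b 4 * (-1/432 * p^2)
      + b 7 * (1/216 * q^2)
      + b 10 * (1/144 * p^2)
      + b 13 * (1/216 * p^2 + 1/54 * p * q + 1/216 * q^2)"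
    "cut_spline 2 (dir_cuts (axis 3 1) (spline_cuts b)) X =
      b 4 * (-1/108 * p^2)
      + b 7 * (-1/108 * q^2)
      + b 10 * (-1/108 * p^2 + -1/27 * p * q + -1/108 * q^2)
      + b 13 * (-1/108 * p^2 + -1/27 * p * q + -1/108 * q^2)
      + b 16 * (1/72 * p^2)
      + b 17 * (1/72 * q^2)
      + b 19 * (5/216 * p^2 + 5/54 * p * q + 5/216 * q^2)"
  unfolding cut_spline_spline_cuts cut_spline_dir_cuts_spline_cuts edge_pieces_b[OF assms]
  by (simp_all add: coef_list_def algebra_simps)

lemma edge_spline_c:
  assumes "0 \<le> p" "0 \<le> q" "X $ 1 = p" "X $ 2 = 2 * p + q" "X $ 3 = 0"
  shows "cut_spline 3 (spline_cuts b) X =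
      b 2 * (1/2916 * q^3)
      + b 7 * (1/432 * p^3 + 1/216 * p^2 * q + 1/324 * p * q^2)
      + b 10 * (1/648 * p^3)
      + b 13 * (7/1296 * p^3 + 1/216 * p^2 * q)"
    "cut_spline 2 (dir_cuts (axis 1 1) (spline_cuts b)) X =
      b 2 * (-1/486 * q^2)
      + b 7 * (-1/432 * p^2 + -1/324 * p * q + 1/324 * q^2)
      + b 10 * (1/216 * p^2)
      + b 13 * (1/144 * p^2 + 1/108 * p * q)"
    "cut_spline 2 (dir_cuts (axis 2 1) (spline_cuts b)) X =
      b 2 * (1/972 * q^2)
      + b 7 * (1/216 * p^2 + 1/162 * p * q)
      + b 13 * (1/216 * p^2)"
    "cut_spline 2 (dir_cuts (axis 3 1) (spline_cuts b)) X =
      b 2 * (-1/486 * q^2)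
      + b 6 * (1/324 * q^2)
      + b 7 * (-1/108 * p^2 + -1/81 * p * q)
      + b 10 * (-1/108 * p^2)
      + b 13 * (-1/108 * p^2)
      + b 17 * (1/72 * p^2 + 1/54 * p * q)
      + b 19 * (5/216 * p^2)"
  unfolding cut_spline_spline_cuts cut_spline_dir_cuts_spline_cuts edge_pieces_c[OF assms]
  by (simp_all add: coef_list_def algebra_simps)

section \<open>Traces on the common edge\<close>

lemma cut_spline_dir_cuts_expand:
  fixes v :: "real ^ 3"
  shows "cut_spline k (dir_cuts v L) X = v $ 1 * cut_spline k (dir_cuts (axis 1 1) L) X + v $ 2 * cut_spline k (dir_cuts (axis 2 1) L) X
    + v $ 3 * cut_spline k (dir_cuts (axis 3 1) L) X"
  unfolding cut_spline_def dir_cuts_def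
proof (induction L)
  case (Cons p L)
  then show ?case by (cases p) (simp add: inner_axis inner_vec_def[of _ v] sum_3 algebra_simps)
qed simp

text \<open>The first two axes lie in the plane \<open>X $ 3 = 0\<close>, so derivatives along them
  are governed by the same six coefficients as the values on the edge.\<close>

lemma edge_agree:
  fixes X :: "real ^ 3"
  assumes "\<forall>i\<in>{1, 2, 4, 7, 10, 13}. b' i = b i" "0 \<le> X $ 1" "0 \<le> X $ 2" "X $ 3 = 0"
  shows "cut_spline 3 (spline_cuts b') X = cut_spline 3 (spline_cuts b) X"
    "cut_spline 2 (dir_cuts (axis 1 1) (spline_cuts b')) X = cut_spline 2 (dir_cuts (axis 1 1) (spline_cuts b)) X"
    "cut_spline 2 (dir_cuts (axis 2 1) (spline_cuts b')) X = cut_spline 2 (dir_cuts (axis 2 1) (spline_cuts b)) X"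
proof (atomize (full), cases rule: edge_cases[OF assms(2,3)])
  case (1 p q)
  show "cut_spline 3 (spline_cuts b') X = cut_spline 3 (spline_cuts b) X \<and>
    cut_spline 2 (dir_cuts (axis 1 1) (spline_cuts b')) X = cut_spline 2 (dir_cuts (axis 1 1) (spline_cuts b)) X \<and>
    cut_spline 2 (dir_cuts (axis 2 1) (spline_cuts b')) X = cut_spline 2 (dir_cuts (axis 2 1) (spline_cuts b)) X"
    unfolding edge_spline_a[OF 1 assms(4)] using assms(1) by simp
next
  case (2 p q)
  show "cut_spline 3 (spline_cuts b') X = cut_spline 3 (spline_cuts b) X \<and>
    cut_spline 2 (dir_cuts (axis 1 1) (spline_cuts b')) X = cut_spline 2 (dir_cuts (axis 1 1) (spline_cuts b)) X \<and>
    cut_spline 2 (dir_cuts (axis 2 1) (spline_cuts b')) X = cut_spline 2 (dir_cuts (axis 2 1) (spline_cuts b)) X"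
    unfolding edge_spline_b[OF 2 assms(4)] using assms(1) by simp
next
  case (3 p q)
  show "cut_spline 3 (spline_cuts b') X = cut_spline 3 (spline_cuts b) X \<and>
    cut_spline 2 (dir_cuts (axis 1 1) (spline_cuts b')) X = cut_spline 2 (dir_cuts (axis 1 1) (spline_cuts b)) X \<and>
    cut_spline 2 (dir_cuts (axis 2 1) (spline_cuts b')) X = cut_spline 2 (dir_cuts (axis 2 1) (spline_cuts b)) X"
    unfolding edge_spline_c[OF 3 assms(4)] using assms(1) by simp
qed

lemma edge_determines:
  assumes "\<And>X. \<lbrakk>0 \<le> X $ 1; 0 \<le> X $ 2; X $ 3 = 0; coord_sum X = 3\<rbrakk>
      \<Longrightarrow> cut_spline 3 (spline_cuts b') X = cut_spline 3 (spline_cuts b) X"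
  shows "\<forall>i\<in>{1, 2, 4, 7, 10, 13}. b' i = b i"
proof -
  define A C where "A b p q = b 1 * (1/2916 * p^3) + b 4 * (1/324 * p^2 * q + 1/216 * p * q^2 + 1/432 * q^3)
      + b 10 * (1/216 * p * q^2 + 7/1296 * q^3) + b 13 * (1/648 * q^3)"
    and "C b p q = b 2 * (1/2916 * q^3) + b 7 * (1/432 * p^3 + 1/216 * p^2 * q + 1/324 * p * q^2)
      + b 10 * (1/648 * p^3) + b 13 * (7/1296 * p^3 + 1/216 * p^2 * q)" for b :: "nat \<Rightarrow> real" and p q :: real
  have a: "A b' p q = A b p q" if "0 \<le> p" "0 \<le> q" "p + 3 * q = 3" for p q
  proof -
    let ?X = "vector [p + 2 * q, q, 0] :: real ^ 3"
    have "cut_spline 3 (spline_cuts b) ?X = A b p q" for b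
      unfolding A_def using that by (intro edge_spline_a) simp_all
    moreover have "cut_spline 3 (spline_cuts b') ?X = cut_spline 3 (spline_cuts b) ?X"
      using that by (intro assms) (simp_all add: coord_sum_def)
    ultimately show ?thesis by simp
  qed
  have c: "C b' p q = C b p q" if "0 \<le> p" "0 \<le> q" "3 * p + q = 3" for p q
  proof -
    let ?X = "vector [p, 2 * p + q, 0] :: real ^ 3"
    have "cut_spline 3 (spline_cuts b) ?X = C b p q" for b
      unfolding C_def using that by (intro edge_spline_c) simp_all
    moreover have "cut_spline 3 (spline_cuts b') ?X = cut_spline 3 (spline_cuts b) ?X"
      using that by (intro assms) (simp_all add: coord_sum_def)
    ultimately show ?thesis by simp
  qed
  have 12: "b' 1 = b 1" "b' 2 = b 2" using a[of 3 0] c[of 0 3] by (simp_all add: A_def C_def)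
  \<comment> \<open>After the two vertices, the sample points are the midpoints of the outer
    intervals and the inner knots \<open>k31\<close> and \<open>k32\<close>. With denominators 10368
    and 1296 cleared they give a nonsingular system for the four remaining coefficients.\<close>
  have eqs: "A b' (3/2) (1/2) = A b (3/2) (1/2)" "A b' 0 1 = A b 0 1" "C b' 1 0 = C b 1 0"
    "C b' (1/2) (3/2) = C b (1/2) (3/2)"
    by (rule a c; simp)+
  have "57 * b' 4 + 25 * b' 10 + 2 * b' 13 = 57 * b 4 + 25 * b 10 + 2 * b 13"
    "3 * b' 4 + 7 * b' 10 + 2 * b' 13 = 3 * b 4 + 7 * b 10 + 2 * b 13"
    "3 * b' 7 + 7 * b' 13 + 2 * b' 10 = 3 * b 7 + 7 * b 13 + 2 * b 10"
    "57 * b' 7 + 25 * b' 13 + 2 * b' 10 = 57 * b 7 + 25 * b 13 + 2 * b 10"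
    using eqs unfolding A_def C_def 12 by (simp_all add: power2_eq_square power3_eq_cube)
  then have "b' 4 = b 4 \<and> b' 7 = b 7 \<and> b' 10 = b 10 \<and> b' 13 = b 13" by linarith
  then show ?thesis using 12 by simp
qed

text \<open>Each defect is multiplied by the transversal trace of its weighted basis function;
  replacing \<open>h3\<close> by \<open>1 - h1 - h2\<close> cancels the rest. In the middle interval
  \<open>b 10\<close> enters with \<open>(3 * h1 + 2 * h2) / 216\<close> times
  \<open>p^2 + 4 * p * q + q^2\<close>, against \<open>5/216\<close> for index 19, whence 3/5 and
  2/5. The leftover \<open>h2/144 * p^2\<close> is \<open>h2 / 2\<close> times the trace
  \<open>1/72 * p^2\<close> of index 16, whence the halves.\<close>

lemma edge_residual:
  fixes X :: "real ^ 3" and h1 h2 h3 :: real and b b' :: "nat \<Rightarrow> real"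
  assumes eq: "\<forall>i\<in>{1, 2, 4, 7, 10, 13}. b' i = b i" and h: "h1 + h2 + h3 = 1"
    and pq: "0 \<le> p" "0 \<le> q" and X3: "X $ 3 = 0"
  defines "e5 \<equiv> b' 5 - (h1 * b 1 + h2 * b 4 + h3 * b 5)"
    and "e16 \<equiv> b' 16 - ((h1 + h2 / 2) * b 4 + h2 / 2 * b 10 + h3 * b 16)"
    and "e19 \<equiv> b' 19 - ((3/5 * h1 + 2/5 * h2) * b 10 + (2/5 * h1 + 3/5 * h2) * b 13 + h3 * b 19)"
    and "e17 \<equiv> b' 17 - ((h1 / 2 + h2) * b 7 + h1 / 2 * b 13 + h3 * b 17)"
    and "e6 \<equiv> b' 6 - (h1 * b 7 + h2 * b 2 + h3 * b 6)"
    and "R \<equiv> cut_spline 2 (dir_cuts (axis 3 1) (spline_cuts b')) X - (h1 * cut_spline 2 (dir_cuts (axis 1 1) (spline_cuts b)) X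
        + h2 * cut_spline 2 (dir_cuts (axis 2 1) (spline_cuts b)) X + h3 * cut_spline 2 (dir_cuts (axis 3 1) (spline_cuts b)) X)"
  shows "\<lbrakk>X $ 1 = p + 2 * q; X $ 2 = q\<rbrakk> \<Longrightarrow>
      R = e5 * (1/324 * p^2) + e16 * (1/54 * p * q + 1/72 * q^2) + e19 * (5/216 * q^2)"
    and "\<lbrakk>X $ 1 = 2 * p + q; X $ 2 = p + 2 * q\<rbrakk> \<Longrightarrow>
      R = e16 * (1/72 * p^2) + e17 * (1/72 * q^2) + e19 * (5/216 * p^2 + 5/54 * p * q + 5/216 * q^2)"
    and "\<lbrakk>X $ 1 = p; X $ 2 = 2 * p + q\<rbrakk> \<Longrightarrow>
      R = e6 * (1/324 * q^2) + e17 * (1/54 * p * q + 1/72 * p^2) + e19 * (5/216 * p^2)"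
proof -
  have b: "b' 1 = b 1" "b' 2 = b 2" "b' 4 = b 4" "b' 7 = b 7" "b' 10 = b 10" "b' 13 = b 13"
    and h3: "h3 = 1 - h1 - h2" using eq h by auto
  show "\<lbrakk>X $ 1 = p + 2 * q; X $ 2 = q\<rbrakk> \<Longrightarrow>
      R = e5 * (1/324 * p^2) + e16 * (1/54 * p * q + 1/72 * q^2) + e19 * (5/216 * q^2)"
    unfolding R_def e5_def e16_def e19_def h3
    by (simp only: edge_spline_a[OF pq _ _ X3] b) (simp add: field_simps)
  show "\<lbrakk>X $ 1 = 2 * p + q; X $ 2 = p + 2 * q\<rbrakk> \<Longrightarrow>
      R = e16 * (1/72 * p^2) + e17 * (1/72 * q^2) + e19 * (5/216 * p^2 + 5/54 * p * q + 5/216 * q^2)"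
    unfolding R_def e16_def e17_def e19_def h3
    by (simp only: edge_spline_b[OF pq _ _ X3] b) (simp add: field_simps)
  show "\<lbrakk>X $ 1 = p; X $ 2 = 2 * p + q\<rbrakk> \<Longrightarrow>
      R = e6 * (1/324 * q^2) + e17 * (1/54 * p * q + 1/72 * p^2) + e19 * (5/216 * p^2)"
    unfolding R_def e6_def e17_def e19_def h3
    by (simp only: edge_spline_c[OF pq _ _ X3] b) (simp add: field_simps)
qed

lemma edge_gradient_iff:
  fixes h1 h2 h3 :: real and b b' :: "nat \<Rightarrow> real"
  assumes eq: "\<forall>i\<in>{1, 2, 4, 7, 10, 13}. b' i = b i" and h: "h1 + h2 + h3 = 1"
  shows "(\<forall>X. 0 < X $ 1 \<longrightarrow> 0 < X $ 2 \<longrightarrow> X $ 3 = 0 \<longrightarrow> coord_sum X = 3 \<longrightarrow>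
       cut_spline 2 (dir_cuts (axis 3 1) (spline_cuts b')) X = h1 * cut_spline 2 (dir_cuts (axis 1 1) (spline_cuts b)) X
        + h2 * cut_spline 2 (dir_cuts (axis 2 1) (spline_cuts b)) X + h3 * cut_spline 2 (dir_cuts (axis 3 1) (spline_cuts b)) X)
    \<longleftrightarrow> b' 5 = h1 * b 1 + h2 * b 4 + h3 * b 5
      \<and> b' 16 = (h1 + h2 / 2) * b 4 + h2 / 2 * b 10 + h3 * b 16
      \<and> b' 19 = (3/5 * h1 + 2/5 * h2) * b 10 + (2/5 * h1 + 3/5 * h2) * b 13 + h3 * b 19
      \<and> b' 17 = (h1 / 2 + h2) * b 7 + h1 / 2 * b 13 + h3 * b 17
      \<and> b' 6 = h1 * b 7 + h2 * b 2 + h3 * b 6" (is "?L \<longleftrightarrow> ?R")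
proof
  assume L: ?L
  define D where "D X = cut_spline 2 (dir_cuts (axis 3 1) (spline_cuts b')) X - (h1 * cut_spline 2 (dir_cuts (axis 1 1) (spline_cuts b)) X
        + h2 * cut_spline 2 (dir_cuts (axis 2 1) (spline_cuts b)) X + h3 * cut_spline 2 (dir_cuts (axis 3 1) (spline_cuts b)) X)" for X
  have D: "D (vector [y, z, 0]) = 0" if "0 < y" "0 < z" "y + z = 3" for y z
    unfolding D_def using L[rule_format, of "vector [y, z, 0]"] that by (simp add: coord_sum_def)
  have D3: "vector [y, z, 0] $ (3 :: 3) = (0 :: real)" for y z :: real by simp
  note res = edge_residual[OF eq h _ _ D3, folded D_def]
  define e5 where "e5 = b' 5 - (h1 * b 1 + h2 * b 4 + h3 * b 5)"
  define e16 where "e16 = b' 16 - ((h1 + h2 / 2) * b 4 + h2 / 2 * b 10 + h3 * b 16)"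
  define e19 where "e19 = b' 19 - ((3/5 * h1 + 2/5 * h2) * b 10 + (2/5 * h1 + 3/5 * h2) * b 13 + h3 * b 19)"
  define e17 where "e17 = b' 17 - ((h1 / 2 + h2) * b 7 + h1 / 2 * b 13 + h3 * b 17)"
  define e6 where "e6 = b' 6 - (h1 * b 7 + h2 * b 2 + h3 * b 6)"
  note res = res[folded e5_def e16_def e19_def e17_def e6_def]
  \<comment> \<open>Five points of the open edge, namely the midpoints of the three intervals and
    the two inner knots, give five independent equations for the five defects.\<close>
  have "e5 * (1/324 * (3/2)^2) + e16 * (1/54 * (3/2) * (1/2) + 1/72 * (1/2)^2) + e19 * (5/216 * (1/2)^2) = 0"
    using res(1)[of "3/2" "1/2" "5/2" "1/2"] D[of "5/2" "1/2"] by simp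
  moreover have "e5 * (1/324 * 0^2) + e16 * (1/54 * 0 * 1 + 1/72 * 1^2) + e19 * (5/216 * 1^2) = 0"
    using res(1)[of 0 1 2 1] D[of 2 1] by simp
  moreover have "e16 * (1/72 * (1/2)^2) + e17 * (1/72 * (1/2)^2) + e19 * (5/216 * (1/2)^2 + 5/54 * (1/2) * (1/2) + 5/216 * (1/2)^2) = 0"
    using res(2)[of "1/2" "1/2" "3/2" "3/2"] D[of "3/2" "3/2"] by simp
  moreover have "e6 * (1/324 * 0^2) + e17 * (1/54 * 1 * 0 + 1/72 * 1^2) + e19 * (5/216 * 1^2) = 0"
    using res(3)[of 1 0 1 2] D[of 1 2] by simp
  moreover have "e6 * (1/324 * (3/2)^2) + e17 * (1/54 * (1/2) * (3/2) + 1/72 * (1/2)^2) + e19 * (5/216 * (1/2)^2) = 0"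
    using res(3)[of "1/2" "3/2" "1/2" "5/2"] D[of "1/2" "5/2"] by simp
  ultimately have "6 * e5 + 15 * e16 + 5 * e19 = 0" "3 * e16 + 5 * e19 = 0" "3 * e16 + 3 * e17 + 30 * e19 = 0"
    "3 * e17 + 5 * e19 = 0" "6 * e6 + 15 * e17 + 5 * e19 = 0"
    by (simp_all add: power2_eq_square)
  then have "e5 = 0 \<and> e16 = 0 \<and> e19 = 0 \<and> e17 = 0 \<and> e6 = 0" by linarith
  then show ?R
    unfolding e5_def e16_def e19_def e17_def e6_def by simp
next
  assume R: ?R
  show ?L
  proof (intro allI impI)
    fix X :: "real ^ 3" assume "0 < X $ 1" "0 < X $ 2" and X3: "X $ 3 = 0"
    then have X: "0 \<le> X $ 1" "0 \<le> X $ 2" by simp_all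
    have "cut_spline 2 (dir_cuts (axis 3 1) (spline_cuts b')) X - (h1 * cut_spline 2 (dir_cuts (axis 1 1) (spline_cuts b)) X
        + h2 * cut_spline 2 (dir_cuts (axis 2 1) (spline_cuts b)) X + h3 * cut_spline 2 (dir_cuts (axis 3 1) (spline_cuts b)) X) = 0"
    proof (cases rule: edge_cases[OF X])
      case (1 p q)
      then show ?thesis using R by (subst edge_residual(1)[OF eq h _ _ X3, of p q]) simp_all
    next
      case (2 p q)
      then show ?thesis using R by (subst edge_residual(2)[OF eq h _ _ X3, of p q]) simp_all
    next
      case (3 p q)
      then show ?thesis using R by (subst edge_residual(3)[OF eq h _ _ X3, of p q]) simp_all
    qed
    then show "cut_spline 2 (dir_cuts (axis 3 1) (spline_cuts b')) X = h1 * cut_spline 2 (dir_cuts (axis 1 1) (spline_cuts b)) X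
        + h2 * cut_spline 2 (dir_cuts (axis 2 1) (spline_cuts b)) X + h3 * cut_spline 2 (dir_cuts (axis 3 1) (spline_cuts b)) X"
      by simp
  qed
qed

section \<open>Smoothness across the common edge\<close>

locale two_triangles =
  fixes p1 p2 p3 p4 :: "real ^ 2" and h1 h2 h3 :: real and b b' :: "nat \<Rightarrow> real"
  assumes areaL: "area2 p1 p2 p3 \<noteq> 0" and areaR: "area2 p1 p2 p4 \<noteq> 0"
    and disj: "interior (convex hull {p1, p2, p3}) \<inter> interior (convex hull {p1, p2, p4}) = {}"
    and p4: "p4 = h1 *\<^sub>R p1 + h2 *\<^sub>R p2 + h3 *\<^sub>R p3" and h: "h1 + h2 + h3 = 1"
begin

abbreviation "TL \<equiv> convex hull {p1, p2, p3}"
abbreviation "TR \<equiv> convex hull {p1, p2, p4}"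
abbreviation "xL \<equiv> bary_coords p1 p2 p3"
abbreviation "xR \<equiv> bary_coords p1 p2 p4"
abbreviation "sL \<equiv> tri_spline p1 p2 p3 b"
abbreviation "sR \<equiv> tri_spline p1 p2 p4 b'"

text \<open>The truncated power formulas on the whole plane. They agree with the splines on the
  closed triangles and are differentiable everywhere, so the two sides can be compared at edge
  points.\<close>

definition fL :: "real ^ 2 \<Rightarrow> real" where "fL x = basis_const * cut_spline 3 (spline_cuts b) (xL x)"
definition fR :: "real ^ 2 \<Rightarrow> real" where "fR x = basis_const * cut_spline 3 (spline_cuts b') (xR x)"
text \<open>Passage from coordinates in the right triangle to coordinates in the left one: the third
  vertex \<open>p4\<close> has left coordinates proportional to \<open>h1, h2, h3\<close>.\<close>

definition change :: "real ^ 3 \<Rightarrow> real ^ 3" where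
  "change Y = vector [Y $ 1 + h1 * Y $ 3, Y $ 2 + h2 * Y $ 3, h3 * Y $ 3]"
text \<open>The linear part of the affine map \<open>xR\<close>, that is, the coordinates of a
  direction; their sum is 0.\<close>

definition lR :: "real ^ 2 \<Rightarrow> real ^ 3" where "lR v = xR v - xR 0"
definition lL :: "real ^ 2 \<Rightarrow> real ^ 3" where "lL v = xL v - xL 0"
definition DL :: "real ^ 2 \<Rightarrow> real ^ 2 \<Rightarrow> real" where
  "DL x v = basis_const * cut_spline 2 (dir_cuts (lL v) (spline_cuts b)) (xL x)"
definition DR :: "real ^ 2 \<Rightarrow> real ^ 2 \<Rightarrow> real" where
  "DR x v = basis_const * cut_spline 2 (dir_cuts (lR v) (spline_cuts b')) (xR x)"

lemma bary_point_change: "bary_point p1 p2 p3 (change Y) = bary_point p1 p2 p4 Y"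
  by (simp add: bary_point_def change_def p4 algebra_simps add_divide_distrib)

lemma xL_xR: "xL x = change (xR x)"
proof -
  have "coord_sum (change (xR x)) = xR x $ 1 + xR x $ 2 + (h1 + h2 + h3) * xR x $ 3"
    by (simp add: coord_sum_def change_def algebra_simps)
  then have "coord_sum (change (xR x)) = 3"
    using coord_sum_bary_coords[OF areaR, of x] by (simp add: h coord_sum_def)
  then show ?thesis
    using bary_coords_bary_point[OF areaL, of "change (xR x)"] by (simp add: bary_point_change bary_point_bary_coords[OF areaR])
qed

lemma xL_bary_point: "coord_sum Y = 3 \<Longrightarrow> xL (bary_point p1 p2 p4 Y) = change Y"
  by (simp add: xL_xR bary_coords_bary_point[OF areaR])

lemma change_linear: "change (X - Y) = change X - change Y" "change (X + r *\<^sub>R Y) = change X + r *\<^sub>R change Y"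
  by (simp_all add: change_def vec_eq_iff forall_3 algebra_simps)

lemma lL_lR: "lL v = change (lR v)"
  by (simp add: lL_def lR_def xL_xR change_linear)

lemma xR_ray: "xR (x + t *\<^sub>R v) = xR x + t *\<^sub>R lR v"
  unfolding lR_def by (rule bary_coords_affine)

lemma xL_ray: "xL (x + t *\<^sub>R v) = xL x + t *\<^sub>R lL v"
  unfolding lL_def by (rule bary_coords_affine)

text \<open>Disjointness of the interiors enters here: for positive \<open>h3\<close> a point just
  off the midpoint of the edge, towards \<open>p4\<close>, would be interior to both
  triangles.\<close>

lemma h3_neg: "h3 < 0"
proof (rule ccontr)
  assume "\<not> h3 < 0"
  moreover have "area2 p1 p2 p4 = h3 * area2 p1 p2 p3"
  proof -
    have h1: "h1 = 1 - h2 - h3" using h by simp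
    show ?thesis by (simp add: area2_def p4 h1 algebra_simps)
  qed
  ultimately have h3: "0 < h3" using areaR by (cases "h3 = 0") auto
  \<comment> \<open>So small that \<open>h1 * d\<close> and \<open>h2 * d\<close> are at least -1/2,
    while the first two coordinates of \<open>Y\<close> are at least 5/4.\<close>
  define d where "d = 1 / (2 * (1 + \<bar>h1\<bar> + \<bar>h2\<bar>))"
  have d: "0 < d" "d \<le> 1 / 2" "\<bar>h1\<bar> * d \<le> 1 / 2" "\<bar>h2\<bar> * d \<le> 1 / 2"
    by (simp_all add: d_def field_simps add_pos_nonneg)
  define Y :: "real ^ 3" where "Y = vector [(3 - d) / 2, (3 - d) / 2, d]"
  have cY: "coord_sum Y = 3" by (simp add: Y_def coord_sum_def)
  have "- (\<bar>h1\<bar> * d) \<le> h1 * d" "- (\<bar>h2\<bar> * d) \<le> h2 * d"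
    using d(1) by (simp_all add: abs_if)
  moreover have "- (1 / 2) \<le> - (\<bar>h1\<bar> * d)" "- (1 / 2) \<le> - (\<bar>h2\<bar> * d)" using d by simp_all
  ultimately have "- (1 / 2) \<le> h1 * d" "- (1 / 2) \<le> h2 * d" by (blast intro: order_trans)+
  moreover have "5 / 4 \<le> (3 - d) / 2" using d(2) by simp
  ultimately have pos: "0 < (3 - d) / 2 + h1 * d" "0 < (3 - d) / 2 + h2 * d" by linarith+
  have h3d: "0 < h3 * d" using d h3 by simp
  have "bary_point p1 p2 p4 Y \<in> interior TR"
    unfolding mem_interior_hull_triangle[OF areaR] bary_coords_bary_point[OF areaR cY] using d by (simp add: Y_def forall_3)
  moreover have "bary_point p1 p2 p4 Y \<in> interior TL"
    unfolding mem_interior_hull_triangle[OF areaL] xL_bary_point[OF cY] using pos h3d by (simp add: Y_def change_def forall_3)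
  ultimately show False using disj by blast
qed

lemma mem_TL: "x \<in> TL \<longleftrightarrow> (\<forall>i. 0 \<le> xL x $ i)"
  by (rule mem_hull_triangle[OF areaL])

lemma mem_TR: "x \<in> TR \<longleftrightarrow> (\<forall>i. 0 \<le> xR x $ i)"
  by (rule mem_hull_triangle[OF areaR])

lemma sL_eq: "x \<in> TL \<Longrightarrow> sL x = fL x"
  unfolding fL_def by (rule tri_spline_eq[OF areaL])

lemma sR_eq: "x \<in> TR \<Longrightarrow> sR x = fR x"
  unfolding fR_def by (rule tri_spline_eq[OF areaR])

lemma xL3: "xL x $ 3 = h3 * xR x $ 3"
  by (simp add: xL_xR change_def)

lemma edge_eq: "xL x $ 3 = 0 \<Longrightarrow> xR x = xL x"
  using h3_neg xL3[of x] by (simp add: xL_xR change_def vec_eq_iff forall_3)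

lemma mem_both: "x \<in> TL \<Longrightarrow> x \<in> TR \<Longrightarrow> xL x $ 3 = 0"
  using h3_neg unfolding mem_TL mem_TR
  by (metis xL3 mult_nonpos_nonneg order_antisym less_imp_le)

lemma continuous_on_fL: "continuous_on A fL"
  unfolding fL_def numeral_3_eq_3
  by (intro continuous_intros continuous_on_compose2[OF continuous_on_cut_spline_Suc[of UNIV]] continuous_on_bary_coords) auto

lemma continuous_on_fR: "continuous_on A fR"
  unfolding fR_def numeral_3_eq_3
  by (intro continuous_intros continuous_on_compose2[OF continuous_on_cut_spline_Suc[of UNIV]] continuous_on_bary_coords) auto

lemma continuous_on_DL: "continuous_on A (\<lambda>x. DL x v)"
  unfolding DL_def numeral_2_eq_2
  by (intro continuous_intros continuous_on_compose2[OF continuous_on_cut_spline_Suc[of UNIV]] continuous_on_bary_coords) auto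

lemma continuous_on_DR: "continuous_on A (\<lambda>x. DR x v)"
  unfolding DR_def numeral_2_eq_2
  by (intro continuous_intros continuous_on_compose2[OF continuous_on_cut_spline_Suc[of UNIV]] continuous_on_bary_coords) auto

lemma bary_coords_has_derivative:
  "(bary_coords v1 v2 v3 has_derivative (\<lambda>v. bary_coords v1 v2 v3 v - bary_coords v1 v2 v3 0)) (at x within S)"
proof -
  have lin: "linear (\<lambda>v. bary_coords v1 v2 v3 v - bary_coords v1 v2 v3 0)"
  proof (rule linearI)
    fix x y :: "real ^ 2" and r :: real
    show "bary_coords v1 v2 v3 (x + y) - bary_coords v1 v2 v3 0 = bary_coords v1 v2 v3 x - bary_coords v1 v2 v3 0 + (bary_coords v1 v2 v3 y - bary_coords v1 v2 v3 0)"
      using bary_coords_affine[of v1 v2 v3 x 1 y] by simp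
    show "bary_coords v1 v2 v3 (r *\<^sub>R x) - bary_coords v1 v2 v3 0 = r *\<^sub>R (bary_coords v1 v2 v3 x - bary_coords v1 v2 v3 0)"
      using bary_coords_affine[of v1 v2 v3 0 r x] by simp
  qed
  then have "((\<lambda>x. (bary_coords v1 v2 v3 x - bary_coords v1 v2 v3 0) + bary_coords v1 v2 v3 0) has_derivative (\<lambda>v. (bary_coords v1 v2 v3 v - bary_coords v1 v2 v3 0) + 0)) (at x within S)"
    by (intro has_derivative_add has_derivative_const bounded_linear_imp_has_derivative)
       (simp add: linear_conv_bounded_linear)
  then show ?thesis by simp
qed

lemma fL_has_derivative: "(fL has_derivative DL x) (at x within S)"
proof -
  have "((\<lambda>x. cut_spline 3 (spline_cuts b) (xL x)) has_derivative (\<lambda>v. cut_spline 2 (dir_cuts (lL v) (spline_cuts b)) (xL x))) (at x within S)"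
    unfolding lL_def numeral_3_eq_3 numeral_2_eq_2
    by (rule has_derivative_compose[OF bary_coords_has_derivative cut_spline_has_derivative]) simp
  from has_derivative_mult_right[OF this, of basis_const]
  show ?thesis by (simp add: fL_def[abs_def] DL_def[abs_def])
qed

lemma fR_has_derivative: "(fR has_derivative DR x) (at x within S)"
proof -
  have "((\<lambda>x. cut_spline 3 (spline_cuts b') (xR x)) has_derivative (\<lambda>v. cut_spline 2 (dir_cuts (lR v) (spline_cuts b')) (xR x))) (at x within S)"
    unfolding lR_def numeral_3_eq_3 numeral_2_eq_2
    by (rule has_derivative_compose[OF bary_coords_has_derivative cut_spline_has_derivative]) simp
  from has_derivative_mult_right[OF this, of basis_const]
  show ?thesis by (simp add: fR_def[abs_def] DR_def[abs_def])
qed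

lemma lR_p4: "lR (p4 - x) = vector [- xR x $ 1, - xR x $ 2, 3 - xR x $ 3]"
proof -
  have "p4 = bary_point p1 p2 p4 (vector [0, 0, 3])" by (simp add: bary_point_def)
  then have "xR p4 = vector [0, 0, 3]" using bary_coords_bary_point[OF areaR, of "vector [0, 0, 3]"] by (simp add: coord_sum_def)
  moreover have "xR p4 = xR x + lR (p4 - x)" using xR_ray[of x 1 "p4 - x"] by simp
  ultimately have "lR (p4 - x) = vector [0, 0, 3] - xR x" by (simp add: algebra_simps)
  then show ?thesis by (simp add: vec_eq_iff forall_3)
qed

section \<open>Continuity across the edge\<close>

text \<open>Towards \<open>p4\<close> the third left coordinate is \<open>h3\<close> times a
  positive number, so the segment leaves the left triangle at once and \<open>glue\<close> takes the
  right spline there.\<close>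

lemma glue_right:
  assumes x: "0 \<le> xL x $ 1" "0 \<le> xL x $ 2" "xL x $ 3 = 0" and t: "0 < t" "t \<le> 1"
  shows "x + t *\<^sub>R (p4 - x) \<in> TR - TL" "glue TL sL sR (x + t *\<^sub>R (p4 - x)) = fR (x + t *\<^sub>R (p4 - x))"
proof -
  note e = edge_eq[OF x(3)]
  have y: "xR (x + t *\<^sub>R (p4 - x)) = vector [(1 - t) * xL x $ 1, (1 - t) * xL x $ 2, 3 * t]"
    unfolding xR_ray lR_p4 e using x by (simp add: vec_eq_iff forall_3 algebra_simps)
  have TR: "x + t *\<^sub>R (p4 - x) \<in> TR"
    using x t by (simp add: mem_TR y forall_3)
  have "xL (x + t *\<^sub>R (p4 - x)) $ 3 < 0"
    using t h3_neg by (simp add: xL3 y mult_neg_pos)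
  then have "x + t *\<^sub>R (p4 - x) \<notin> TL" by (auto simp: mem_TL not_le)
  then show "x + t *\<^sub>R (p4 - x) \<in> TR - TL" "glue TL sL sR (x + t *\<^sub>R (p4 - x)) = fR (x + t *\<^sub>R (p4 - x))"
    using TR by (auto simp: glue_def sR_eq)
qed

text \<open>On the common edge \<open>glue\<close> takes the left value, so continuity is tested by
  approaching from the right, along segments towards \<open>p4\<close>. The converse is pasting
  along two closed sets.\<close>

lemma joins_C0_iff_edge:
  "joins_C0 TL TR sL sR \<longleftrightarrow>
    (\<forall>X. 0 \<le> X $ 1 \<longrightarrow> 0 \<le> X $ 2 \<longrightarrow> X $ 3 = 0 \<longrightarrow> coord_sum X = 3 \<longrightarrow>
      cut_spline 3 (spline_cuts b') X = cut_spline 3 (spline_cuts b) X)" (is "_ \<longleftrightarrow> ?E")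
proof
  assume c: "joins_C0 TL TR sL sR"
  show ?E
  proof (intro allI impI)
    fix X :: "real ^ 3" assume X: "0 \<le> X $ 1" "0 \<le> X $ 2" "X $ 3 = 0" "coord_sum X = 3"
    define x where "x = bary_point p1 p2 p3 X"
    have xX: "xL x = X" unfolding x_def by (rule bary_coords_bary_point[OF areaL X(4)])
    have xR: "xR x = X" using edge_eq[of x] X by (simp add: xX)
    have xT: "x \<in> TL" using X by (simp add: mem_TL xX forall_3)
    define t where "t n = inverse (real (Suc n))" for n
    have t: "0 < t n" "t n \<le> 1" for n by (auto simp: t_def field_simps)
    have "t \<longlonglongrightarrow> 0" unfolding t_def by (rule LIMSEQ_inverse_real_of_nat)
    then have lim: "(\<lambda>n. x + t n *\<^sub>R (p4 - x)) \<longlonglongrightarrow> x" by (auto intro!: tendsto_eq_intros)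
    have gr: "x + t n *\<^sub>R (p4 - x) \<in> TR - TL" "glue TL sL sR (x + t n *\<^sub>R (p4 - x)) = fR (x + t n *\<^sub>R (p4 - x))" for n
      using glue_right[of x "t n"] X t by (simp_all add: xX)
    have "(\<lambda>n. glue TL sL sR (x + t n *\<^sub>R (p4 - x))) \<longlonglongrightarrow> glue TL sL sR x"
      using c xT gr(1) lim unfolding joins_C0_def continuous_on_sequentially
      by (auto simp: comp_def)
    then have "(\<lambda>n. fR (x + t n *\<^sub>R (p4 - x))) \<longlonglongrightarrow> fL x"
      using xT by (simp add: gr(2)) (simp add: glue_def sL_eq)
    moreover have "(\<lambda>n. fR (x + t n *\<^sub>R (p4 - x))) \<longlonglongrightarrow> fR x"
      using continuous_on_tendsto_compose[OF continuous_on_fR[of UNIV] lim] by simp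
    ultimately have "fL x = fR x" using LIMSEQ_unique by blast
    then show "cut_spline 3 (spline_cuts b') X = cut_spline 3 (spline_cuts b) X"
      using basis_const_pos by (simp add: fL_def fR_def xX xR)
  qed
next
  assume E: ?E
  have agree: "sL x = sR x" if "x \<in> TL" "x \<in> TR" for x
  proof -
    have "xL x $ 3 = 0" by (rule mem_both[OF that])
    moreover from this have "xR x = xL x" by (rule edge_eq)
    moreover have "0 \<le> xL x $ 1" "0 \<le> xL x $ 2" using that by (simp_all add: mem_TL)
    ultimately show ?thesis
      using E coord_sum_bary_coords[OF areaL, of x] that by (simp add: sL_eq sR_eq fL_def fR_def)
  qed
  have cl: "closed TL" "closed TR"
    by (simp_all add: compact_imp_closed finite_imp_compact_convex_hull)
  have "continuous_on TL sL" using continuous_on_fL[of TL] by (rule continuous_on_eq) (simp add: sL_eq)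
  moreover have "continuous_on TR sR" using continuous_on_fR[of TR] by (rule continuous_on_eq) (simp add: sR_eq)
  ultimately have "continuous_on (TL \<union> TR) (\<lambda>x. if x \<in> TL then sL x else sR x)"
    using agree by (intro continuous_on_cases cl) auto
  then show "joins_C0 TL TR sL sR" by (simp add: joins_C0_def glue_def[abs_def])
qed

lemma joins_C0_iff: "joins_C0 TL TR sL sR \<longleftrightarrow> (\<forall>i\<in>{1, 2, 4, 7, 10, 13}. b' i = b i)"
proof
  assume "joins_C0 TL TR sL sR"
  then show "\<forall>i\<in>{1, 2, 4, 7, 10, 13}. b' i = b i"
    unfolding joins_C0_iff_edge by (intro edge_determines) auto
next
  assume "\<forall>i\<in>{1, 2, 4, 7, 10, 13}. b' i = b i"
  then show "joins_C0 TL TR sL sR"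
    unfolding joins_C0_iff_edge by (auto intro!: edge_agree(1))
qed

section \<open>Continuous differentiability across the edge\<close>

text \<open>The chain rule for \<open>change\<close>: the third axis of the right coordinates is the
  direction \<open>(h1, h2, h3)\<close> in the left ones.\<close>

definition gradient_matches :: bool where
  "gradient_matches \<longleftrightarrow> (\<forall>X. 0 < X $ 1 \<longrightarrow> 0 < X $ 2 \<longrightarrow> X $ 3 = 0 \<longrightarrow> coord_sum X = 3 \<longrightarrow>
       cut_spline 2 (dir_cuts (axis 3 1) (spline_cuts b')) X = h1 * cut_spline 2 (dir_cuts (axis 1 1) (spline_cuts b)) X
        + h2 * cut_spline 2 (dir_cuts (axis 2 1) (spline_cuts b)) X + h3 * cut_spline 2 (dir_cuts (axis 3 1) (spline_cuts b)) X)"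

text \<open>Along the first two axes both derivatives coincide on the edge by
  \<open>edge_agree\<close>, so only the third component of the direction contributes.\<close>

lemma derivative_jump:
  assumes eq: "\<forall>i\<in>{1, 2, 4, 7, 10, 13}. b' i = b i"
    and x: "0 \<le> xL x $ 1" "0 \<le> xL x $ 2" "xL x $ 3 = 0"
  shows "DR x v - DL x v = basis_const * lR v $ 3 *
     (cut_spline 2 (dir_cuts (axis 3 1) (spline_cuts b')) (xL x) - (h1 * cut_spline 2 (dir_cuts (axis 1 1) (spline_cuts b)) (xL x)
        + h2 * cut_spline 2 (dir_cuts (axis 2 1) (spline_cuts b)) (xL x) + h3 * cut_spline 2 (dir_cuts (axis 3 1) (spline_cuts b)) (xL x)))"
  unfolding DR_def DL_def cut_spline_dir_cuts_expand[of 2 "lR v"] cut_spline_dir_cuts_expand[of 2 "lL v"]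
    edge_eq[OF x(3)] edge_agree[OF eq x]
  by (simp add: lL_lR change_def algebra_simps)

lemma mem_open_edge:
  "x \<in> open_segment p1 p2 \<longleftrightarrow> 0 < xL x $ 1 \<and> 0 < xL x $ 2 \<and> xL x $ 3 = 0"
proof
  assume "x \<in> open_segment p1 p2"
  then obtain u where u: "0 < u" "u < 1" "x = (1 - u) *\<^sub>R p1 + u *\<^sub>R p2"
    by (auto simp: in_segment)
  then have "x = bary_point p1 p2 p3 (vector [3 * (1 - u), 3 * u, 0])" by (simp add: bary_point_def)
  then have "xL x = vector [3 * (1 - u), 3 * u, 0]"
    using bary_coords_bary_point[OF areaL, of "vector [3 * (1 - u), 3 * u, 0]"] by (simp add: coord_sum_def)
  then show "0 < xL x $ 1 \<and> 0 < xL x $ 2 \<and> xL x $ 3 = 0" using u by simp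
next
  assume X: "0 < xL x $ 1 \<and> 0 < xL x $ 2 \<and> xL x $ 3 = 0"
  define u where "u = xL x $ 2 / 3"
  have u1: "1 - u = xL x $ 1 / 3" using X coord_sum_bary_coords[OF areaL, of x] by (simp add: coord_sum_def u_def field_simps)
  have "x = (1 - u) *\<^sub>R p1 + u *\<^sub>R p2"
    using X bary_point_bary_coords[OF areaL, of x] by (simp add: bary_point_def u1) (simp add: u_def)
  moreover have "0 < u" "u < 1" using X u1 by (simp_all add: u_def)
  moreover have "p1 \<noteq> p2" using areaL by (auto simp: area2_def)
  ultimately show "x \<in> open_segment p1 p2" by (auto simp: in_segment)
qed

text \<open>Differentiability at each point of the open edge is enough. From \<open>x\<close> the
  ray towards \<open>p4\<close> runs in the right triangle and its opposite starts in the left one,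
  so a single linear \<open>g'\<close> forces \<open>DR x v = DL x v\<close>.\<close>

lemma joins_C1_imp:
  assumes C1: "joins_C1 TL TR (open_segment p1 p2) sL sR"
  shows "gradient_matches"
  unfolding gradient_matches_def
proof (intro allI impI)
  fix X :: "real ^ 3" assume X: "0 < X $ 1" "0 < X $ 2" "X $ 3 = 0" "coord_sum X = 3"
  define x where "x = bary_point p1 p2 p3 X"
  have xX: "xL x = X" unfolding x_def by (rule bary_coords_bary_point[OF areaL X(4)])
  have xT: "x \<in> TL" using X by (simp add: mem_TL xX forall_3)
  have C0: "joins_C0 TL TR sL sR" using C1 by (simp add: joins_C1_def)
  then have eq: "\<forall>i\<in>{1, 2, 4, 7, 10, 13}. b' i = b i" by (simp only: joins_C0_iff)
  have "x \<in> open_segment p1 p2" using X by (simp add: mem_open_edge xX)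
  then obtain g' where g': "(glue TL sL sR has_derivative g') (at x)"
    using C1 unfolding joins_C1_def by blast
  then have lin: "linear g'" by (simp add: has_derivative_linear)
  define v where "v = p4 - x"
  have gx: "glue TL sL sR x = fL x" using xT by (simp add: glue_def sL_eq)
  have "xR x = X" using edge_eq[of x] X by (simp add: xX)
  then have "fR x = fL x"
    using edge_agree(1)[OF eq, of X] X by (simp add: fL_def fR_def xX)
  then have gx': "glue TL sL sR x = fR x" using gx by simp
  have ray: "((\<lambda>t. F (x + t *\<^sub>R w)) has_real_derivative F' w) (at 0 within {0..})"
    if "(F has_derivative F') (at x)" for F :: "real ^ 2 \<Rightarrow> real" and F' w
  proof -
    have "((\<lambda>t. x + t *\<^sub>R w) has_derivative (\<lambda>t. t *\<^sub>R w)) (at (0 :: real) within {0..})"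
      by (auto intro!: derivative_eq_intros)
    from has_derivative_compose[OF this, of F F'] that
    have "((\<lambda>t. F (x + t *\<^sub>R w)) has_derivative (\<lambda>t. F' (t *\<^sub>R w))) (at (0 :: real) within {0..})" by simp
    moreover have "F' (t *\<^sub>R w) = F' w * t" for t
      using has_derivative_linear[OF that] by (simp add: linear_scale)
    ultimately show ?thesis by (simp add: has_field_derivative_def)
  qed
  \<comment> \<open>The glued function equals either formula on one side only, so derivatives are
    compared along half-lines, where they are still unique.\<close>
  have uniq: "F' w = G' w"
    if F: "(F has_derivative F') (at x)" and G: "(G has_derivative G') (at x)"
      and e: "0 < e" "\<And>t. 0 \<le> t \<Longrightarrow> t < e \<Longrightarrow> F (x + t *\<^sub>R w) = G (x + t *\<^sub>R w)"
    for F G :: "real ^ 2 \<Rightarrow> real" and F' G' w e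
  proof -
    have "((\<lambda>t. F (x + t *\<^sub>R w)) has_real_derivative G' w) (at 0 within {0..})"
      by (rule has_field_derivative_transform_within[OF ray[OF G] e(1)]) (auto simp: e(2))
    moreover have "at (0 :: real) within {0..} \<noteq> bot"
      by (simp add: at_within_Ici_at_right)
    ultimately show ?thesis using ray[OF F, of w] has_field_derivative_unique by blast
  qed
  have R: "g' v = DR x v"
  proof (rule uniq[OF g' fR_has_derivative, of 1])
    fix t :: real assume "0 \<le> t" "t < 1"
    then show "glue TL sL sR (x + t *\<^sub>R v) = fR (x + t *\<^sub>R v)"
      using glue_right(2)[of x t] X gx' by (cases "t = 0") (auto simp: v_def xX)
  qed simp
  have L: "g' (- v) = DL x (- v)"
  proof -
    define w where "w = lL v"
    have w3: "w $ 3 < 0"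
      using X h3_neg by (simp add: w_def v_def lL_lR change_def lR_p4 \<open>xR x = X\<close> mult_neg_pos)
    \<comment> \<open>Up to this time the first two left coordinates stay nonnegative on the ray
      towards the left; the added 1 keeps the denominators positive.\<close>
    define e where "e = min (X $ 1 / (1 + \<bar>w $ 1\<bar>)) (X $ 2 / (1 + \<bar>w $ 2\<bar>))"
    have e: "0 < e" using X by (simp add: e_def)
    have "fL (x + t *\<^sub>R (- v)) = glue TL sL sR (x + t *\<^sub>R (- v))" if t: "0 \<le> t" "t < e" for t
    proof -
      have y: "xL (x + t *\<^sub>R (- v)) = X - t *\<^sub>R w"
        using xL_ray[of x "- t" v] by (simp add: xX w_def)
      have "t * w $ i \<le> X $ i" if "t < X $ i / (1 + \<bar>w $ i\<bar>)" for i
      proof -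
        have "t * w $ i \<le> t * (1 + \<bar>w $ i\<bar>)" using t by (intro mult_left_mono) auto
        also have "\<dots> \<le> X $ i" using that by (simp add: field_simps add_pos_nonneg)
        finally show ?thesis .
      qed
      then have "t * w $ 1 \<le> X $ 1" "t * w $ 2 \<le> X $ 2" using t by (simp_all add: e_def)
      moreover have "t * w $ 3 \<le> 0" using t w3 by (simp add: mult_nonneg_nonpos)
      ultimately have "x + t *\<^sub>R (- v) \<in> TL" using X unfolding mem_TL y by (simp add: forall_3)
      then show ?thesis by (simp add: glue_def sL_eq)
    qed
    then show ?thesis using uniq[OF g' fL_has_derivative e, of "- v"] by simp
  qed
  have "DL x (- v) = - DL x v"
    using linear_neg[OF has_derivative_linear[OF fL_has_derivative]] by blast
  then have "DR x v - DL x v = 0" using R L linear_neg[OF lin, of v] by simp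
  moreover have "lR v $ 3 = 3" using X by (simp add: v_def lR_p4 \<open>xR x = X\<close>)
  ultimately show "cut_spline 2 (dir_cuts (axis 3 1) (spline_cuts b')) X = h1 * cut_spline 2 (dir_cuts (axis 1 1) (spline_cuts b)) X
        + h2 * cut_spline 2 (dir_cuts (axis 2 1) (spline_cuts b)) X + h3 * cut_spline 2 (dir_cuts (axis 3 1) (spline_cuts b)) X"
    using derivative_jump[OF eq, of x v] X basis_const_pos by (simp add: xX)
qed

text \<open>One neighbourhood serves all points of the open edge. In it the line through the edge
  separates the two formulas, whose values and derivatives agree on that line.\<close>

lemma joins_C1_if:
  assumes C0: "joins_C0 TL TR sL sR" and gm: "gradient_matches"
  shows "joins_C1 TL TR (open_segment p1 p2) sL sR"
proof -
  have eq: "\<forall>i\<in>{1, 2, 4, 7, 10, 13}. b' i = b i" using C0 by (simp only: joins_C0_iff)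
  \<comment> \<open>Positivity of the first two coordinates in both systems leaves the third
    coordinate to decide which triangle contains a point, and its sign changes between the systems
    by \<open>h3_neg\<close>.\<close>
  define U where "U = {y. 0 < xL y $ 1 \<and> 0 < xL y $ 2 \<and> 0 < xR y $ 1 \<and> 0 < xR y $ 2}"
  define S where "S = {y. 0 \<le> xL y $ 3}"
  have co: "continuous_on UNIV (\<lambda>y. xL y $ i)" "continuous_on UNIV (\<lambda>y. xR y $ i)" for i
    by (intro continuous_intros continuous_on_bary_coords)+
  have U: "open U"
    unfolding U_def by (intro open_Collect_conj open_Collect_less co continuous_on_const)
  have S: "closed S" unfolding S_def by (intro closed_Collect_le co continuous_on_const)
  have S': "closed {y. xL y $ 3 \<le> 0}" by (intro closed_Collect_le co continuous_on_const)
  have cS': "closure (- S) \<subseteq> {y. xL y $ 3 \<le> 0}"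
    by (rule closure_minimal[OF _ S']) (auto simp: S_def)
  have UT: "y \<in> TL \<longleftrightarrow> y \<in> S" "y \<notin> S \<Longrightarrow> y \<in> TR" if "y \<in> U" for y
  proof -
    show "y \<in> TL \<longleftrightarrow> y \<in> S" using that by (auto simp: mem_TL U_def S_def forall_3)
    assume "y \<notin> S"
    then have "0 < xR y $ 3" using h3_neg by (simp add: S_def xL3 not_le mult_less_0_iff)
    then show "y \<in> TR" using that by (simp add: mem_TR U_def forall_3)
  qed
  have glue_eq: "glue TL sL sR y = (if y \<in> S then fL y else fR y)" if "y \<in> U" for y
    using UT[OF that] by (auto simp: glue_def sL_eq sR_eq)
  have edge: "fL y = fR y" "DL y = DR y" if "y \<in> U" "xL y $ 3 = 0" for y
  proof -
    have y: "0 < xL y $ 1" "0 < xL y $ 2" using that by (auto simp: U_def)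
    then show "fL y = fR y"
      using edge_agree(1)[OF eq, of "xL y"] that(2) by (simp add: fL_def fR_def edge_eq[OF that(2)])
    show "DL y = DR y"
    proof
      fix v
      have "DR y v - DL y v = 0"
        using derivative_jump[OF eq _ _ that(2), of v] y gm coord_sum_bary_coords[OF areaL, of y] that(2)
        by (simp add: gradient_matches_def)
      then show "DL y v = DR y v" by simp
    qed
  qed
  define g' where "g' y = (if y \<in> S then DL y else DR y)" for y
  have deriv: "(glue TL sL sR has_derivative g' y) (at y)" if y: "y \<in> U" for y
  proof -
    \<comment> \<open>A point adherent to both halves lies on the line of the edge, where
      \<open>edge\<close> supplies the agreement demanded by the pasting rule.\<close>
    have z: "xL y $ 3 = 0" if "y \<in> closure S" "y \<in> closure (- S)"
      using that S cS' by (auto simp: S_def)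
    have "((\<lambda>x. if x \<in> S then fL x else fR x) has_derivative (if y \<in> S then DL y else DR y)) (at y within (S \<union> - S))"
      using edge[OF y z]
      by (intro has_derivative_If_within_closures fL_has_derivative fR_has_derivative) auto
    then have "((\<lambda>x. if x \<in> S then fL x else fR x) has_derivative g' y) (at y)"
      by (simp add: g'_def)
    then show ?thesis
      by (rule has_derivative_transform_within_open[OF _ U y]) (simp add: glue_eq)
  qed
  have cont: "continuous_on U (\<lambda>y. g' y v)" for v
  proof -
    \<comment> \<open>Two relatively closed pieces overlapping where \<open>xL y $ 3 = 0\<close>.
      Both \<open>DL\<close> and \<open>DR\<close> are continuous on the whole plane, so agreement
      on the overlap suffices.\<close>
    have "U = (U \<inter> S) \<union> (U \<inter> {y. xL y $ 3 \<le> 0})" by (auto simp: S_def)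
    moreover have "continuous_on ((U \<inter> S) \<union> (U \<inter> {y. xL y $ 3 \<le> 0})) (\<lambda>y. if y \<in> S then DL y v else DR y v)"
    proof (rule continuous_on_cases_local)
      show "closedin (top_of_set (U \<inter> S \<union> U \<inter> {y. xL y $ 3 \<le> 0})) (U \<inter> S)"
        using S by (metis calculation closedin_closed_Int)
      show "closedin (top_of_set (U \<inter> S \<union> U \<inter> {y. xL y $ 3 \<le> 0})) (U \<inter> {y. xL y $ 3 \<le> 0})"
        using S' by (metis calculation closedin_closed_Int)
    qed (auto simp: continuous_on_DL continuous_on_DR S_def edge(2))
    ultimately have "continuous_on U (\<lambda>y. if y \<in> S then DL y v else DR y v)" by simp
    then show ?thesis by (simp add: g'_def if_distrib[of "\<lambda>f. f v"])
  qed
  have "\<exists>U. open U \<and> x \<in> U \<and> U \<subseteq> TL \<union> TR \<and>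
        (\<exists>g'. (\<forall>y\<in>U. (glue TL sL sR has_derivative g' y) (at y)) \<and> (\<forall>v. continuous_on U (\<lambda>y. g' y v)))"
    if x: "x \<in> open_segment p1 p2" for x
  proof (intro exI conjI)
    show "open U" by (rule U)
    show "x \<in> U" using x edge_eq[of x] by (auto simp: U_def mem_open_edge)
    show "U \<subseteq> TL \<union> TR" using UT by blast
    show "\<forall>y\<in>U. (glue TL sL sR has_derivative g' y) (at y)" using deriv by blast
    show "\<forall>v. continuous_on U (\<lambda>y. g' y v)" using cont by blast
  qed
  then show ?thesis using C0 unfolding joins_C1_def by blast
qed

lemma joins_C1_iff:
  "joins_C1 TL TR (open_segment p1 p2) sL sR \<longleftrightarrow> joins_C0 TL TR sL sR
      \<and> b' 5 = h1 * b 1 + h2 * b 4 + h3 * b 5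
      \<and> b' 16 = (h1 + h2 / 2) * b 4 + h2 / 2 * b 10 + h3 * b 16
      \<and> b' 19 = (3/5 * h1 + 2/5 * h2) * b 10 + (2/5 * h1 + 3/5 * h2) * b 13 + h3 * b 19
      \<and> b' 17 = (h1 / 2 + h2) * b 7 + h1 / 2 * b 13 + h3 * b 17
      \<and> b' 6 = h1 * b 7 + h2 * b 2 + h3 * b 6" (is "_ \<longleftrightarrow> _ \<and> ?R")
proof -
  have "gradient_matches \<longleftrightarrow> ?R" if "joins_C0 TL TR sL sR"
    unfolding gradient_matches_def using that by (intro edge_gradient_iff h) (simp only: joins_C0_iff)
  moreover have "joins_C0 TL TR sL sR" if "joins_C1 TL TR (open_segment p1 p2) sL sR"
    using that by (simp add: joins_C1_def)
  ultimately show ?thesis using joins_C1_imp joins_C1_if by blast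
qed

end

theorem theorem4p1:
  fixes p1 p2 p3 p4 :: "real ^ 2" and \<eta>1 \<eta>2 \<eta>3 :: real and bL bR :: "nat \<Rightarrow> real"
  assumes "\<not> collinear {p1, p2, p3}" and "\<not> collinear {p1, p2, p4}"
    and "interior (convex hull {p1, p2, p3}) \<inter> interior (convex hull {p1, p2, p4}) = {}"
    and "p4 = \<eta>1 *\<^sub>R p1 + \<eta>2 *\<^sub>R p2 + \<eta>3 *\<^sub>R p3" and "\<eta>1 + \<eta>2 + \<eta>3 = 1"
  shows "(joins_C0 (convex hull {p1, p2, p3}) (convex hull {p1, p2, p4})
            (tri_spline p1 p2 p3 bL) (tri_spline p1 p2 p4 bR)
          \<longleftrightarrow> (\<forall>i\<in>{1, 2, 4, 7, 10, 13}. bR i = bL i))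
       \<and> (joins_C1 (convex hull {p1, p2, p3}) (convex hull {p1, p2, p4}) (open_segment p1 p2)
            (tri_spline p1 p2 p3 bL) (tri_spline p1 p2 p4 bR)
          \<longleftrightarrow> joins_C0 (convex hull {p1, p2, p3}) (convex hull {p1, p2, p4})
                (tri_spline p1 p2 p3 bL) (tri_spline p1 p2 p4 bR)
              \<and> bR 5 = \<eta>1 * bL 1 + \<eta>2 * bL 4 + \<eta>3 * bL 5
              \<and> bR 16 = (\<eta>1 + \<eta>2 / 2) * bL 4 + \<eta>2 / 2 * bL 10 + \<eta>3 * bL 16
              \<and> bR 19 = (3/5 * \<eta>1 + 2/5 * \<eta>2) * bL 10 + (2/5 * \<eta>1 + 3/5 * \<eta>2) * bL 13
                         + \<eta>3 * bL 19
              \<and> bR 17 = (\<eta>1 / 2 + \<eta>2) * bL 7 + \<eta>1 / 2 * bL 13 + \<eta>3 * bL 17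
              \<and> bR 6 = \<eta>1 * bL 7 + \<eta>2 * bL 2 + \<eta>3 * bL 6)"
proof -
  interpret two_triangles p1 p2 p3 p4 \<eta>1 \<eta>2 \<eta>3 bL bR
    using assms by unfold_locales (simp_all add: collinear_area2)
  show ?thesis using joins_C0_iff joins_C1_iff by blast
qed

end
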